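(* Let $M^n$ be a closed manifold and let $g(t)$, $t\in[0,T)$, be a solution of the (unnormalized) Ricci flow $\frac{\partial g}{\partial t}=-2\,Ric(g)$ on $M^n$ with initial metric $g(0)=g_0$. Let $\lambda(t)$ be an evolving eigenvalue of the Laplacian under the flow, with associated normalized evolving eigenfunction $f=f_t$ (see context). Then for all $t\in[0,T)$ $$\frac{d\lambda}{dt}=\lambda\int_M f^2R\,d\mu-\int_M R|\nabla f|^2\,d\mu+2\int_M Ric(\nabla f,\nabla f)\,d\mu,$$ where all geometric quantities are those of $g(t)$.
   Context: $M^n$ is a closed (compact, connected, without boundary) smooth manifold of dimension $n$. For a Riemannian metric $g$, $Ric$ is the Ricci tensor, $R$ the scalar curvature, $d\mu$ the Riemannian measure, $\nabla$ the gradient/Levi-Civita connection, and $\Delta_g=\mathrm{Tr}_g\nabla^2$ the Laplacian on functions; $\lambda$ is an eigenvalue with eigenfunction $f$ if $\Delta_g f+\lambda f=0$, so the spectrum is $0=\lambda_0<\lambda_1\le\lambda_2\le\dots$. An evolving eigenvalue with normalized evolving eigenfunction along a family $g(t)$ means: a real function $\lambda(t)$ and smooth functions $f_t\in C^\infty(M)$, both depending in a continuously differentiable way on $t$ (that is, $\lambda$ is $C^1$ and $t\mapsto f_t$ is a $C^1$ map into $C^\infty(M)$, with one-sided derivatives at $t=0$), such that for every $t$: $\Delta_{g(t)}f_t+\lambda(t)f_t=0$, $\int_M f_t\,d\mu_t=0$ and $\int_M f_t^2\,d\mu_t=1$. In particular $\lambda(t)>0$. The existence of such $C^1$ families is a standing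 assumption. *)

theory Defs
  imports "HOL-Analysis.Analysis"
begin

section \<open>Smooth functions on open subsets of Euclidean space\<close>

definition pd :: "'n::finite \<Rightarrow> (real^'n \<Rightarrow> real) \<Rightarrow> real^'n \<Rightarrow> real" where
  "pd i F x = frechet_derivative F (at x) (axis i 1)"

primrec pds :: "'n::finite list \<Rightarrow> (real^'n \<Rightarrow> real) \<Rightarrow> real^'n \<Rightarrow> real" where
  "pds [] F = F"
| "pds (i # \<alpha>) F = pd i (pds \<alpha> F)"

text \<open>Only used for open \<open>S\<close>, where it is the usual \<open>C\<^sup>\<infinity>\<close>: every iterated partial derivative
  exists and is (Frechet) differentiable, hence continuous.\<close>

definition smooth_on :: "(real^'n::finite) set \<Rightarrow> (real^'n \<Rightarrow> real) \<Rightarrow> bool" where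
  "smooth_on S F \<longleftrightarrow> (\<forall>\<alpha>. pds \<alpha> F differentiable_on S)"

text \<open>Mixed derivatives of a time-dependent function: \<open>None\<close> stands for the time derivative
  (one-sided at an endpoint belonging to the time interval \<open>J\<close>) and \<open>Some i\<close> for the
  \<open>i\<close>-th space derivative.\<close>

primrec mixed_pds ::
  "real set \<Rightarrow> 'n::finite option list \<Rightarrow> (real \<Rightarrow> real^'n \<Rightarrow> real) \<Rightarrow> real \<Rightarrow> real^'n \<Rightarrow> real" where
  "mixed_pds J [] F = F"
| "mixed_pds J (d # \<alpha>) F =
     (case d of
        None \<Rightarrow> (\<lambda>t x. vector_derivative (\<lambda>s. mixed_pds J \<alpha> F s x) (at t within J))
      | Some i \<Rightarrow> (\<lambda>t. pd i (mixed_pds J \<alpha> F t)))"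

definition smooth_in_time_on ::
  "real set \<Rightarrow> (real^'n::finite) set \<Rightarrow> (real \<Rightarrow> real^'n \<Rightarrow> real) \<Rightarrow> bool" where
  "smooth_in_time_on J S F \<longleftrightarrow>
     (\<forall>\<alpha>. (\<lambda>(t, x). mixed_pds J \<alpha> F t x) differentiable_on (J \<times> S))"


section \<open>Closed manifolds\<close>

text \<open>A chart is an open domain together with a coordinate map. The coordinate map is a total
  function whose values outside of the domain are irrelevant.\<close>

type_synonym ('m, 'n) chart = "'m set \<times> ('m \<Rightarrow> real^'n)"

abbreviation cdom :: "('m, 'n::finite) chart \<Rightarrow> 'm set" where
  "cdom c \<equiv> fst c"

abbreviation coord :: "('m, 'n::finite) chart \<Rightarrow> 'm \<Rightarrow> real^'n" where
  "coord c \<equiv> snd c"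

definition cimg :: "('m, 'n::finite) chart \<Rightarrow> (real^'n) set" where
  "cimg c = coord c ` cdom c"

definition cinv :: "('m, 'n::finite) chart \<Rightarrow> real^'n \<Rightarrow> 'm" where
  "cinv c = inv_into (cdom c) (coord c)"

definition is_chart :: "('m::topological_space, 'n::finite) chart \<Rightarrow> bool" where
  "is_chart c \<longleftrightarrow>
     open (cdom c) \<and> open (cimg c) \<and> homeomorphism (cdom c) (cimg c) (coord c) (cinv c)"

text \<open>The atlas is not required to be maximal; it determines the smooth structure.\<close>

definition smooth_atlas :: "('m::topological_space, 'n::finite) chart set \<Rightarrow> bool" where
  "smooth_atlas A \<longleftrightarrow>
     (\<forall>c\<in>A. is_chart c) \<and>
     (\<Union>c\<in>A. cdom c) = UNIV \<and>
     (\<forall>c\<in>A. \<forall>c'\<in>A. \<forall>k.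
        smooth_on (coord c ` (cdom c \<inter> cdom c')) (\<lambda>x. coord c' (cinv c x) $ k))"

text \<open>The points of the manifold form the type \<open>'m\<close>, its dimension is \<open>CARD('n)\<close>.\<close>

definition closed_manifold ::
  "('m::{t2_space, second_countable_topology}, 'n::finite) chart set \<Rightarrow> bool" where
  "closed_manifold A \<longleftrightarrow>
     smooth_atlas A \<and> compact (UNIV :: 'm set) \<and> connected (UNIV :: 'm set)"

text \<open>The coordinate vector field \<open>\<partial>/\<partial>x\<^sup>i\<close> of a chart, acting on functions on the manifold.\<close>

definition cpd :: "('m, 'n::finite) chart \<Rightarrow> 'n \<Rightarrow> ('m \<Rightarrow> real) \<Rightarrow> 'm \<Rightarrow> real" where
  "cpd c i f p = pd i (f \<circ> cinv c) (coord c p)"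

definition Cinf :: "('m, 'n::finite) chart set \<Rightarrow> ('m \<Rightarrow> real) set" where
  "Cinf A = {f. \<forall>c\<in>A. smooth_on (cimg c) (f \<circ> cinv c)}"

text \<open>Convergence in the Frechet space \<open>C\<^sup>\<infinity>(M)\<close>: in every chart all partial derivatives converge
  uniformly on compact sets.\<close>

definition Cinf_tendsto ::
  "('m, 'n::finite) chart set \<Rightarrow> ('b \<Rightarrow> 'm \<Rightarrow> real) \<Rightarrow> ('m \<Rightarrow> real) \<Rightarrow> 'b filter \<Rightarrow> bool" where
  "Cinf_tendsto A F l flt \<longleftrightarrow>
     (\<forall>c\<in>A. \<forall>K \<alpha>. compact K \<and> K \<subseteq> cimg c \<longrightarrow>
        uniform_limit K (\<lambda>s. pds \<alpha> (F s \<circ> cinv c)) (pds \<alpha> (l \<circ> cinv c)) flt)"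

definition C1_into_Cinf ::
  "('m, 'n::finite) chart set \<Rightarrow> real set \<Rightarrow> (real \<Rightarrow> 'm \<Rightarrow> real) \<Rightarrow> bool" where
  "C1_into_Cinf A J f \<longleftrightarrow>
     (\<forall>t\<in>J. f t \<in> Cinf A) \<and>
     (\<exists>h. (\<forall>t\<in>J. h t \<in> Cinf A \<and>
             Cinf_tendsto A (\<lambda>s p. (f s p - f t p) / (s - t)) (h t) (at t within J) \<and>
             Cinf_tendsto A h (h t) (at t within J)))"


section \<open>Riemannian geometry in local coordinates\<close>

text \<open>A covariant 2-tensor field is given by its component matrix in each chart; a vector field by
  its component vector in each chart.\<close>

type_synonym ('m, 'n) tensor2 = "('m, 'n) chart \<Rightarrow> 'm \<Rightarrow> real^'n^'n"
type_synonym ('m, 'n) vfield = "('m, 'n) chart \<Rightarrow> 'm \<Rightarrow> real^'n"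

definition covariant :: "('m, 'n::finite) chart set \<Rightarrow> ('m, 'n) tensor2 \<Rightarrow> bool" where
  "covariant A h \<longleftrightarrow>
     (\<forall>c\<in>A. \<forall>c'\<in>A. \<forall>p\<in>cdom c \<inter> cdom c'. \<forall>i j.
        h c p $ i $ j =
          (\<Sum>k\<in>UNIV. \<Sum>l\<in>UNIV. h c' p $ k $ l *
             cpd c i (\<lambda>q. coord c' q $ k) p * cpd c j (\<lambda>q. coord c' q $ l) p))"

definition riemannian_metric :: "('m, 'n::finite) chart set \<Rightarrow> ('m, 'n) tensor2 \<Rightarrow> bool" where
  "riemannian_metric A g \<longleftrightarrow>
     covariant A g \<and>
     (\<forall>c\<in>A. \<forall>i j. smooth_on (cimg c) (\<lambda>x. g c (cinv c x) $ i $ j)) \<and>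
     (\<forall>c\<in>A. \<forall>p\<in>cdom c.
        (\<forall>i j. g c p $ i $ j = g c p $ j $ i) \<and>
        (\<forall>v. v \<noteq> 0 \<longrightarrow> v \<bullet> (g c p *v v) > 0))"

abbreviation ginv :: "('m, 'n::finite) tensor2 \<Rightarrow> ('m, 'n) chart \<Rightarrow> 'm \<Rightarrow> 'n \<Rightarrow> 'n \<Rightarrow> real" where
  "ginv g c p i j \<equiv> matrix_inv (g c p) $ i $ j"

text \<open>The Christoffel symbol \<open>\<Gamma>\<^sup>k\<^sub>i\<^sub>j\<close> of the Levi-Civita connection.\<close>

definition christoffel ::
  "('m, 'n::finite) tensor2 \<Rightarrow> ('m, 'n) chart \<Rightarrow> 'n \<Rightarrow> 'n \<Rightarrow> 'n \<Rightarrow> 'm \<Rightarrow> real" where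
  "christoffel g c k i j p =
     (1/2) * (\<Sum>l\<in>UNIV. ginv g c p k l *
        (cpd c i (\<lambda>q. g c q $ j $ l) p + cpd c j (\<lambda>q. g c q $ i $ l) p
         - cpd c l (\<lambda>q. g c q $ i $ j) p))"

text \<open>\<open>riemann g c l k i j\<close> is the \<open>\<partial>\<^sub>l\<close>-component of
  \<open>R(\<partial>\<^sub>i, \<partial>\<^sub>j) \<partial>\<^sub>k = \<nabla>\<^sub>i \<nabla>\<^sub>j \<partial>\<^sub>k - \<nabla>\<^sub>j \<nabla>\<^sub>i \<partial>\<^sub>k\<close>. The Ricci tensor \<open>Ric(Y, Z)\<close> is the trace of
  \<open>X \<mapsto> R(X, Y) Z\<close>, so that round spheres have positive Ricci curvature.\<close>

definition riemann ::
  "('m, 'n::finite) tensor2 \<Rightarrow> ('m, 'n) chart \<Rightarrow> 'n \<Rightarrow> 'n \<Rightarrow> 'n \<Rightarrow> 'n \<Rightarrow> 'm \<Rightarrow> real" where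
  "riemann g c l k i j p =
     cpd c i (christoffel g c l j k) p - cpd c j (christoffel g c l i k) p
     + (\<Sum>m\<in>UNIV. christoffel g c l i m p * christoffel g c m j k p
                  - christoffel g c l j m p * christoffel g c m i k p)"

definition ricci :: "('m, 'n::finite) tensor2 \<Rightarrow> ('m, 'n) tensor2" where
  "ricci g c p = (\<chi> j k. \<Sum>i\<in>UNIV. riemann g c i k i j p)"

definition grad :: "('m, 'n::finite) tensor2 \<Rightarrow> ('m \<Rightarrow> real) \<Rightarrow> ('m, 'n) vfield" where
  "grad g f c p = (\<chi> i. \<Sum>j\<in>UNIV. ginv g c p i j * cpd c j f p)"

definition hessian :: "('m, 'n::finite) tensor2 \<Rightarrow> ('m \<Rightarrow> real) \<Rightarrow> ('m, 'n) tensor2" where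
  "hessian g f c p =
     (\<chi> i j. cpd c i (cpd c j f) p - (\<Sum>k\<in>UNIV. christoffel g c k i j p * cpd c k f p))"

definition trace_wrt ::
  "('m, 'n::finite) tensor2 \<Rightarrow> ('m, 'n) tensor2 \<Rightarrow> ('m, 'n) chart \<Rightarrow> 'm \<Rightarrow> real" where
  "trace_wrt g h c p = (\<Sum>i\<in>UNIV. \<Sum>j\<in>UNIV. ginv g c p i j * h c p $ i $ j)"

definition laplacian ::
  "('m, 'n::finite) tensor2 \<Rightarrow> ('m \<Rightarrow> real) \<Rightarrow> ('m, 'n) chart \<Rightarrow> 'm \<Rightarrow> real" where
  "laplacian g f = trace_wrt g (hessian g f)"

text \<open>Coordinate expressions for scalars do not depend on the chart; they become functions on the
  manifold by evaluating them at each point in some chart around it.\<close>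

definition chart_at :: "('m, 'n::finite) chart set \<Rightarrow> 'm \<Rightarrow> ('m, 'n) chart" where
  "chart_at A p = (SOME c. c \<in> A \<and> p \<in> cdom c)"

definition scalar_curvature ::
  "('m, 'n::finite) chart set \<Rightarrow> ('m, 'n) tensor2 \<Rightarrow> 'm \<Rightarrow> real" where
  "scalar_curvature A g p = trace_wrt g (ricci g) (chart_at A p) p"

definition tensor_apply ::
  "('m, 'n::finite) chart set \<Rightarrow> ('m, 'n) tensor2 \<Rightarrow> ('m, 'n) vfield \<Rightarrow> ('m, 'n) vfield \<Rightarrow> 'm \<Rightarrow> real"
  where
  "tensor_apply A h X Y p =
     (let c = chart_at A p in \<Sum>i\<in>UNIV. \<Sum>j\<in>UNIV. h c p $ i $ j * X c p $ i * Y c p $ j)"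

text \<open>The Riemannian measure is the unique Borel measure with density \<open>sqrt (det g\<^sub>i\<^sub>j)\<close> in every
  chart.\<close>

definition is_riemannian_measure ::
  "('m::topological_space, 'n::finite) chart set \<Rightarrow> ('m, 'n) tensor2 \<Rightarrow> 'm measure \<Rightarrow> bool" where
  "is_riemannian_measure A g \<mu> \<longleftrightarrow>
     sets \<mu> = sets borel \<and>
     (\<forall>c\<in>A. \<forall>B\<in>sets borel. B \<subseteq> cdom c \<longrightarrow>
        emeasure \<mu> B =
          (\<integral>\<^sup>+x\<in>coord c ` B. ennreal (sqrt (det (g c (cinv c x)))) \<partial>lborel))"

definition riemannian_measure ::
  "('m::topological_space, 'n::finite) chart set \<Rightarrow> ('m, 'n) tensor2 \<Rightarrow> 'm measure" where
  "riemannian_measure A g = (THE \<mu>. is_riemannian_measure A g \<mu>)"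


section \<open>Ricci flow and evolving eigenvalues\<close>

definition flow_interval :: "ereal \<Rightarrow> real set" where
  "flow_interval T = {t. 0 \<le> t \<and> ereal t < T}"

definition ricci_flow ::
  "('m, 'n::finite) chart set \<Rightarrow> real set \<Rightarrow> (real \<Rightarrow> ('m, 'n) tensor2) \<Rightarrow> bool" where
  "ricci_flow A J g \<longleftrightarrow>
     (\<forall>t\<in>J. riemannian_metric A (g t)) \<and>
     (\<forall>c\<in>A. \<forall>i j. smooth_in_time_on J (cimg c) (\<lambda>t x. g t c (cinv c x) $ i $ j)) \<and>
     (\<forall>t\<in>J. \<forall>c\<in>A. \<forall>p\<in>cdom c. \<forall>i j.
        ((\<lambda>s. g s c p $ i $ j) has_real_derivative - 2 * ricci (g t) c p $ i $ j) (at t within J))"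

definition eigenfunction ::
  "('m, 'n::finite) chart set \<Rightarrow> ('m, 'n) tensor2 \<Rightarrow> real \<Rightarrow> ('m \<Rightarrow> real) \<Rightarrow> bool" where
  "eigenfunction A g l f \<longleftrightarrow>
     f \<in> Cinf A \<and> (\<forall>c\<in>A. \<forall>p\<in>cdom c. laplacian g f c p + l * f p = 0)"

definition evolving_eigenvalue ::
  "('m::topological_space, 'n::finite) chart set \<Rightarrow> real set \<Rightarrow> (real \<Rightarrow> ('m, 'n) tensor2) \<Rightarrow>
   (real \<Rightarrow> real) \<Rightarrow> (real \<Rightarrow> 'm \<Rightarrow> real) \<Rightarrow> bool" where
  "evolving_eigenvalue A J g lam f \<longleftrightarrow>
     (\<exists>lam'. continuous_on J lam' \<and>
        (\<forall>t\<in>J. (lam has_real_derivative lam' t) (at t within J))) \<and>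
     C1_into_Cinf A J f \<and>
     (\<forall>t\<in>J. eigenfunction A (g t) (lam t) (f t) \<and>
        (\<integral>p. f t p \<partial>riemannian_measure A (g t)) = 0 \<and>
        (\<integral>p. (f t p)\<^sup>2 \<partial>riemannian_measure A (g t)) = 1)"

end

theory Submission
  imports Defs
begin

text \<open>Only the weak form of the eigenvalue equation is differentiated, so the time derivative of
  the eigenfunction never enters. Write \<open>f = f\<^sub>t\<close>. Green's identity for \<open>g(s)\<close>, tested against
  \<open>f\<close>, and for \<open>g(t)\<close>, tested against \<open>f\<^sub>s\<close>, gives
  \<open>\<lambda>(s) \<integral> f\<^sub>s f d\<mu>\<^sub>s = \<integral> \<langle>\<nabla>f\<^sub>s, \<nabla>f\<rangle>\<^sub>s d\<mu>\<^sub>s\<close> and \<open>\<lambda>(t) \<integral> f\<^sub>s f d\<mu>\<^sub>t = \<integral> \<langle>\<nabla>f\<^sub>s, \<nabla>f\<rangle>\<^sub>t d\<mu>\<^sub>t\<close>.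
  Subtracting and dividing by \<open>s - t\<close>, the pair \<open>f\<^sub>s, f\<close> is the same in both energies and in both
  masses, so in the limit only the derivatives of the density \<open>sqrt (det g)\<close> (namely \<open>- R\<close> times it)
  and of the inverse metric (namely \<open>2 Ric\<close> with raised indices) remain. The integrals
  are split by a \<open>C\<^sup>1\<close> partition of unity into integrals over coordinate boxes, where the difference
  quotients converge uniformly.\<close>

section \<open>Change of variables for arbitrary finite index types\<close>

text \<open>Two encodings shape the proof. Tensors are families of component matrices, and scalars
  are read off in the chart picked by \<open>chart_at\<close>, so each contraction under an integral
  must first be shown chart independent. The measure is a definite description, so existence and
  uniqueness come before any integral can be computed; the charts are compatible because covariance
  multiplies \<open>det g\<close> by the square of the Jacobian determinant, which matches the
  change of variables formula. The weak form differentiates its test function only once in space, so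
  cut-offs need only be \<open>C1\<close>. Write X(s,r) for the integral of f_s f_t against the
  measure of g(r). Then lam(s) X(s,s) - lam(t) X(s,t) = (lam(s) - lam(t)) X(s,s) + lam(t) (X(s,s) -
  X(s,t)), and the normalisation makes X(s,s) tend to 1, so the quotient of lam can be isolated. The
  derivative of the density enters twice, through the mass and through the energy; hence the two
  integrals of R with opposite signs.\<close>

typedef 'a ord_copy = "UNIV :: 'a set" ..

lemma bij_Rep_ord_copy: "bij (Rep_ord_copy :: 'a ord_copy \<Rightarrow> 'a)"
  by (metis Abs_ord_copy_inverse Rep_ord_copy_inject UNIV_I bijI inj_onI surj_def)

instance ord_copy :: (finite) finite
proof
  have "bij (Rep_ord_copy :: 'a::finite ord_copy \<Rightarrow> 'a)"
    by (rule bij_Rep_ord_copy)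
  then show "finite (UNIV :: 'a ord_copy set)"
    by (simp add: bij_betw_finite)
qed

text \<open>Any injection into \<open>nat\<close> will do: it pulls back a well-order. The order
  lives on a fresh copy of the index type so that it cannot clash with an order the index type
  already carries.\<close>

definition ord_copy_rank :: "'a::finite ord_copy \<Rightarrow> nat" where
  "ord_copy_rank = (SOME r. inj r)"

lemma inj_ord_copy_rank: "inj (ord_copy_rank :: 'a::finite ord_copy \<Rightarrow> nat)"
proof -
  obtain r :: "'a ord_copy \<Rightarrow> nat" where "inj r"
    using finite_imp_inj_to_nat_seg[of "UNIV :: 'a ord_copy set"] by auto
  then show ?thesis
    unfolding ord_copy_rank_def by (rule someI[where P = inj])
qed

instantiation ord_copy :: (finite) wellorder
begin

definition less_eq_ord_copy :: "'a ord_copy \<Rightarrow> 'a ord_copy \<Rightarrow> bool" where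
  "x \<le> y \<longleftrightarrow> ord_copy_rank x \<le> ord_copy_rank y"

definition less_ord_copy :: "'a ord_copy \<Rightarrow> 'a ord_copy \<Rightarrow> bool" where
  "x < y \<longleftrightarrow> ord_copy_rank x < ord_copy_rank y"

instance
proof
  fix P :: "'a ord_copy \<Rightarrow> bool" and a
  assume step: "\<And>x. (\<And>y. y < x \<Longrightarrow> P y) \<Longrightarrow> P x"
  show "P a"
  proof (induction a rule: measure_induct_rule[of ord_copy_rank])
    case (less x)
    show ?case
      by (rule step, rule less) (simp add: less_ord_copy_def)
  qed
qed (auto simp: less_eq_ord_copy_def less_ord_copy_def dest: injD[OF inj_ord_copy_rank])

end

text \<open>Conjugation by \<open>e\<close> is a sign-preserving bijection between the two
  permutation groups, so it reindexes the Leibniz sum.\<close>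

lemma det_reindex:
  fixes M :: "real^'n::finite^'n" and e :: "'m::finite \<Rightarrow> 'n"
  assumes "bij e"
  shows "det (\<chi> i j. M $ e i $ e j) = det M"
proof -
  have inj: "inj e" and surj: "surj e"
    using assms by (auto simp: bij_def)
  have bij: "bij_betw (map_permutation UNIV e) {p. p permutes UNIV} {p. p permutes UNIV}"
    using map_permutation_permutes  bij_betw_permutations[OF assms]
    by (simp add: map_permutation_def[abs_def] surj restrict_id_def surj)
  have "det M = (\<Sum>p\<in>{p. p permutes (UNIV :: 'm set)}.
     of_int (sign (map_permutation UNIV e p)) * (\<Prod>i\<in>UNIV. M $ i $ map_permutation UNIV e p i))"
    unfolding det_def by (rule sum.reindex_bij_betw[OF bij, symmetric])
  also have "\<dots> = det (\<chi> i j. M $ e i $ e j)"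
    unfolding det_def
  proof (rule sum.cong[OF refl])
    fix p :: "'m \<Rightarrow> 'm" assume "p \<in> {p. p permutes UNIV}"
    then have "sign (map_permutation UNIV e p) = sign p"
      by (intro sign_map_permutation[OF inj]) auto
    moreover have "(\<Prod>i\<in>UNIV. M $ i $ map_permutation UNIV e p i) = (\<Prod>i\<in>UNIV. M $ e i $ e (p i))"
      by (subst prod.reindex_bij_betw[OF assms, symmetric])
        (auto simp: map_permutation_def restrict_id_def surj inj)
    ultimately show "of_int (sign (map_permutation UNIV e p)) *
        (\<Prod>i\<in>UNIV. M $ i $ map_permutation UNIV e p i) =
        of_int (sign p) * (\<Prod>i\<in>UNIV. (\<chi> i j. M $ e i $ e j) $ i $ p i)"
      by simp
  qed
  finally show ?thesis by simp
qed

definition vec_reindex :: "('m \<Rightarrow> 'n) \<Rightarrow> real^'n \<Rightarrow> real^'m" where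
  "vec_reindex e x = (\<chi> i. x $ e i)"

lemma linear_vec_reindex: "linear (vec_reindex e)"
  by (rule linearI) (auto simp: vec_reindex_def vec_eq_iff)

lemma borel_measurable_vec_reindex [measurable]: "vec_reindex e \<in> borel_measurable borel"
  by (intro borel_measurable_continuous_onI linear_continuous_on linear_conv_bounded_linear[THEN iffD1]
      linear_vec_reindex)

lemma vec_reindex_inv:
  assumes "bij e"
  shows "vec_reindex e (vec_reindex (inv e) x) = x" "vec_reindex (inv e) (vec_reindex e y) = y"
  using assms by (auto simp: vec_reindex_def vec_eq_iff bij_is_inj bij_is_surj surj_f_inv_f)

lemma prod_Basis_cart:
  "(\<Prod>b\<in>Basis. f b) = (\<Prod>i\<in>UNIV. f (axis i 1))" for f :: "real^'n::finite \<Rightarrow> 'b::comm_monoid_mult"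
proof -
  have "Basis = range (\<lambda>i. axis i 1 :: real^'n)"
    by (auto simp: Basis_vec_def)
  moreover have "inj (\<lambda>i. axis i 1 :: real^'n)"
    by (auto simp: inj_on_def axis_eq_axis)
  ultimately show ?thesis
    by (metis (no_types, lifting) prod.cong prod.reindex_cong)
qed

text \<open>Relabelling coordinates maps boxes to boxes with the same side lengths, and Lebesgue
  measure is determined by its values on boxes.\<close>

lemma lborel_distr_vec_reindex:
  fixes e :: "'m::finite \<Rightarrow> 'n::finite"
  assumes "bij e"
  shows "distr lborel borel (vec_reindex e) = lborel"
proof (rule lborel_eqI[symmetric])
  fix l u :: "real^'m" assume le: "\<And>b. b \<in> Basis \<Longrightarrow> l \<bullet> b \<le> u \<bullet> b"
  have le': "l $ i \<le> u $ i" for i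
    using le[of "axis i 1"] by (simp add: inner_axis axis_in_Basis_iff)
  have surj: "surj e"
    using assms by (simp add: bij_is_surj)
  have "(\<forall>i. l $ i < x $ e i \<and> x $ e i < u $ i) \<longleftrightarrow>
      (\<forall>j. l $ inv e j < x $ j \<and> x $ j < u $ inv e j)" for x
    using surj_f_inv_f[OF surj] inv_f_f[OF bij_is_inj[OF assms]] by metis
  then have "vec_reindex e -` box l u = box (vec_reindex (inv e) l) (vec_reindex (inv e) u)"
    by (auto simp: mem_box_cart vec_reindex_def)
  then have "emeasure (distr lborel borel (vec_reindex e)) (box l u)
      = emeasure lborel (box (vec_reindex (inv e) l) (vec_reindex (inv e) u))"
    by (simp add: emeasure_distr)
  also have "\<dots> = ennreal (\<Prod>b\<in>Basis. (vec_reindex (inv e) u - vec_reindex (inv e) l) \<bullet> b)"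
    by (rule emeasure_lborel_box) (auto simp: Basis_vec_def inner_axis vec_reindex_def le')
  also have "(\<Prod>b\<in>Basis. (vec_reindex (inv e) u - vec_reindex (inv e) l) \<bullet> b)
     = (\<Prod>i\<in>UNIV. (u - l) $ inv e i)"
    by (simp add: prod_Basis_cart inner_axis vec_reindex_def)
  also have "\<dots> = (\<Prod>i\<in>UNIV. (u - l) $ i)"
    using prod.reindex_bij_betw[OF bij_imp_bij_inv[OF assms], of "\<lambda>i. (u - l) $ i"] by simp
  also have "\<dots> = (\<Prod>b\<in>Basis. (u - l) \<bullet> b)"
    by (simp add: prod_Basis_cart inner_axis)
  finally show "emeasure (distr lborel borel (vec_reindex e)) (box l u) = ennreal (\<Prod>b\<in>Basis. (u - l) \<bullet> b)" .
qed simp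


text \<open>Translates between the Lebesgue integral of a nonnegative function and the absolutely
  integrable gauge integral, in which the change of variables theorem is phrased.\<close>

lemma nn_integral_eq_iff_absolutely_integrable:
  fixes u :: "'a::euclidean_space \<Rightarrow> real"
  assumes "(\<lambda>x. indicator S x * u x) \<in> borel_measurable borel" and nn: "\<And>x. x \<in> S \<Longrightarrow> 0 \<le> u x"
    and b: "0 \<le> b"
  shows "(\<integral>\<^sup>+x\<in>S. ennreal (u x) \<partial>lborel) = ennreal b \<longleftrightarrow> u absolutely_integrable_on S \<and> integral S u = b"
proof
  have eq: "(\<integral>\<^sup>+x\<in>S. ennreal (u x) \<partial>lborel) = (\<integral>\<^sup>+x. ennreal (indicator S x * u x) \<partial>lborel)"
    by (rule nn_integral_cong) (auto simp: indicator_def)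
  {
    assume "(\<integral>\<^sup>+x\<in>S. ennreal (u x) \<partial>lborel) = ennreal b"
    then have "((\<lambda>x. indicator S x * u x) has_integral b) UNIV"
      unfolding eq using nn b
      by (intro nn_integral_has_integral[OF assms(1)]) (auto simp: indicator_def)
    moreover have "(\<lambda>x. indicator S x * u x) = (\<lambda>x. if x \<in> S then u x else 0)"
      by (auto simp: indicator_def)
    ultimately have "(u has_integral b) S"
      by (simp add: has_integral_restrict_UNIV)
    then show "u absolutely_integrable_on S \<and> integral S u = b"
      using nn by (auto simp: has_integral_iff intro: nonnegative_absolutely_integrable_1)
  }
  {
    assume "u absolutely_integrable_on S \<and> integral S u = b"
    then have "(u has_integral b) S"
      by (auto simp: has_integral_iff absolutely_integrable_on_def)
    then show "(\<integral>\<^sup>+x\<in>S. ennreal (u x) \<partial>lborel) = ennreal b"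
      unfolding eq using nn_integral_has_integral_lebesgue[of S u] nn by simp
  }
qed

lemma nn_integral_change_of_variables_wellorder:
  fixes \<tau> :: "real^'m::{finite,wellorder} \<Rightarrow> real^'m::_" and F :: "real^'m::_ \<Rightarrow> real"
  assumes S: "S \<in> sets borel"
    and der: "\<And>x. x \<in> S \<Longrightarrow> (\<tau> has_derivative \<tau>' x) (at x within S)"
    and inj: "inj_on \<tau> S"
    and F: "(\<lambda>y. indicator (\<tau> ` S) y * F y) \<in> borel_measurable borel"
    and F0: "\<And>y. y \<in> \<tau> ` S \<Longrightarrow> 0 \<le> F y"
    and meas: "(\<lambda>x. indicator S x * (\<bar>det (matrix (\<tau>' x))\<bar> * F (\<tau> x))) \<in> borel_measurable borel"
  shows "(\<integral>\<^sup>+y\<in>\<tau> ` S. ennreal (F y) \<partial>lborel) =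
    (\<integral>\<^sup>+x\<in>S. ennreal (\<bar>det (matrix (\<tau>' x))\<bar> * F (\<tau> x)) \<partial>lborel)" (is "?L = ?R")
proof -
  let ?D = "\<lambda>x. \<bar>det (matrix (\<tau>' x))\<bar> * F (\<tau> x)"
  have key: "?D absolutely_integrable_on S \<and> integral S ?D = b \<longleftrightarrow>
      F absolutely_integrable_on (\<tau> ` S) \<and> integral (\<tau> ` S) F = b" for b
  proof -
    have "S \<in> sets lebesgue"
      using S by simp
    \<comment> \<open>The theorem speaks of vector-valued integrands, so the scalar function is
      viewed in \<open>real^1\<close> and then read back.\<close>
    note * = has_absolute_integral_change_of_variables[OF this der inj, of "\<lambda>x. vec (F x) :: real^1" "vec b"]
    have "(\<lambda>x. \<bar>det (matrix (\<tau>' x))\<bar> *\<^sub>R vec (F (\<tau> x)) :: real^1) = (\<lambda>x. vec (?D x))"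
      by (auto simp: vec_eq_iff)
    with * show ?thesis
      by (auto simp: absolutely_integrable_on_1_iff integral_on_1_eq absolutely_integrable_on_def vec_eq_iff)
  qed
  \<comment> \<open>Both sides take the same finite values; the case split below concludes that they
    are also infinite together.\<close>
  have iff: "?R = ennreal b \<longleftrightarrow> ?L = ennreal b" if "0 \<le> b" for b
    by (subst (1 2) nn_integral_eq_iff_absolutely_integrable)
       (use key that F F0 meas in auto)
  show ?thesis
  proof (cases ?R)
    case (real b)
    then have "?L = ennreal b"
      using iff[of b] by blast
    with real show ?thesis
      by simp
  next
    case top
    show ?thesis
    proof (cases ?L)
      case (real b)
      then have "?R = ennreal b"
        using iff[of b] by blast
      with real show ?thesis
        by simp
    qed (use top in simp)
  qed
qed

lemma nn_integral_lborel_reindex: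
  fixes e :: "'m::finite \<Rightarrow> 'n::finite"
  assumes e: "bij e" and u: "u \<in> borel_measurable borel"
  shows "(\<integral>\<^sup>+x. u (vec_reindex e x) \<partial>lborel) = (\<integral>\<^sup>+y. u y \<partial>lborel)"
proof -
  have "(\<integral>\<^sup>+y. u y \<partial>lborel) = (\<integral>\<^sup>+y. u y \<partial>distr lborel borel (vec_reindex e))"
    by (simp add: lborel_distr_vec_reindex[OF e])
  also have "\<dots> = (\<integral>\<^sup>+x. u (vec_reindex e x) \<partial>lborel)"
    by (rule nn_integral_distr) (use u in simp_all)
  finally show ?thesis by simp
qed

text \<open>The library proves the change of variables formula only for well-ordered index types;
  it is transported along a bijection fm a well-ordered copy of the index type.\<close>

lemma nn_integral_change_of_variables:
  fixes \<tau> :: "real^'n::finite \<Rightarrow> real^'n" and F :: "real^'n \<Rightarrow> real"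
  assumes S: "S \<in> sets borel"
    and der: "\<And>x. x \<in> S \<Longrightarrow> (\<tau> has_derivative \<tau>' x) (at x within S)"
    and inj: "inj_on \<tau> S"
    and F: "(\<lambda>y. indicator (\<tau> ` S) y * F y) \<in> borel_measurable borel"
    and F0: "\<And>y. y \<in> \<tau> ` S \<Longrightarrow> 0 \<le> F y"
    and meas: "(\<lambda>x. indicator S x * (\<bar>det (matrix (\<tau>' x))\<bar> * F (\<tau> x))) \<in> borel_measurable borel"
  shows "(\<integral>\<^sup>+y\<in>\<tau> ` S. ennreal (F y) \<partial>lborel) =
    (\<integral>\<^sup>+x\<in>S. ennreal (\<bar>det (matrix (\<tau>' x))\<bar> * F (\<tau> x)) \<partial>lborel)"
proof -
  define e where "e = (Rep_ord_copy :: 'n ord_copy \<Rightarrow> 'n)"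
  have e: "bij e"
    unfolding e_def by (rule bij_Rep_ord_copy)
  define to where "to = (vec_reindex e :: real^'n \<Rightarrow> real^'n ord_copy)"
  define fm where "fm = (vec_reindex (inv e) :: real^'n ord_copy \<Rightarrow> real^'n)"
  have tf [simp]: "to (fm x) = x" and ft [simp]: "fm (to y) = y" for x y
    unfolding to_def fm_def using vec_reindex_inv[OF e] by auto
  have lin: "linear to" "linear fm"
    unfolding to_def fm_def by (rule linear_vec_reindex)+
  have [measurable]: "to \<in> borel_measurable borel" "fm \<in> borel_measurable borel"
    unfolding to_def fm_def by measurable
  define \<sigma> where "\<sigma> = to \<circ> \<tau> \<circ> fm"
  define \<sigma>' where "\<sigma>' = (\<lambda>x. to \<circ> \<tau>' (fm x) \<circ> fm)"
  define S' where "S' = fm -` S"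
  have S'_eq: "S' = to ` S"
    unfolding S'_def by (auto simp: image_iff) (metis tf)
  have ind_S: "indicator S' x = indicator S (fm x)" for x
    unfolding S'_def by (simp add: indicator_def)
  have im: "\<sigma> ` S' = to ` \<tau> ` S"
    unfolding S'_eq \<sigma>_def image_comp by (simp add: o_def)
  have ind_im: "indicator (\<sigma> ` S') y = indicator (\<tau> ` S) (fm y)" for y
    unfolding im by (auto simp: indicator_def image_iff) (metis tf)+
  have S'_borel: "S' \<in> sets borel"
    unfolding S'_def using measurable_sets_borel[of "fm" borel S] S by simp
  \<comment> \<open>Relabelling permutes rows and columns of the Jacobian matrix simultaneously,
    which keeps its determinant.\<close>
  have mat: "det (matrix (\<sigma>' x)) = det (matrix (\<tau>' (fm x)))" for x
  proof -
    have "fm (axis j 1) = axis (e j) 1" for j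
      unfolding fm_def vec_reindex_def vec_eq_iff axis_def
      using bij_is_surj[OF e] bij_is_inj[OF e] by (auto simp: surj_f_inv_f)
    then have "matrix (\<sigma>' x) = (\<chi> i j. matrix (\<tau>' (fm x)) $ e i $ e j)"
      by (simp add: matrix_def \<sigma>'_def to_def vec_reindex_def)
    then show ?thesis
      using det_reindex[OF e] by simp
  qed
  have "(\<integral>\<^sup>+y\<in>\<tau> ` S. ennreal (F y) \<partial>lborel) = (\<integral>\<^sup>+y. ennreal (indicator (\<tau> ` S) y * F y) \<partial>lborel)"
    by (rule nn_integral_cong) (auto simp: indicator_def)
  also have "\<dots> = (\<integral>\<^sup>+y. ennreal (indicator (\<tau> ` S) (fm y) * F (fm y)) \<partial>lborel)"
    unfolding fm_def
    by (rule nn_integral_lborel_reindex[OF bij_imp_bij_inv[OF e], symmetric]) (use F in simp)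
  also have "\<dots> = (\<integral>\<^sup>+y\<in>\<sigma> ` S'. ennreal (F (fm y)) \<partial>lborel)"
    by (rule nn_integral_cong) (simp only: ind_im, auto simp: indicator_def)
  also have "\<dots> = (\<integral>\<^sup>+x\<in>S'. ennreal (\<bar>det (matrix (\<sigma>' x))\<bar> * F (fm (\<sigma> x))) \<partial>lborel)"
  proof (rule nn_integral_change_of_variables_wellorder[OF S'_borel])
    show "(\<sigma> has_derivative \<sigma>' x) (at x within S')" if "x \<in> S'" for x
    proof -
      have "(fm has_derivative fm) (at x within S')" "(to has_derivative to) (at z within T)" for z T
        using lin by (auto intro!: linear_imp_has_derivative)
      moreover have "(\<tau> has_derivative \<tau>' (fm x)) (at (fm x) within fm ` S')"
        using der[of "fm x"] that unfolding S'_def by (auto elim: has_derivative_subset)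
      ultimately show ?thesis
        unfolding \<sigma>_def \<sigma>'_def by (intro diff_chain_within) auto
    qed
    show "inj_on \<sigma> S'"
      unfolding S'_def \<sigma>_def using inj by (auto simp: inj_on_def) (metis ft tf)
    have "(\<lambda>y. indicator (\<tau> ` S) (fm y) * F (fm y)) \<in> borel_measurable borel"
      by (rule measurable_compose[OF _ F]) simp
    then show "(\<lambda>y. indicator (\<sigma> ` S') y * F (fm y)) \<in> borel_measurable borel"
      by (simp only: ind_im)
    show "0 \<le> F (fm y)" if "y \<in> \<sigma> ` S'" for y
      using that F0 unfolding im by auto
    have "(\<lambda>x. indicator S (fm x) * (\<bar>det (matrix (\<tau>' (fm x)))\<bar> * F (\<tau> (fm x)))) \<in> borel_measurable borel"
      by (rule measurable_compose[OF _ meas]) simp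
    then show "(\<lambda>x. indicator S' x * (\<bar>det (matrix (\<sigma>' x))\<bar> * F (fm (\<sigma> x)))) \<in> borel_measurable borel"
      by (simp only: ind_S mat) (simp add: \<sigma>_def)
  qed
  also have "\<dots> = (\<integral>\<^sup>+x. ennreal (indicator S (fm x) * (\<bar>det (matrix (\<tau>' (fm x)))\<bar> * F (\<tau> (fm x)))) \<partial>lborel)"
    by (rule nn_integral_cong) (simp only: ind_S mat, auto simp: \<sigma>_def indicator_def)
  also have "\<dots> = (\<integral>\<^sup>+x. ennreal (indicator S x * (\<bar>det (matrix (\<tau>' x))\<bar> * F (\<tau> x))) \<partial>lborel)"
    unfolding fm_def
    by (rule nn_integral_lborel_reindex[OF bij_imp_bij_inv[OF e]]) (use meas in simp)
  also have "\<dots> = (\<integral>\<^sup>+x\<in>S. ennreal (\<bar>det (matrix (\<tau>' x))\<bar> * F (\<tau> x)) \<partial>lborel)"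
    by (rule nn_integral_cong) (auto simp: indicator_def)
  finally show ?thesis .
qed

section \<open>Derivatives of determinants and inverse matrices\<close>

lemma matrix_inv_mult:
  fixes M :: "real^'n::finite^'n"
  assumes "det M \<noteq> 0"
  shows "matrix_inv M ** M = mat 1" "M ** matrix_inv M = mat 1"
proof -
  have "\<exists>N. M ** N = mat 1 \<and> N ** M = mat 1"
    using assms by (simp add: invertible_det_nz[symmetric] invertible_def)
  then have "M ** matrix_inv M = mat 1 \<and> matrix_inv M ** M = mat 1"
    unfolding matrix_inv_def by (rule someI_ex)
  then show "matrix_inv M ** M = mat 1" "M ** matrix_inv M = mat 1"
    by auto
qed

lemma matrix_inv_unique:
  fixes M :: "real^'n::finite^'n"
  assumes "M ** N = mat 1"
  shows "matrix_inv M = N"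
proof -
  have "det M * det N = 1"
    using arg_cong[OF assms, of det] by (simp add: det_mul)
  then have "det M \<noteq> 0"
    by auto
  then have "matrix_inv M = matrix_inv M ** (M ** N)"
    by (simp add: assms)
  then show ?thesis
    using matrix_inv_mult[OF \<open>det M \<noteq> 0\<close>] by (simp add: matrix_mul_assoc)
qed

lemma symmetric_matrix_inv:
  fixes M :: "real^'n::finite^'n"
  assumes "det M \<noteq> 0" and "transpose M = M"
  shows "transpose (matrix_inv M) = matrix_inv M"
proof -
  have "M ** transpose (matrix_inv M) = transpose (matrix_inv M ** M)"
    by (simp add: matrix_transpose_mul assms)
  then show ?thesis
    using matrix_inv_unique[of M "transpose (matrix_inv M)"] matrix_inv_mult[OF assms(1)]
    by (simp add: transpose_mat)
qed

text \<open>Each entry becomes a quotient of determinants, so differentiability and continuity of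
  the inverse reduce to those of polynomials in the entries.\<close>

lemma matrix_inv_cramer:
  fixes M :: "real^'n::finite^'n"
  assumes "det M \<noteq> 0"
  shows "matrix_inv M $ i $ j = det (\<chi> a b. if b = i then axis j 1 $ a else M $ a $ b) / det M"
proof -
  have "M *v (matrix_inv M *v axis j 1) = axis j 1"
    using matrix_inv_mult[OF assms] by (simp add: matrix_vector_mul_assoc)
  then have "(matrix_inv M *v axis j 1) $ i
      = det (\<chi> a b. if b = i then axis j 1 $ a else M $ a $ b) / det M"
    using cramer[OF assms, of "matrix_inv M *v axis j 1" "axis j 1"] by (simp add: vec_eq_iff)
  then show ?thesis
    by (simp add: matrix_vector_mult_basis column_def)
qed

text \<open>Indexing the product by columns makes the replacement of one column affect exactly one
  factor.\<close>

lemma det_columns: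
  fixes M :: "real^'n::finite^'n"
  shows "det M = (\<Sum>p\<in>{p. p permutes UNIV}. of_int (sign p) * (\<Prod>c\<in>UNIV. M $ p c $ c))"
  using det_transpose[of M] by (simp add: det_def transpose_def)

text \<open>Product rule in every Leibniz term; the terms whose differentiated factor lies in column
  \<open>k\<close> form a determinant again.\<close>

lemma has_real_derivative_det_columns:
  fixes M :: "real \<Rightarrow> real^'n::finite^'n"
  assumes "\<And>i j. ((\<lambda>s. M s $ i $ j) has_real_derivative D $ i $ j) (at t within J)"
  shows "((\<lambda>s. det (M s)) has_real_derivative
    (\<Sum>k\<in>UNIV. det (\<chi> r c. if c = k then D $ r $ k else M t $ r $ c))) (at t within J)"
proof -
  have prod: "((\<lambda>s. \<Prod>c\<in>UNIV. M s $ p c $ c) has_real_derivative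
      (\<Sum>k\<in>UNIV. D $ p k $ k * (\<Prod>c\<in>UNIV - {k}. M t $ p c $ c))) (at t within J)" for p :: "'n \<Rightarrow> 'n"
  proof -
    have "((\<lambda>s. M s $ p c $ c) has_derivative (\<lambda>h. D $ p c $ c * h)) (at t within J)" for c
      using assms unfolding has_field_derivative_def .
    then have "((\<lambda>s. \<Prod>c\<in>UNIV. M s $ p c $ c) has_derivative
      (\<lambda>h. \<Sum>k\<in>UNIV. (D $ p k $ k * h) * (\<Prod>c\<in>UNIV - {k}. M t $ p c $ c))) (at t within J)"
      by (rule has_derivative_prod)
    moreover have "(\<lambda>h. \<Sum>k\<in>UNIV. (D $ p k $ k * h) * (\<Prod>c\<in>UNIV - {k}. M t $ p c $ c)) =
        (*) (\<Sum>k\<in>UNIV. D $ p k $ k * (\<Prod>c\<in>UNIV - {k}. M t $ p c $ c))"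
      by (simp add: fun_eq_iff sum_distrib_left sum_distrib_right mult_ac)
    ultimately show ?thesis
      unfolding has_field_derivative_def by simp
  qed
  have "((\<lambda>s. det (M s)) has_real_derivative
     (\<Sum>p\<in>{p. p permutes UNIV}. of_int (sign p) *
       (\<Sum>k\<in>UNIV. D $ p k $ k * (\<Prod>c\<in>UNIV - {k}. M t $ p c $ c)))) (at t within J)"
    unfolding det_columns by (intro DERIV_sum DERIV_cmult prod)
  also have "(\<Sum>p\<in>{p. p permutes UNIV}. of_int (sign p) *
       (\<Sum>k\<in>UNIV. D $ p k $ k * (\<Prod>c\<in>UNIV - {k}. M t $ p c $ c)))
     = (\<Sum>k\<in>UNIV. \<Sum>p\<in>{p. p permutes UNIV}. of_int (sign p) *
        (D $ p k $ k * (\<Prod>c\<in>UNIV - {k}. M t $ p c $ c)))"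
    by (simp add: sum_distrib_left) (rule sum.swap)
  also have "\<dots> = (\<Sum>k\<in>UNIV. det (\<chi> r c. if c = k then D $ r $ k else M t $ r $ c))"
  proof (rule sum.cong[OF refl])
    fix k
    have "D $ p k $ k * (\<Prod>c\<in>UNIV - {k}. M t $ p c $ c) =
        (\<Prod>c\<in>UNIV. (\<chi> r c. if c = k then D $ r $ k else M t $ r $ c) $ p c $ c)" for p :: "'n \<Rightarrow> 'n"
      by (subst prod.remove[of UNIV k]) (auto intro!: prod.cong)
    then show "(\<Sum>p\<in>{p. p permutes UNIV}. of_int (sign p) *
        (D $ p k $ k * (\<Prod>c\<in>UNIV - {k}. M t $ p c $ c))) =
        det (\<chi> r c. if c = k then D $ r $ k else M t $ r $ c)"
      unfolding det_columns by simp
  qed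
  finally show ?thesis .
qed

text \<open>By Cramer's rule, replacing the \<open>k\<close>-th column of \<open>M\<close> by that of \<open>D\<close>
  multiplies the determinant by the \<open>k\<close>-th diagonal entry of \<open>M\<^sup>-\<^sup>1 D\<close>.\<close>

lemma has_real_derivative_det:
  fixes M :: "real \<Rightarrow> real^'n::finite^'n"
  assumes "\<And>i j. ((\<lambda>s. M s $ i $ j) has_real_derivative D $ i $ j) (at t within J)"
    and nz: "det (M t) \<noteq> 0"
  shows "((\<lambda>s. det (M s)) has_real_derivative det (M t) * trace (matrix_inv (M t) ** D)) (at t within J)"
proof -
  have "det (\<chi> r c. if c = k then D $ r $ k else M t $ r $ c) = (matrix_inv (M t) ** D) $ k $ k * det (M t)" for k
  proof -
    have col: "M t *v (matrix_inv (M t) *v column k D) = column k D"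
      using matrix_inv_mult[OF nz] by (simp add: matrix_vector_mul_assoc)
    have "det (\<chi> r c. if c = k then D $ r $ k else M t $ r $ c) =
        (matrix_inv (M t) *v column k D) $ k * det (M t)"
      using cramer_lemma[of k "M t" "matrix_inv (M t) *v column k D", unfolded col]
      by (simp only: column_def vec_lambda_beta)
    also have "(matrix_inv (M t) *v column k D) $ k = (matrix_inv (M t) ** D) $ k $ k"
      by (simp add: matrix_vector_mult_def matrix_matrix_mult_def column_def)
    finally show ?thesis .
  qed
  then show ?thesis
    using has_real_derivative_det_columns[OF assms(1)]
    by (simp add: trace_def sum_distrib_left mult.commute)
qed

lemma has_real_derivative_sqrt_det:
  fixes M :: "real \<Rightarrow> real^'n::finite^'n"
  assumes "\<And>i j. ((\<lambda>s. M s $ i $ j) has_real_derivative D $ i $ j) (at t within J)"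
    and pos: "det (M t) > 0"
  shows "((\<lambda>s. sqrt (det (M s))) has_real_derivative
    sqrt (det (M t)) * trace (matrix_inv (M t) ** D) / 2) (at t within J)"
proof -
  have "((\<lambda>s. det (M s)) has_real_derivative det (M t) * trace (matrix_inv (M t) ** D)) (at t within J)"
    using pos by (intro has_real_derivative_det assms(1)) simp
  from DERIV_chain2[OF DERIV_real_sqrt[OF pos] this]
  show ?thesis
    by (rule DERIV_cong) (use pos real_div_sqrt[of "det (M t)"] in \<open>simp add: field_simps\<close>)
qed

text \<open>Cramer's rule shows only that the entries are differentiable. The value is then found by
  differentiating \<open>M s ** matrix_inv (M s) = mat 1\<close> within \<open>J\<close>;
  nontriviality of the filter makes the derivative of the constant side unique.\<close>

lemma has_real_derivative_matrix_inv:
  fixes M :: "real \<Rightarrow> real^'n::finite^'n"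
  assumes der: "\<And>i j. ((\<lambda>s. M s $ i $ j) has_real_derivative D $ i $ j) (at t within J)"
    and nz: "\<And>s. s \<in> J \<Longrightarrow> det (M s) \<noteq> 0" and t: "t \<in> J" "at t within J \<noteq> bot"
  shows "((\<lambda>s. matrix_inv (M s) $ i $ j) has_real_derivative
    - (matrix_inv (M t) ** D ** matrix_inv (M t)) $ i $ j) (at t within J)"
proof -
  have "\<exists>d. ((\<lambda>s. matrix_inv (M s) $ i $ j) has_real_derivative d) (at t within J)" for i j
  proof -
    let ?N = "\<lambda>s. \<chi> a b. if b = i then axis j 1 $ a else M s $ a $ b"
    have "((\<lambda>s. ?N s $ a $ b) has_real_derivative
        (\<chi> a b. if b = i then 0 else D $ a $ b) $ a $ b) (at t within J)" for a b
      using der by simp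
    from has_real_derivative_det_columns[OF this] has_real_derivative_det_columns[OF der]
    obtain d e where "((\<lambda>s. det (?N s)) has_real_derivative d) (at t within J)"
      "((\<lambda>s. det (M s)) has_real_derivative e) (at t within J)"
      by blast
    from DERIV_divide[OF this nz[OF t(1)]]
    obtain q where q: "((\<lambda>s. det (?N s) / det (M s)) has_real_derivative q) (at t within J)"
      by blast
    have "((\<lambda>s. matrix_inv (M s) $ i $ j) has_real_derivative q) (at t within J)"
      by (rule has_field_derivative_transform_within[OF q zero_less_one t(1)])
        (simp add: matrix_inv_cramer nz)
    then show ?thesis ..
  qed
  then obtain h where h: "\<And>i j. ((\<lambda>s. matrix_inv (M s) $ i $ j) has_real_derivative h i j) (at t within J)"
    by metis
  define H where "H = (\<chi> i j. h i j)"
  have inv: "matrix_inv (M s) ** M s = mat 1" "M s ** matrix_inv (M s) = mat 1" if "s \<in> J" for s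
    using matrix_inv_mult[OF nz[OF that]] by auto
  have "(D ** matrix_inv (M t)) $ i $ j + (M t ** H) $ i $ j = 0" for i j
  proof -
    have "((\<lambda>s. \<Sum>k\<in>UNIV. M s $ i $ k * matrix_inv (M s) $ k $ j) has_real_derivative
       (\<Sum>k\<in>UNIV. D $ i $ k * matrix_inv (M t) $ k $ j + H $ k $ j * M t $ i $ k)) (at t within J)"
      unfolding H_def by (intro DERIV_sum DERIV_mult der) (simp add: h)
    moreover have "((\<lambda>s. \<Sum>k\<in>UNIV. M s $ i $ k * matrix_inv (M s) $ k $ j) has_real_derivative 0) (at t within J)"
    proof (rule has_field_derivative_transform_within[OF DERIV_const zero_less_one t(1)])
      fix s assume "s \<in> J"
      then show "(mat 1 :: real^'n^'n) $ i $ j = (\<Sum>k\<in>UNIV. M s $ i $ k * matrix_inv (M s) $ k $ j)"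
        using arg_cong[OF inv(2)[of s], of "\<lambda>A. A $ i $ j"] by (simp add: matrix_matrix_mult_def)
    qed
    ultimately have "(\<Sum>k\<in>UNIV. D $ i $ k * matrix_inv (M t) $ k $ j + H $ k $ j * M t $ i $ k) = 0"
      by (rule has_field_derivative_unique[OF _ _ t(2)])
    then show ?thesis
      by (simp add: matrix_matrix_mult_def sum.distrib mult.commute)
  qed
  then have "M t ** H = - (D ** matrix_inv (M t))"
    by (simp add: vec_eq_iff eq_neg_iff_add_eq_0 add.commute)
  then have "matrix_inv (M t) ** (M t ** H) = - (matrix_inv (M t) ** (D ** matrix_inv (M t)))"
    by (simp add: matrix_matrix_mult_def vec_eq_iff sum_negf)
  then have "H = - (matrix_inv (M t) ** D ** matrix_inv (M t))"
    using inv(1)[OF t(1)] by (simp add: matrix_mul_assoc)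
  then show ?thesis
    using h[of i j] by (simp add: H_def vec_eq_iff)
qed

lemma continuous_on_det:
  fixes M :: "'a::topological_space \<Rightarrow> real^'n::finite^'n"
  assumes "\<And>i j. continuous_on S (\<lambda>z. M z $ i $ j)"
  shows "continuous_on S (\<lambda>z. det (M z))"
  unfolding det_def by (intro continuous_intros assms)

lemma continuous_on_matrix_inv:
  fixes M :: "'a::topological_space \<Rightarrow> real^'n::finite^'n"
  assumes "\<And>i j. continuous_on S (\<lambda>z. M z $ i $ j)" and "\<And>z. z \<in> S \<Longrightarrow> det (M z) \<noteq> 0"
  shows "continuous_on S (\<lambda>z. matrix_inv (M z) $ i $ j)"
proof -
  have "continuous_on S (\<lambda>z. (\<chi> a b. if b = i then axis j 1 $ a else M z $ a $ b) $ a $ b)" for a b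
    using assms(1) by (cases "b = i") simp_all
  then have "continuous_on S (\<lambda>z. det (\<chi> a b. if b = i then axis j 1 $ a else M z $ a $ b) / det (M z))"
    by (intro continuous_on_divide continuous_on_det) (use assms in auto)
  then show ?thesis
    by (rule continuous_on_eq) (simp add: matrix_inv_cramer assms)
qed

text \<open>The segment from the identity to \<open>M\<close> consists of positive definite, hence
  invertible, matrices. The determinant starts at 1 and would have to vanish on the way to a
  nonpositive value.\<close>

lemma det_pos_definite:
  fixes M :: "real^'n::finite^'n"
  assumes pos: "\<And>v. v \<noteq> 0 \<Longrightarrow> v \<bullet> (M *v v) > 0"
  shows "det M > 0"
proof (rule ccontr)
  assume "\<not> det M > 0"
  define P where "P s = (1 - s) *\<^sub>R mat 1 + s *\<^sub>R M" for s :: real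
  have P: "P s *v v = (1 - s) *\<^sub>R v + s *\<^sub>R (M *v v)" for s v
    by (simp add: P_def matrix_vector_mult_add_rdistrib flip: scaleR_matrix_vector_assoc)
  have "continuous_on {0..1} (\<lambda>s. det (P s))"
    by (rule continuous_on_det) (auto simp: P_def intro!: continuous_intros)
  moreover have "P 0 = mat 1" "P 1 = M"
    by (auto simp: P_def vec_eq_iff)
  ultimately obtain s where s: "0 \<le> s" "s \<le> 1" "det (P s) = 0"
    using IVT2'[of "\<lambda>s. det (P s)" 1 0 0] \<open>\<not> det M > 0\<close> by auto
  then obtain v where v: "v \<noteq> 0" "P s *v v = 0"
    using invertible_det_nz[of "P s"] matrix_left_invertible_ker[of "P s"]
    by (auto simp: invertible_left_inverse)
  have "0 = (1 - s) * (v \<bullet> v) + s * (v \<bullet> (M *v v))"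
    using arg_cong[OF v(2)[unfolded P], of "\<lambda>x. v \<bullet> x"] by (simp add: inner_add_right)
  moreover have "v \<bullet> v > 0" "v \<bullet> (M *v v) > 0"
    using v pos by auto
  ultimately show False
    using s by (smt (verit, best) mult_nonneg_nonneg mult_pos_pos)
qed

section \<open>Partial derivatives and C1 functions\<close>

lemma pd_eq: "(F has_derivative F') (at x) \<Longrightarrow> pd i F x = F' (axis i 1)"
  unfolding pd_def by (metis frechet_derivative_at)

lemma has_derivative_pd:
  fixes F :: "real^'n::finite \<Rightarrow> real"
  assumes "F differentiable (at x)"
  shows "(F has_derivative (\<lambda>v. \<Sum>i\<in>UNIV. v $ i * pd i F x)) (at x)"
proof -
  let ?D = "frechet_derivative F (at x)"
  have D: "(F has_derivative ?D) (at x)"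
    using assms by (simp add: frechet_derivative_works)
  have "?D v = (\<Sum>i\<in>UNIV. v $ i * pd i F x)" for v
  proof -
    have "?D v = ?D (\<Sum>i\<in>UNIV. v $ i *\<^sub>R axis i 1)"
      using basis_expansion[of v] by (simp add: scalar_mult_eq_scaleR)
    also have "\<dots> = (\<Sum>i\<in>UNIV. v $ i * pd i F x)"
      using has_derivative_linear[OF D] by (simp add: linear_sum linear_cmul pd_def)
    finally show ?thesis .
  qed
  then have "?D = (\<lambda>v. \<Sum>i\<in>UNIV. v $ i * pd i F x)"
    by (rule ext)
  then show ?thesis
    using D by simp
qed

lemma pd_cong:
  assumes "open S" "x \<in> S" "\<And>y. y \<in> S \<Longrightarrow> F y = G y"
  shows "pd i F x = pd i G x"
proof -
  have "(F has_derivative D) (at x) \<longleftrightarrow> (G has_derivative D) (at x)" for D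
    using assms has_derivative_transform_within_open[of F D x UNIV S G]
      has_derivative_transform_within_open[of G D x UNIV S F] by auto
  then show ?thesis
    by (simp add: pd_def frechet_derivative_def)
qed

lemma differentiable_cong_open:
  assumes "open S" "x \<in> S" "\<And>y. y \<in> S \<Longrightarrow> F y = G y" "F differentiable (at x)"
  shows "G differentiable (at x)"
  using assms has_derivative_transform_within_open[of F _ x UNIV S G] unfolding differentiable_def by auto

lemma pd_const: "pd i (\<lambda>x. c) x = 0"
  by (rule pd_eq) (rule has_derivative_const)

lemma pd_add:
  assumes "F differentiable (at x)" "G differentiable (at x)"
  shows "pd i (\<lambda>x. F x + G x) x = pd i F x + pd i G x"
  using pd_eq[OF has_derivative_add[OF assms[unfolded frechet_derivative_works]]]
  by (simp add: pd_def)

lemma pd_cmult: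
  assumes "F differentiable (at x)"
  shows "pd i (\<lambda>x. c * F x) x = c * pd i F x"
  using pd_eq[OF has_derivative_mult_right[OF assms[unfolded frechet_derivative_works]]]
  by (simp add: pd_def)

lemma pd_sum:
  assumes "finite K" "\<And>k. k \<in> K \<Longrightarrow> F k differentiable (at x)"
  shows "pd i (\<lambda>x. \<Sum>k\<in>K. F k x) x = (\<Sum>k\<in>K. pd i (F k) x)"
  using assms by (induction) (simp_all add: pd_const pd_add)

lemma pd_mult:
  assumes "F differentiable (at x)" "G differentiable (at x)"
  shows "pd i (\<lambda>x. F x * G x) x = pd i F x * G x + F x * pd i G x"
  using pd_eq[OF has_derivative_mult[OF assms[unfolded frechet_derivative_works]]]
  by (simp add: pd_def)

lemma pd_divide:
  assumes "F differentiable (at x)" "G differentiable (at x)" "G x \<noteq> 0"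
  shows "pd i (\<lambda>x. F x / G x) x = (pd i F x * G x - F x * pd i G x) / (G x * G x)"
  using pd_eq[OF has_derivative_divide'[OF assms(1,2)[unfolded frechet_derivative_works] assms(3)]]
  by (simp add: pd_def)

lemma differentiable_cart:
  fixes \<tau> :: "'a::real_normed_vector \<Rightarrow> real^'n::finite"
  assumes "\<And>k. (\<lambda>y. \<tau> y $ k) differentiable (at x)"
  shows "\<tau> differentiable (at x)"
proof -
  have "(\<lambda>y. \<Sum>k\<in>UNIV. \<tau> y $ k *\<^sub>R axis k 1 :: real^'n) differentiable (at x)"
    by (intro differentiable_sum ballI differentiable_scaleR assms) auto
  then show ?thesis
    using basis_expansion[of "\<tau> _"] by (simp add: scalar_mult_eq_scaleR)
qed

lemma has_derivative_cart:
  fixes \<tau> :: "real^'m::finite \<Rightarrow> real^'n::finite"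
  assumes "\<And>k. (\<lambda>y. \<tau> y $ k) differentiable (at x)"
  shows "(\<tau> has_derivative (\<lambda>v. \<chi> k. \<Sum>i\<in>UNIV. v $ i * pd i (\<lambda>y. \<tau> y $ k) x)) (at x)"
proof -
  have D: "(\<tau> has_derivative frechet_derivative \<tau> (at x)) (at x)"
    using differentiable_cart[of \<tau>] assms by (simp add: frechet_derivative_works)
  have "frechet_derivative \<tau> (at x) v $ k = (\<Sum>i\<in>UNIV. v $ i * pd i (\<lambda>y. \<tau> y $ k) x)" for v k
  proof -
    have "((\<lambda>y. \<tau> y $ k) has_derivative (\<lambda>v. frechet_derivative \<tau> (at x) v $ k)) (at x)"
      using bounded_linear.has_derivative[OF bounded_linear_vec_nth D] .
    from has_derivative_unique[OF this has_derivative_pd[OF assms]] show ?thesis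
      by (rule fun_cong)
  qed
  then have "frechet_derivative \<tau> (at x) = (\<lambda>v. \<chi> k. \<Sum>i\<in>UNIV. v $ i * pd i (\<lambda>y. \<tau> y $ k) x)"
    by (simp add: fun_eq_iff vec_eq_iff)
  then show ?thesis
    using D by simp
qed

lemma
  fixes \<tau> :: "real^'m::finite \<Rightarrow> real^'n::finite"
  assumes \<tau>: "\<And>k. (\<lambda>y. \<tau> y $ k) differentiable (at x)" and F: "F differentiable (at (\<tau> x))"
  shows pd_chain: "pd i (\<lambda>y. F (\<tau> y)) x = (\<Sum>k\<in>UNIV. pd k F (\<tau> x) * pd i (\<lambda>y. \<tau> y $ k) x)"
    and differentiable_chain: "(\<lambda>y. F (\<tau> y)) differentiable (at x)"
proof -
  have 1: "((\<lambda>y. F (\<tau> y)) has_derivative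
      (\<lambda>v. \<Sum>k\<in>UNIV. (\<Sum>i\<in>UNIV. v $ i * pd i (\<lambda>y. \<tau> y $ k) x) * pd k F (\<tau> x))) (at x)"
    using diff_chain_at[OF has_derivative_cart[OF \<tau>] has_derivative_pd[OF F]] by (simp add: o_def)
  have "axis i 1 $ j * c = (if j = i then c else 0)" for i j :: 'm and c :: real
    by (simp add: axis_def)
  then have "pd i (\<lambda>y. F (\<tau> y)) x = (\<Sum>k\<in>UNIV. pd i (\<lambda>y. \<tau> y $ k) x * pd k F (\<tau> x))"
    by (simp add: pd_eq[OF 1])
  then show "pd i (\<lambda>y. F (\<tau> y)) x = (\<Sum>k\<in>UNIV. pd k F (\<tau> x) * pd i (\<lambda>y. \<tau> y $ k) x)"
    by (simp add: mult.commute)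
  show "(\<lambda>y. F (\<tau> y)) differentiable (at x)"
    using 1 by (rule differentiableI)
qed

text \<open>Partial derivatives become one-variable derivatives along a coordinate line, the form
  used for determinants, inverse matrices and integration by parts.\<close>

lemma has_real_derivative_pd_shift:
  fixes F :: "real^'n::finite \<Rightarrow> real"
  assumes "F differentiable (at x)"
  shows "((\<lambda>e. F (x + e *\<^sub>R axis i 1)) has_real_derivative pd i F x) (at 0)"
proof -
  have "((\<lambda>e. x + e *\<^sub>R axis i 1) has_derivative (\<lambda>e. e *\<^sub>R axis i 1)) (at (0::real))"
    by (auto intro!: derivative_eq_intros)
  moreover have "(F has_derivative frechet_derivative F (at x)) (at (x + 0 *\<^sub>R axis i 1))"
    using assms by (simp add: frechet_derivative_works)
  ultimately have "((\<lambda>e. F (x + e *\<^sub>R axis i 1)) has_derivative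
      (\<lambda>e. frechet_derivative F (at x) (e *\<^sub>R axis i 1))) (at 0)"
    using diff_chain_at by (fastforce simp: o_def)
  moreover have "linear (frechet_derivative F (at x))"
    using assms by (intro has_derivative_linear) (simp add: frechet_derivative_works)
  then have "frechet_derivative F (at x) (e *\<^sub>R axis i 1) = pd i F x * e" for e
    by (simp add: pd_def linear_cmul)
  ultimately show ?thesis
    by (simp add: has_field_derivative_def)
qed

text \<open>Differentiability is at, not within, the set, to match \<open>pd\<close>, whose Frechet
  derivative is unrestricted. The order is one because the cut-offs below are only once continuously
  differentiable.\<close>

definition C1_on :: "(real^'n::finite) set \<Rightarrow> (real^'n \<Rightarrow> real) \<Rightarrow> bool" where
  "C1_on S F \<longleftrightarrow> (\<forall>x\<in>S. F differentiable (at x)) \<and> (\<forall>i. continuous_on S (pd i F))"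

lemma C1_onD:
  assumes "C1_on S F"
  shows "x \<in> S \<Longrightarrow> F differentiable (at x)" "continuous_on S (pd i F)" "continuous_on S F"
  using assms differentiable_imp_continuous_within[of F _ UNIV]
  by (auto simp: C1_on_def intro!: continuous_at_imp_continuous_on)

lemma C1_on_subset: "C1_on S F \<Longrightarrow> T \<subseteq> S \<Longrightarrow> C1_on T F"
  by (auto simp: C1_on_def intro: continuous_on_subset)

lemma C1_on_cong:
  assumes "open S" "\<And>y. y \<in> S \<Longrightarrow> F y = G y" "C1_on S F"
  shows "C1_on S G"
proof -
  have "continuous_on S (pd i G)" for i
    using C1_onD(2)[OF assms(3)] pd_cong[OF assms(1) _ assms(2)] by (rule continuous_on_eq) auto
  then show ?thesis
    using differentiable_cong_open[OF assms(1) _ assms(2)] assms(3) by (auto simp: C1_on_def)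
qed

lemma C1_on_Union:
  assumes "\<And>S. S \<in> \<S> \<Longrightarrow> open S" "\<And>S. S \<in> \<S> \<Longrightarrow> C1_on S F"
  shows "C1_on (\<Union>\<S>) F"
  using assms continuous_on_open_Union[of \<S> "pd _ F"] by (auto simp: C1_on_def)

lemma C1_on_const: "C1_on S (\<lambda>x. c)"
  by (simp add: C1_on_def pd_const cong: continuous_on_cong)

lemma C1_on_add:
  assumes "C1_on S F" "C1_on S G"
  shows "C1_on S (\<lambda>x. F x + G x)"
proof -
  have "continuous_on S (pd i (\<lambda>x. F x + G x)) \<longleftrightarrow> continuous_on S (\<lambda>x. pd i F x + pd i G x)" for i
    by (rule continuous_on_cong) (auto simp: pd_add C1_onD[OF assms(1)] C1_onD[OF assms(2)])
  then show ?thesis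
    using assms by (auto simp: C1_on_def intro!: continuous_intros)
qed

lemma C1_on_sum:
  assumes "\<And>k. k \<in> K \<Longrightarrow> C1_on S (F k)"
  shows "C1_on S (\<lambda>x. \<Sum>k\<in>K. F k x)"
  using assms by (induction K rule: infinite_finite_induct) (auto intro: C1_on_const C1_on_add)

lemma C1_on_mult:
  assumes "C1_on S F" "C1_on S G"
  shows "C1_on S (\<lambda>x. F x * G x)"
proof -
  have "continuous_on S (pd i (\<lambda>x. F x * G x)) \<longleftrightarrow>
      continuous_on S (\<lambda>x. pd i F x * G x + F x * pd i G x)" for i
    by (rule continuous_on_cong) (auto simp: pd_mult C1_onD[OF assms(1)] C1_onD[OF assms(2)])
  then show ?thesis
    using assms C1_onD(3)[OF assms(1)] C1_onD(3)[OF assms(2)]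
    by (auto simp: C1_on_def intro!: continuous_intros)
qed

lemma C1_on_divide:
  assumes "C1_on S F" "C1_on S G" "\<And>x. x \<in> S \<Longrightarrow> G x \<noteq> 0"
  shows "C1_on S (\<lambda>x. F x / G x)"
proof -
  have "continuous_on S (pd i (\<lambda>x. F x / G x)) \<longleftrightarrow>
      continuous_on S (\<lambda>x. (pd i F x * G x - F x * pd i G x) / (G x * G x))" for i
    by (rule continuous_on_cong)
      (auto simp: pd_divide C1_onD[OF assms(1)] C1_onD[OF assms(2)] assms(3))
  then show ?thesis
    using assms C1_onD(3)[OF assms(1)] C1_onD(3)[OF assms(2)]
    by (auto simp: C1_on_def intro!: continuous_intros)
qed

lemma C1_on_compose:
  fixes \<tau> :: "real^'m::finite \<Rightarrow> real^'n::finite"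
  assumes F: "C1_on T F" and \<tau>: "\<And>k. C1_on S (\<lambda>y. \<tau> y $ k)" and "\<tau> ` S \<subseteq> T"
  shows "C1_on S (\<lambda>y. F (\<tau> y))"
proof -
  have cont: "continuous_on S \<tau>"
    using continuous_on_vec_lambda[where f = "\<lambda>k y. \<tau> y $ k" and S = S] C1_onD(3)[OF \<tau>] by simp
  have "continuous_on S (pd i (\<lambda>y. F (\<tau> y))) \<longleftrightarrow>
     continuous_on S (\<lambda>x. \<Sum>k\<in>UNIV. pd k F (\<tau> x) * pd i (\<lambda>y. \<tau> y $ k) x)" for i
    using assms(3) by (intro continuous_on_cong[OF refl] pd_chain C1_onD(1)[OF F] C1_onD(1)[OF \<tau>]) auto
  moreover have "continuous_on S (\<lambda>x. pd k F (\<tau> x))" for k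
    by (rule continuous_on_compose2[OF C1_onD(2)[OF F] cont assms(3)])
  moreover have "continuous_on S (pd i (\<lambda>y. \<tau> y $ k))" for i k
    by (rule C1_onD(2)[OF \<tau>])
  ultimately have "continuous_on S (pd i (\<lambda>y. F (\<tau> y)))" for i
    by (auto intro!: continuous_intros)
  moreover have "(\<lambda>y. F (\<tau> y)) differentiable (at x)" if "x \<in> S" for x
    by (rule differentiable_chain[OF C1_onD(1)[OF \<tau> that] C1_onD(1)[OF F]]) (use that assms(3) in auto)
  ultimately show ?thesis
    by (simp add: C1_on_def)
qed

lemma C1_on_smooth:
  assumes "smooth_on S F" "open S"
  shows "C1_on S (pds \<alpha> F)"
proof -
  have "pds \<beta> F differentiable_on S" for \<beta>
    using assms(1) by (simp add: smooth_on_def)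
  then have "pds \<beta> F differentiable (at x)" if "x \<in> S" for x \<beta>
    using that assms(2) by (simp add: differentiable_on_eq_differentiable_at)
  moreover have "continuous_on S (pds (i # \<alpha>) F)" for i
    using assms(1) differentiable_imp_continuous_on unfolding smooth_on_def by blast
  ultimately show ?thesis
    by (simp add: C1_on_def)
qed

text \<open>Compactness of \<open>K\<close> makes the continuity of \<open>q'\<close> in time
  uniform in \<open>x\<close>, and the mean value inequality on the convex set \<open>J\<close>
  carries this over to quotients, also at an endpoint of \<open>J\<close>.\<close>

lemma uniform_limit_difference_quotient:
  fixes q :: "real \<Rightarrow> 'a::topological_space \<Rightarrow> real"
  assumes "compact K" "convex J" "t \<in> J"
    and der: "\<And>s x. s \<in> J \<Longrightarrow> x \<in> K \<Longrightarrow> ((\<lambda>s. q s x) has_real_derivative q' s x) (at s within J)"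
    and cont: "continuous_on (J \<times> K) (\<lambda>(s, x). q' s x)"
  shows "uniform_limit K (\<lambda>s x. (q s x - q t x) / (s - t)) (q' t) (at t within J)"
proof (rule uniform_limitI)
  fix e :: real assume "e > 0"
  then have e2: "e / 2 > 0" by simp
  obtain X where X: "t \<in> X" "open X" "\<forall>s\<in>X \<inter> J. \<forall>x\<in>K. dist (q' s x) (q' t x) \<le> e / 2"
    using continuous_on_prod_compactE[OF cont assms(1,3) e2] by auto
  then obtain d where d: "d > 0" "ball t d \<subseteq> X"
    using openE by blast
  have "dist ((q s x - q t x) / (s - t)) (q' t x) < e"
    if s: "s \<in> J" "s \<noteq> t" "dist s t < d" and x: "x \<in> K" for s x
  proof -
    \<comment> \<open>Subtracting the linear function of slope \<open>q' t x\<close> leaves a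
      function of time whose derivative is at most \<open>e / 2\<close> in size near
      \<open>t\<close>.\<close>
    let ?r = "\<lambda>s. q s x - s * q' t x"
    have "norm (?r s - ?r t) \<le> (e / 2) * norm (s - t)"
    proof (rule field_differentiable_bound[of "J \<inter> ball t d"])
      show "convex (J \<inter> ball t d)"
        using assms(2) by (intro convex_Int) auto
      show "(?r has_field_derivative q' z x - q' t x) (at z within J \<inter> ball t d)"
        if "z \<in> J \<inter> ball t d" for z
        using der[of z x] that x
        by (auto intro!: derivative_eq_intros intro: has_field_derivative_subset)
      show "norm (q' z x - q' t x) \<le> e / 2" if "z \<in> J \<inter> ball t d" for z
        using X(3) d(2) that x by (auto simp: dist_norm)
    qed (use s d(1) assms(3) in \<open>auto simp: dist_commute\<close>)
    moreover have "(q s x - q t x) / (s - t) - q' t x = (?r s - ?r t) / (s - t)"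
      using s(2) by (simp add: field_simps)
    ultimately have "norm ((q s x - q t x) / (s - t) - q' t x) \<le> e / 2"
      using s(2) by (simp add: abs_divide divide_le_eq)
    then show ?thesis
      using \<open>e > 0\<close> by (simp add: dist_norm)
  qed
  then show "\<forall>\<^sub>F s in at t within J. \<forall>x\<in>K. dist ((q s x - q t x) / (s - t)) (q' t x) < e"
    using d(1) by (auto simp: eventually_at)
qed

text \<open>The integrals of all translates of \<open>h\<close> agree, so differentiating them under the integral
  sign gives the claim.\<close>

lemma integral_directional_derivative_eq_0:
  fixes h h' :: "'a::euclidean_space \<Rightarrow> real"
  assumes supp: "\<And>x. x \<notin> cbox a b \<Longrightarrow> h x = 0"
    and der: "\<And>x. ((\<lambda>e. h (x + e *\<^sub>R v)) has_real_derivative h' x) (at 0)"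
    and cont: "continuous_on UNIV h" "continuous_on UNIV h'"
  shows "integral (cbox a b) h' = 0"
proof -
  \<comment> \<open>Off the closed box \<open>h\<close> vanishes on a short segment through
    \<open>x\<close>, so the derivative along it vanishes too.\<close>
  have supp': "h' x = 0" if "x \<notin> cbox a b" for x
  proof -
    have "((\<lambda>e::real. x + e *\<^sub>R v) \<longlongrightarrow> x + 0 *\<^sub>R v) (at 0)"
      by (intro tendsto_intros)
    then have "\<forall>\<^sub>F e in at (0::real). x + e *\<^sub>R v \<in> - cbox a b"
      using that by (intro topological_tendstoD) auto
    then have "\<forall>\<^sub>F e in at 0. h (x + e *\<^sub>R v) = 0"
      by eventually_elim (use supp in auto)
    then have "((\<lambda>e. h (x + e *\<^sub>R v)) has_real_derivative 0) (at 0)"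
      using that supp
      by (subst has_field_derivative_cong_ev[where g="\<lambda>_. 0", OF refl _ refl refl])
        (auto simp: eventually_at_filter elim: eventually_mono)
    then show ?thesis
      using der DERIV_unique by blast
  qed
  \<comment> \<open>The box \<open>cbox (-c) c\<close> is made large enough to contain the supports
    of all translates of \<open>h\<close> by e times \<open>v\<close> with e in
    \<open>{-1..1}\<close>, so one fixed domain of integration serves all of them.\<close>
  obtain r where r: "\<And>x. x \<in> cbox a b \<Longrightarrow> norm x \<le> r"
    using bounded_cbox[of a b] by (auto simp: bounded_iff)
  obtain c :: 'a where c: "cball 0 (r + norm v) \<subseteq> cbox (-c) c"
    using bounded_subset_cbox_symmetric[OF bounded_cball] by metis
  have cbox: "x \<in> cbox (-c) c" if "x + e *\<^sub>R v \<in> cbox a b" "\<bar>e\<bar> \<le> 1" for x and e :: real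
  proof -
    have "norm (e *\<^sub>R v) \<le> norm v"
      using that(2) by (simp add: mult_left_le_one_le)
    then have "norm x \<le> r + norm v"
      using r[OF that(1)] norm_triangle_sub[of x "- (e *\<^sub>R v)"] by simp
    then show ?thesis
      using c by auto
  qed
  have int: "integrable lborel h"
  proof -
    have "integrable lborel (\<lambda>x. indicator (cbox a b) x *\<^sub>R h x)"
      using cont(1) by (intro borel_integrable_compact) (auto intro: continuous_on_subset)
    moreover have "(\<lambda>x. indicator (cbox a b) x *\<^sub>R h x) = h"
      using supp by (auto simp: indicator_def fun_eq_iff)
    ultimately show ?thesis by simp
  qed
  have const: "integral (cbox (-c) c) (\<lambda>x. h (x + e *\<^sub>R v)) = (\<integral>x. h x \<partial>lborel)" if "\<bar>e\<bar> \<le> 1" for e :: real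
  proof -
    have meas: "h \<in> borel_measurable borel"
      using cont(1) by (rule borel_measurable_continuous_onI)
    have "integrable (distr lborel borel ((+) (e *\<^sub>R v))) h"
      using int by (simp add: lborel_distr_plus)
    then have int': "integrable lborel (\<lambda>x. h (e *\<^sub>R v + x))"
      using meas by (simp add: integrable_distr_eq)
    have "(\<integral>x. h x \<partial>lborel) = (\<integral>x. h x \<partial>distr lborel borel ((+) (e *\<^sub>R v)))"
      by (simp add: lborel_distr_plus)
    also have "\<dots> = (\<integral>x. h (e *\<^sub>R v + x) \<partial>lborel)"
      using meas by (simp add: integral_distr)
    finally have "((\<lambda>x. h (e *\<^sub>R v + x)) has_integral (\<integral>x. h x \<partial>lborel)) UNIV"
      using has_integral_integral_lborel[OF int'] by simp
    moreover have "(\<lambda>x. h (e *\<^sub>R v + x)) = (\<lambda>x. if x \<in> cbox (-c) c then h (x + e *\<^sub>R v) else 0)"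
      using cbox[OF _ that] supp by (fastforce simp: add.commute)
    ultimately have "((\<lambda>x. h (x + e *\<^sub>R v)) has_integral (\<integral>x. h x \<partial>lborel)) (cbox (-c) c)"
      by (simp add: has_integral_restrict_UNIV)
    then show ?thesis by blast
  qed
  have "((\<lambda>e. integral (cbox (-c) c) (\<lambda>x. h (x + e *\<^sub>R v))) has_real_derivative
      integral (cbox (-c) c) (\<lambda>x. h' (x + 0 *\<^sub>R v))) (at 0 within {-1..1})"
  proof (rule leibniz_rule_field_derivative)
    fix e :: real and x
    have "((\<lambda>z. h ((x + e *\<^sub>R v) + z *\<^sub>R v)) has_real_derivative h' (x + e *\<^sub>R v)) (at 0)"
      by (rule der)
    then have "((\<lambda>z. h (x + z *\<^sub>R v)) has_real_derivative h' (x + e *\<^sub>R v)) (at e)"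
      using DERIV_shift[of "\<lambda>z. h (x + z *\<^sub>R v)" _ 0 e] by (simp add: algebra_simps)
    then show "((\<lambda>z. h (x + z *\<^sub>R v)) has_real_derivative h' (x + e *\<^sub>R v)) (at e within {-1..1})"
      by (rule has_field_derivative_at_within)
  next
    fix e :: real
    show "(\<lambda>x. h (x + e *\<^sub>R v)) integrable_on cbox (-c) c"
      by (intro integrable_continuous continuous_on_compose2[OF cont(1)] continuous_intros) auto
  next
    show "continuous_on ({-1..1} \<times> cbox (-c) c) (\<lambda>(e, x). h' (x + e *\<^sub>R v))"
      unfolding case_prod_beta
      by (intro continuous_on_compose2[OF cont(2)] continuous_intros) auto
  qed auto
  moreover have "((\<lambda>e. integral (cbox (-c) c) (\<lambda>x. h (x + e *\<^sub>R v))) has_real_derivative 0) (at 0 within {-1..1})"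
    by (rule has_field_derivative_transform_within[OF DERIV_const zero_less_one])
      (auto simp: const)
  moreover have "at (0::real) within {-1..1} \<noteq> bot"
    by (simp add: trivial_limit_within islimpt_Icc)
  ultimately have "integral (cbox (-c) c) h' = 0"
    using has_field_derivative_unique by fastforce
  moreover have "cbox a b \<subseteq> cbox (-c) c"
    using cbox[of _ 0] by auto
  moreover have "h' integrable_on cbox (-c) c"
    using cont(2) by (intro integrable_continuous) (auto intro: continuous_on_subset)
  ultimately have "((\<lambda>x. if x \<in> cbox a b then h' x else 0) has_integral 0) (cbox (-c) c)"
    using supp' has_integral_eq[of "cbox (-c) c" h' "\<lambda>x. if x \<in> cbox a b then h' x else 0"]
    by (auto dest: integrable_integral)
  then have "(h' has_integral 0) (cbox a b)"
    using has_integral_restrict[OF \<open>cbox a b \<subseteq> cbox (-c) c\<close>] by blast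
  then show ?thesis by blast
qed

section \<open>Charts and partitions of unity\<close>

definition C1_mfd :: "('m, 'n::finite) chart set \<Rightarrow> ('m \<Rightarrow> real) \<Rightarrow> bool" where
  "C1_mfd A u \<longleftrightarrow> (\<forall>c\<in>A. C1_on (cimg c) (\<lambda>x. u (cinv c x)))"

lemma C1_mfd_mult: "C1_mfd A u \<Longrightarrow> C1_mfd A v \<Longrightarrow> C1_mfd A (\<lambda>p. u p * v p)"
  by (simp add: C1_mfd_def C1_on_mult)

lemma C1_mfd_sum: "(\<And>k. k \<in> K \<Longrightarrow> C1_mfd A (u k)) \<Longrightarrow> C1_mfd A (\<lambda>p. \<Sum>k\<in>K. u k p)"
  by (simp add: C1_mfd_def C1_on_sum)

lemma C1_mfd_divide:
  "C1_mfd A u \<Longrightarrow> C1_mfd A v \<Longrightarrow> (\<And>p. v p \<noteq> 0) \<Longrightarrow> C1_mfd A (\<lambda>p. u p / v p)"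
  by (simp add: C1_mfd_def C1_on_divide)

text \<open>Squaring removes the kink of \<open>max 0\<close>: at the origin the difference quotient
  is bounded by the absolute value of the increment.\<close>

lemma has_real_derivative_max_0_square:
  "((\<lambda>s::real. (max 0 s)\<^sup>2) has_real_derivative 2 * max 0 s) (at s)"
proof (cases s "0::real" rule: linorder_cases)
  case less
  then have "\<forall>\<^sub>F y in nhds s. (max 0 y)\<^sup>2 = 0"
    by (intro eventually_mono[OF eventually_nhds_in_open[of "{..<0}"]]) (auto simp: max_def)
  then have "((\<lambda>s::real. (max 0 s)\<^sup>2) has_real_derivative 0) (at s)"
    by (subst has_field_derivative_cong_ev[where g="\<lambda>_. 0"]) (use less in \<open>auto elim: eventually_mono\<close>)
  then show ?thesis
    using less by (simp add: max_def)
next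
  case greater
  then have ev: "\<forall>\<^sub>F y in nhds s. (max 0 y)\<^sup>2 = y\<^sup>2"
    by (intro eventually_mono[OF eventually_nhds_in_open[of "{0<..}"]]) (auto simp: max_def)
  have "((\<lambda>s::real. s\<^sup>2) has_real_derivative 2 * s) (at s)"
    by (auto intro!: derivative_eq_intros)
  then have "((\<lambda>s::real. (max 0 s)\<^sup>2) has_real_derivative 2 * s) (at s)"
    using ev greater
    by (subst has_field_derivative_cong_ev[where g="\<lambda>s. s\<^sup>2"]) (auto elim: eventually_mono)
  then show ?thesis
    using greater by (simp add: max_def)
next
  case equal
  have "((\<lambda>h::real. (max 0 h)\<^sup>2 / h) \<longlongrightarrow> 0) (at 0)"
  proof (rule Lim_null_comparison[where g="\<lambda>h. \<bar>h\<bar>"])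
    show "\<forall>\<^sub>F h::real in at 0. norm ((max 0 h)\<^sup>2 / h) \<le> \<bar>h\<bar>"
      by (rule always_eventually) (auto simp: max_def power2_eq_square)
    show "((\<lambda>h::real. \<bar>h\<bar>) \<longlongrightarrow> 0) (at 0)"
      by (rule tendsto_eq_intros)+ auto
  qed
  then show ?thesis
    using equal by (simp add: has_field_derivative_iff)
qed

text \<open>The profile is the square of a truncated paraboloid; for positive \<open>r\<close> it is
  positive exactly on the open ball of radius \<open>r\<close> around \<open>x0\<close>, see
  \<open>bump_eq_0_iff\<close>.\<close>

lemma C1_on_bump:
  fixes x0 :: "real^'n::finite"
  shows "C1_on S (\<lambda>x. (max 0 (r\<^sup>2 - (x - x0) \<bullet> (x - x0)))\<^sup>2)"
proof -
  have D: "((\<lambda>x. (max 0 (r\<^sup>2 - (x - x0) \<bullet> (x - x0)))\<^sup>2) has_derivative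
     (\<lambda>v. 2 * max 0 (r\<^sup>2 - (x - x0) \<bullet> (x - x0)) * (- 2 * (v \<bullet> (x - x0))))) (at x)" for x
  proof -
    have "((\<lambda>x. r\<^sup>2 - (x - x0) \<bullet> (x - x0)) has_derivative (\<lambda>v. - 2 * (v \<bullet> (x - x0)))) (at x)"
      by (auto intro!: derivative_eq_intros simp: inner_commute)
    from diff_chain_at[OF this has_real_derivative_max_0_square[unfolded has_field_derivative_def]]
    show ?thesis
      by (simp add: o_def)
  qed
  have "pd i (\<lambda>x. (max 0 (r\<^sup>2 - (x - x0) \<bullet> (x - x0)))\<^sup>2) =
      (\<lambda>x. 2 * max 0 (r\<^sup>2 - (x - x0) \<bullet> (x - x0)) * (- 2 * (axis i 1 \<bullet> (x - x0))))" for i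
    using pd_eq[OF D] by auto
  then show ?thesis
    using D unfolding C1_on_def differentiable_def by (auto intro!: continuous_intros)
qed

lemma bump_eq_0_iff:
  fixes x x0 :: "'a::real_inner"
  assumes "0 < r"
  shows "(max 0 (r\<^sup>2 - (x - x0) \<bullet> (x - x0)))\<^sup>2 = 0 \<longleftrightarrow> x \<notin> ball x0 r"
proof -
  have "(x - x0) \<bullet> (x - x0) < r\<^sup>2 \<longleftrightarrow> dist x0 x < r"
    using assms power_strict_mono[of "dist x0 x" r 2] power2_less_imp_less[of "dist x0 x" r]
    by (auto simp: dot_square_norm dist_norm norm_minus_commute)
  then show ?thesis
    by (auto simp: max_def)
qed

locale closed_mfd =
  fixes A :: "('m::{t2_space, second_countable_topology}, 'n::finite) chart set"
  assumes closed_manifold: "closed_manifold A"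
begin

lemma compact_mfd: "compact (UNIV :: 'm set)"
  using closed_manifold by (simp add: closed_manifold_def)

lemma cover: "\<exists>c\<in>A. p \<in> cdom c"
  using closed_manifold UNIV_I[of p] by (force simp: closed_manifold_def smooth_atlas_def)

lemma
  assumes "c \<in> A"
  shows open_cdom: "open (cdom c)" and open_cimg: "open (cimg c)"
    and homeo: "homeomorphism (cdom c) (cimg c) (coord c) (cinv c)"
  using closed_manifold assms by (auto simp: closed_manifold_def smooth_atlas_def is_chart_def)

lemma
  assumes "c \<in> A"
  shows coord_cinv: "x \<in> cimg c \<Longrightarrow> coord c (cinv c x) = x"
    and cinv_coord: "p \<in> cdom c \<Longrightarrow> cinv c (coord c p) = p"
    and cinv_in: "x \<in> cimg c \<Longrightarrow> cinv c x \<in> cdom c"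
    and coord_in: "p \<in> cdom c \<Longrightarrow> coord c p \<in> cimg c"
    and continuous_on_coord: "continuous_on (cdom c) (coord c)"
    and continuous_on_cinv: "continuous_on (cimg c) (cinv c)"
  using homeo[OF assms] by (auto simp: homeomorphism_def)

lemma coord_image_eq:
  assumes "c \<in> A"
  shows "coord c ` (cdom c \<inter> U) = cimg c \<inter> cinv c -` U"
  using coord_cinv[OF assms] cinv_coord[OF assms] cinv_in[OF assms] coord_in[OF assms]
  by (force simp: image_iff)

lemma open_coord_image:
  assumes "c \<in> A" "open U"
  shows "open (coord c ` (cdom c \<inter> U))"
  unfolding coord_image_eq[OF assms(1)]
  using continuous_on_open_vimage[OF open_cimg[OF assms(1)]] continuous_on_cinv[OF assms(1)] assms(2)
  by (auto simp: Int_commute)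

lemma C1_on_transition:
  assumes "c \<in> A" "c' \<in> A"
  shows "C1_on (coord c ` (cdom c \<inter> cdom c')) (\<lambda>x. coord c' (cinv c x) $ k)"
proof -
  have "smooth_on (coord c ` (cdom c \<inter> cdom c')) (\<lambda>x. coord c' (cinv c x) $ k)"
    using closed_manifold assms by (auto simp: closed_manifold_def smooth_atlas_def)
  from C1_on_smooth[OF this open_coord_image, of "[]"] assms open_cdom show ?thesis
    by simp
qed

lemma Cinf_C1_mfd: "u \<in> Cinf A \<Longrightarrow> C1_mfd A u"
  using C1_on_smooth[where \<alpha> = "[]", OF _ open_cimg] by (simp add: C1_mfd_def Cinf_def o_def)

lemma cpd_eq: "cpd c i u p = pd i (\<lambda>x. u (cinv c x)) (coord c p)"
  by (simp add: cpd_def o_def)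

lemma cpd_coordinate_change:
  assumes c: "c \<in> A" "c' \<in> A" and p: "p \<in> cdom c" "p \<in> cdom c'"
    and u: "(\<lambda>x. u (cinv c' x)) differentiable (at (coord c' p))"
  shows "cpd c i u p = (\<Sum>k\<in>UNIV. cpd c' k u p * cpd c i (\<lambda>q. coord c' q $ k) p)"
proof -
  let ?S = "coord c ` (cdom c \<inter> cdom c')" and ?\<tau> = "\<lambda>x. coord c' (cinv c x)"
  have S: "open ?S" "coord c p \<in> ?S"
    using open_coord_image[OF c(1) open_cdom[OF c(2)]] p by auto
  have \<tau>p: "?\<tau> (coord c p) = coord c' p"
    using p c by (simp add: cinv_coord)
  have \<tau>: "(\<lambda>x. ?\<tau> x $ k) differentiable (at (coord c p))" for k
    using C1_onD(1)[OF C1_on_transition[OF c] S(2)] .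
  have "pd i (\<lambda>x. u (cinv c x)) (coord c p) = pd i (\<lambda>x. u (cinv c' (?\<tau> x))) (coord c p)"
    by (rule pd_cong[OF S]) (use c in \<open>auto simp: cinv_coord\<close>)
  also have "\<dots> = (\<Sum>k\<in>UNIV. pd k (\<lambda>x. u (cinv c' x)) (coord c' p) * pd i (\<lambda>x. ?\<tau> x $ k) (coord c p))"
    using pd_chain[where F = "\<lambda>x. u (cinv c' x)", OF \<tau>] u \<tau>p by simp
  finally show ?thesis
    by (simp add: cpd_eq)
qed

lemma C1_mfd_differentiable:
  assumes "C1_mfd A u" "c \<in> A" "p \<in> cdom c"
  shows "(\<lambda>x. u (cinv c x)) differentiable (at (coord c p))"
  using assms coord_in[OF assms(2,3)] by (auto simp: C1_mfd_def intro: C1_onD(1))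

lemma continuous_on_mfd:
  assumes "\<And>c. c \<in> A \<Longrightarrow> continuous_on (cimg c) (\<lambda>x. u (cinv c x))"
  shows "continuous_on UNIV u"
proof -
  have "continuous_on (\<Union>c\<in>A. cdom c) u"
  proof (rule continuous_on_open_UN[OF open_cdom])
    fix c assume c: "c \<in> A"
    have "continuous_on (cdom c) (\<lambda>p. u (cinv c (coord c p)))"
      by (rule continuous_on_compose2[OF assms[OF c] continuous_on_coord[OF c]])
        (auto intro: coord_in[OF c])
    then show "continuous_on (cdom c) u"
      by (rule continuous_on_eq) (simp add: cinv_coord[OF c])
  qed
  moreover have "(\<Union>c\<in>A. cdom c) = UNIV"
    using cover by auto
  ultimately show ?thesis by simp
qed

lemma C1_mfd_continuous: "C1_mfd A u \<Longrightarrow> continuous_on UNIV u"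
  by (rule continuous_on_mfd) (auto simp: C1_mfd_def intro: C1_onD(3))

text \<open>The profile on a ball inside a coordinate box, extended by zero. The support is confined
  to a box because all coordinate integrals below are over boxes.\<close>

lemma bump_function:
  obtains c a b u where "c \<in> A" "cbox a b \<subseteq> cimg c" "C1_mfd A u" "0 < u p" "\<And>q. 0 \<le> u q"
    "\<And>q. u q \<noteq> 0 \<Longrightarrow> q \<in> cdom c \<and> coord c q \<in> cbox a b"
proof -
  obtain c where c: "c \<in> A" "p \<in> cdom c"
    using cover by blast
  obtain a b where ab: "cbox a b \<subseteq> cimg c" "coord c p \<in> box a b"
    by (rule open_contains_cbox[OF open_cimg[OF c(1)] coord_in[OF c]])
  obtain r where r: "0 < r" "ball (coord c p) r \<subseteq> box a b"
    by (rule openE[OF open_box ab(2)])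
  define \<beta> where "\<beta> x = (max 0 (r\<^sup>2 - (x - coord c p) \<bullet> (x - coord c p)))\<^sup>2" for x
  have \<beta>: "\<beta> x = 0 \<longleftrightarrow> x \<notin> ball (coord c p) r" for x
    unfolding \<beta>_def by (rule bump_eq_0_iff[OF r(1)])
  have \<beta>_box: "x \<in> cbox a b" if "\<beta> x \<noteq> 0" for x
  proof -
    have "x \<in> ball (coord c p) r"
      using that \<beta>[of x] by simp
    then show ?thesis
      using r(2) box_subset_cbox[of a b] by auto
  qed
  define u where "u q = (if q \<in> cdom c then \<beta> (coord c q) else 0)" for q
  \<comment> \<open>\<open>u\<close> vanishes off \<open>K\<close>, which is compact and hence
    closed by the Hausdorff property. So \<open>cdom c\<close> and the complement of
    \<open>K\<close> form an open cover, and on each of them \<open>u\<close> is \<open>C1\<close>: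
    a transported bump on the first, zero on the second.\<close>
  define K where "K = cinv c ` cbox a b"
  have "closed K"
    unfolding K_def using ab(1)
    by (rule compact_imp_closed[OF compact_continuous_image[OF
          continuous_on_subset[OF continuous_on_cinv[OF c(1)]] compact_cbox]])
  have K: "q \<in> K" if "u q \<noteq> 0" for q
  proof -
    have "q \<in> cdom c" "coord c q \<in> cbox a b"
      using that \<beta>_box[of "coord c q"] by (auto simp: u_def split: if_splits)
    then show ?thesis
      unfolding K_def using cinv_coord[OF c(1)] by (metis imageI)
  qed
  have "C1_on (cimg d) (\<lambda>x. u (cinv d x))" if d: "d \<in> A" for d
  proof -
    let ?S1 = "coord d ` (cdom d \<inter> cdom c)" and ?S2 = "coord d ` (cdom d \<inter> - K)"
    have "K \<subseteq> cdom c"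
      unfolding K_def using ab(1) cinv_in[OF c(1)] by auto
    then have "cimg d = \<Union>{?S1, ?S2}"
      unfolding cimg_def by auto
    moreover have o: "open ?S1" "open ?S2"
      using open_coord_image[OF d] open_cdom[OF c(1)] \<open>closed K\<close> by auto
    moreover have "C1_on ?S1 (\<lambda>x. u (cinv d x))"
    proof (rule C1_on_cong[OF o(1)])
      show "C1_on ?S1 (\<lambda>x. \<beta> (coord c (cinv d x)))"
        by (rule C1_on_compose[where T = UNIV])
          (use C1_on_bump C1_on_transition[OF d c(1)] in \<open>auto simp: \<beta>_def[abs_def]\<close>)
    qed (use cinv_coord[OF d] in \<open>auto simp: u_def\<close>)
    moreover have "C1_on ?S2 (\<lambda>x. u (cinv d x))"
    proof (rule C1_on_cong[OF o(2)])
      show "C1_on ?S2 (\<lambda>x. 0)"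
        by (rule C1_on_const)
    qed (use cinv_coord[OF d] K in force)
    ultimately show ?thesis
      using C1_on_Union[of "{?S1, ?S2}"] by auto
  qed
  then have "C1_mfd A u"
    by (simp add: C1_mfd_def)
  moreover have "0 \<le> u q" for q
    by (simp add: u_def \<beta>_def)
  moreover have "u p \<noteq> 0"
    using r(1) c(2) \<beta> by (simp add: u_def)
  moreover have "u q \<noteq> 0 \<Longrightarrow> q \<in> cdom c \<and> coord c q \<in> cbox a b" for q
    using \<beta>_box by (auto simp: u_def split: if_splits)
  ultimately show ?thesis
    using that c ab(1) by (metis less_le)
qed

text \<open>By compactness finitely many bumps have positivity sets covering the manifold; dividing
  by their positive sum normalises them and keeps their supports.\<close>

lemma partition_of_unity:
  obtains I :: "'m set" and ch a b pu where "finite I" "\<And>k. k \<in> I \<Longrightarrow> ch k \<in> A"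
    "\<And>k. k \<in> I \<Longrightarrow> cbox (a k) (b k) \<subseteq> cimg (ch k)" "\<And>k. k \<in> I \<Longrightarrow> C1_mfd A (pu k)"
    "\<And>k q. k \<in> I \<Longrightarrow> pu k q \<noteq> 0 \<Longrightarrow> q \<in> cdom (ch k) \<and> coord (ch k) q \<in> cbox (a k) (b k)"
    "\<And>q. (\<Sum>k\<in>I. pu k q) = (1::real)"
proof -
  \<comment> \<open>Chart, box and bump are chosen together as one tuple, so that a single choice
    over the points \<open>p\<close> suffices.\<close>
  define good where "good p z \<longleftrightarrow> (case z of (c, a, b, u) \<Rightarrow>
      c \<in> A \<and> cbox a b \<subseteq> cimg c \<and> C1_mfd A u \<and> 0 < u p \<and> (\<forall>q. 0 \<le> u q) \<and>
      (\<forall>q. u q \<noteq> 0 \<longrightarrow> q \<in> cdom c \<and> coord c q \<in> cbox a b))" for p z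
  have "\<exists>z. good p z" for p
  proof (rule bump_function[of p])
    fix c a b u
    assume "c \<in> A" "cbox a b \<subseteq> cimg c" "C1_mfd A u" "0 < u p" "\<And>q. 0 \<le> u q"
      "\<And>q. u q \<noteq> 0 \<Longrightarrow> q \<in> cdom c \<and> coord c q \<in> cbox a b"
    then have "good p (c, a, b, u)"
      by (simp add: good_def)
    then show ?thesis ..
  qed
  then obtain z where z: "\<And>p. good p (z p)"
    by metis
  define ch where "ch p = fst (z p)" for p
  define a where "a p = fst (snd (z p))" for p
  define b where "b p = fst (snd (snd (z p)))" for p
  define u where "u p = snd (snd (snd (z p)))" for p
  have ch: "ch p \<in> A" and box: "cbox (a p) (b p) \<subseteq> cimg (ch p)"
    and u: "C1_mfd A (u p)" "0 < u p p" "0 \<le> u p q"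
      "u p q \<noteq> 0 \<Longrightarrow> q \<in> cdom (ch p) \<and> coord (ch p) q \<in> cbox (a p) (b p)" for p q
    using z[of p] by (simp_all add: good_def ch_def a_def b_def u_def case_prod_beta)
  have open_pos: "open {q. 0 < u p q}" for p
    using C1_mfd_continuous[OF u(1)] by (intro open_Collect_less continuous_on_const)
  obtain I where I: "I \<subseteq> UNIV" "finite I" "UNIV \<subseteq> (\<Union>p\<in>I. {q. 0 < u p q})"
  proof (rule compactE_image[OF compact_mfd, of UNIV "\<lambda>p. {q. 0 < u p q}"])
    show "UNIV \<subseteq> (\<Union>p\<in>UNIV. {q. 0 < u p q})"
      using u(2) by auto
  qed (use open_pos in auto)
  define w where "w q = (\<Sum>k\<in>I. u k q)" for q
  have w: "0 < w q" for q
  proof -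
    obtain k where "k \<in> I" "0 < u k q"
      using I(3) by blast
    then show ?thesis
      unfolding w_def using I(2) u(3) by (intro sum_pos2) auto
  qed
  show ?thesis
  proof (rule that[of I ch a b "\<lambda>k q. u k q / w q"])
    have "C1_mfd A w"
      unfolding w_def[abs_def] by (intro C1_mfd_sum u(1))
    then show "C1_mfd A (\<lambda>q. u k q / w q)" for k
      using w by (intro C1_mfd_divide u(1)) (auto simp: less_imp_neq[symmetric])
    show "(\<Sum>k\<in>I. u k q / w q) = 1" for q
      using w[of q] by (simp add: w_def flip: sum_divide_distrib)
  qed (use I(2) ch box u(4) in auto)
qed

end

section \<open>The Riemannian measure\<close>

text \<open>The transpose of the usual Jacobian matrix of the transition map from \<open>c\<close>
  to \<open>c'\<close>: rows belong to \<open>c\<close>, columns to \<open>c'\<close>, so it carries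
  the components of a differential in \<open>c'\<close> to those in \<open>c\<close>.\<close>

definition jac :: "('m, 'n::finite) chart \<Rightarrow> ('m, 'n) chart \<Rightarrow> 'm \<Rightarrow> real^'n^'n" where
  "jac c c' p = (\<chi> i k. cpd c i (\<lambda>q. coord c' q $ k) p)"

lemma covariant_jac:
  assumes "covariant A h" "c \<in> A" "c' \<in> A" "p \<in> cdom c" "p \<in> cdom c'"
  shows "h c p = jac c c' p ** h c' p ** transpose (jac c c' p)"
proof -
  have "h c p $ i $ j = (\<Sum>k\<in>UNIV. \<Sum>l\<in>UNIV. h c' p $ k $ l * jac c c' p $ i $ k * jac c c' p $ j $ l)" for i j
    using bspec[OF bspec[OF bspec[OF assms(1)[unfolded covariant_def] assms(2)] assms(3)], of p] assms(4,5)
    by (simp add: jac_def)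
  moreover have "(\<Sum>k\<in>UNIV. \<Sum>l\<in>UNIV. h c' p $ k $ l * jac c c' p $ i $ k * jac c c' p $ j $ l) =
      (\<Sum>l\<in>UNIV. (\<Sum>k\<in>UNIV. jac c c' p $ i $ k * h c' p $ k $ l) * jac c c' p $ j $ l)" for i j
    by (subst sum.swap) (simp add: sum_distrib_left sum_distrib_right mult_ac)
  ultimately show ?thesis
    by (simp add: vec_eq_iff matrix_matrix_mult_def transpose_def)
qed

abbreviation vol :: "('m, 'n::finite) tensor2 \<Rightarrow> ('m, 'n) chart \<Rightarrow> real^'n \<Rightarrow> real" where
  "vol g c x \<equiv> sqrt (det (g c (cinv c x)))"

context closed_mfd
begin

lemma
  assumes "riemannian_metric A g" "c \<in> A"
  shows metric_det_pos: "p \<in> cdom c \<Longrightarrow> det (g c p) > 0"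
    and metric_sym: "p \<in> cdom c \<Longrightarrow> transpose (g c p) = g c p"
    and C1_on_metric: "C1_on (cimg c) (\<lambda>x. g c (cinv c x) $ i $ j)"
proof -
  show "det (g c p) > 0" "transpose (g c p) = g c p" if "p \<in> cdom c"
    using assms that by (auto simp: riemannian_metric_def transpose_def vec_eq_iff intro!: det_pos_definite)
  have "smooth_on (cimg c) (\<lambda>x. g c (cinv c x) $ i $ j)"
    using assms by (simp add: riemannian_metric_def)
  from C1_on_smooth[OF this open_cimg[OF assms(2)], of "[]"]
  show "C1_on (cimg c) (\<lambda>x. g c (cinv c x) $ i $ j)"
    by simp
qed

lemma continuous_on_vol:
  assumes "riemannian_metric A g" "c \<in> A"
  shows "continuous_on (cimg c) (vol g c)"
  by (intro continuous_on_real_sqrt continuous_on_det C1_onD(3)[OF C1_on_metric[OF assms]])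

lemma sets_coord_image:
  assumes c: "c \<in> A" and B: "B \<in> sets borel"
  shows "coord c ` (cdom c \<inter> B) \<in> sets borel"
proof -
  have "cinv c \<in> restrict_space borel (cimg c) \<rightarrow>\<^sub>M borel"
    by (rule borel_measurable_continuous_on_restrict[OF continuous_on_cinv[OF c]])
  from measurable_sets[OF this B] have "cinv c -` B \<inter> cimg c \<in> sets (restrict_space borel (cimg c))"
    by (simp add: space_restrict_space)
  then show ?thesis
    unfolding coord_image_eq[OF c] using open_cimg[OF c]
    by (subst Int_commute) (simp add: sets_restrict_space_iff)
qed

lemma sets_coord_image_subset:
  assumes "c \<in> A" "B \<in> sets borel" "B \<subseteq> cdom c"
  shows "coord c ` B \<in> sets borel"
  using sets_coord_image[OF assms(1,2)] assms(3) by (simp add: Int_absorb1)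

text \<open>By covariance the Gram determinants in the two charts differ by the squared Jacobian
  determinant; its square root is exactly the factor in the change of variables formula.\<close>

lemma nn_integral_vol_chart_change:
  assumes g: "riemannian_metric A g" and c: "c \<in> A" "c' \<in> A"
    and B: "B \<in> sets borel" "B \<subseteq> cdom c" "B \<subseteq> cdom c'"
  shows "(\<integral>\<^sup>+y\<in>coord c' ` B. ennreal (vol g c' y) \<partial>lborel) =
    (\<integral>\<^sup>+x\<in>coord c ` B. ennreal (vol g c x) \<partial>lborel)"
proof -
  define \<tau> where "\<tau> x = coord c' (cinv c x)" for x
  define \<tau>' where "\<tau>' x = (\<lambda>v. \<chi> k. \<Sum>i\<in>UNIV. v $ i * pd i (\<lambda>y. \<tau> y $ k) x)" for x
  have \<tau>_coord: "\<tau> (coord c p) = coord c' p" if "p \<in> B" for p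
    using that B cinv_coord[OF c(1)] by (auto simp: \<tau>_def)
  have im: "\<tau> ` coord c ` B = coord c' ` B"
    by (auto simp: image_comp \<tau>_coord)
  have det: "\<bar>det (matrix (\<tau>' x))\<bar> * vol g c' (\<tau> x) = vol g c x" if x: "x \<in> coord c ` B" for x
  proof -
    obtain p where p: "p \<in> B" "x = coord c p"
      using x by auto
    have pc: "p \<in> cdom c" "p \<in> cdom c'"
      using p B by auto
    have "matrix (\<tau>' x) = transpose (jac c c' p)"
      by (simp add: matrix_def \<tau>'_def transpose_def jac_def cpd_eq \<tau>_def p(2) vec_eq_iff axis_def
          if_distrib[where f = "\<lambda>z. z * _"] cong: if_cong)
    then have "\<bar>det (matrix (\<tau>' x))\<bar> * sqrt (det (g c' p)) = sqrt ((det (jac c c' p))\<^sup>2 * det (g c' p))"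
      by (simp add: det_transpose real_sqrt_mult)
    also have "(det (jac c c' p))\<^sup>2 * det (g c' p) = det (g c p)"
      using covariant_jac[of A g c c' p] g c pc
      by (simp add: riemannian_metric_def det_mul det_transpose power2_eq_square)
    finally show ?thesis
      using p pc c by (simp add: \<tau>_coord cinv_coord)
  qed
  have cont: "continuous_on (coord d ` B) (vol g d)" if "d \<in> A" "B \<subseteq> cdom d" for d
    using continuous_on_subset[OF continuous_on_vol[OF g that(1)]] coord_in[OF that(1)] that(2) by blast
  have meas: "(\<lambda>x. indicator (coord d ` B) x * vol g d x) \<in> borel_measurable borel"
    if "d \<in> A" "B \<subseteq> cdom d" for d
    using borel_measurable_continuous_on_indicator[OF sets_coord_image_subset[OF that(1) B(1) that(2)] cont[OF that]]
    by simp
  have "(\<integral>\<^sup>+y\<in>\<tau> ` coord c ` B. ennreal (vol g c' y) \<partial>lborel) =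
      (\<integral>\<^sup>+x\<in>coord c ` B. ennreal (\<bar>det (matrix (\<tau>' x))\<bar> * vol g c' (\<tau> x)) \<partial>lborel)"
  proof (rule nn_integral_change_of_variables)
    show "coord c ` B \<in> sets borel"
      by (rule sets_coord_image_subset[OF c(1) B(1,2)])
    show "(\<tau> has_derivative \<tau>' x) (at x within coord c ` B)" if "x \<in> coord c ` B" for x
    proof -
      have "x \<in> coord c ` (cdom c \<inter> cdom c')"
        using that B by auto
      then have "(\<lambda>y. \<tau> y $ k) differentiable (at x)" for k
        unfolding \<tau>_def by (rule C1_onD(1)[OF C1_on_transition[OF c]])
      from has_derivative_cart[OF this] show ?thesis
        unfolding \<tau>'_def by (rule has_derivative_at_withinI)
    qed
    show "inj_on \<tau> (coord c ` B)"
    proof (rule inj_onI)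
      fix x y assume "x \<in> coord c ` B" "y \<in> coord c ` B" "\<tau> x = \<tau> y"
      then obtain p q where "p \<in> B" "q \<in> B" "x = coord c p" "y = coord c q" "coord c' p = coord c' q"
        using \<tau>_coord by auto
      then show "x = y"
        using cinv_coord[OF c(2)] B(3) by (metis subsetD)
    qed
    show "(\<lambda>y. indicator (\<tau> ` coord c ` B) y * vol g c' y) \<in> borel_measurable borel"
      unfolding im by (rule meas[OF c(2) B(3)])
    show "0 \<le> vol g c' y" if "y \<in> \<tau> ` coord c ` B" for y
      using that metric_det_pos[OF g c(2)] B(3) cinv_coord[OF c(2)] unfolding im
      by (auto simp: less_imp_le)
    have "(\<lambda>x. indicator (coord c ` B) x * (\<bar>det (matrix (\<tau>' x))\<bar> * vol g c' (\<tau> x))) =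
        (\<lambda>x. indicator (coord c ` B) x * vol g c x)"
      using det by (auto simp: indicator_def fun_eq_iff)
    then show "(\<lambda>x. indicator (coord c ` B) x * (\<bar>det (matrix (\<tau>' x))\<bar> * vol g c' (\<tau> x))) \<in> borel_measurable borel"
      using meas[OF c(1) B(2)] by simp
  qed
  also have "\<dots> = (\<integral>\<^sup>+x\<in>coord c ` B. ennreal (vol g c x) \<partial>lborel)"
    by (rule nn_integral_cong) (simp add: det indicator_def)
  finally show ?thesis
    by (simp add: im)
qed

section \<open>Existence and uniqueness of the Riemannian measure\<close>

definition chart_measure :: "('m, 'n) tensor2 \<Rightarrow> ('m, 'n) chart \<Rightarrow> 'm measure" where
  "chart_measure g c =
     distr (density (restrict_space lborel (cimg c)) (\<lambda>x. ennreal (vol g c x))) borel (cinv c)"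

lemma
  assumes g: "riemannian_metric A g" and c: "c \<in> A"
  shows measurable_cinv: "cinv c \<in> restrict_space lborel (cimg c) \<rightarrow>\<^sub>M borel"
    and measurable_vol: "vol g c \<in> borel_measurable (restrict_space lborel (cimg c))"
proof -
  have "sets (restrict_space lborel (cimg c)) = sets (restrict_space borel (cimg c))"
    by (intro sets_restrict_space_cong) simp
  then have *: "measurable (restrict_space lborel (cimg c)) N = measurable (restrict_space borel (cimg c)) N" for N
    by (rule measurable_cong_sets) simp
  show "cinv c \<in> restrict_space lborel (cimg c) \<rightarrow>\<^sub>M borel"
    unfolding * by (rule borel_measurable_continuous_on_restrict[OF continuous_on_cinv[OF c]])
  show "vol g c \<in> borel_measurable (restrict_space lborel (cimg c))"
    unfolding * by (rule borel_measurable_continuous_on_restrict[OF continuous_on_vol[OF g c]])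
qed

lemma emeasure_chart_measure:
  assumes g: "riemannian_metric A g" and c: "c \<in> A" and B: "B \<in> sets borel"
  shows "emeasure (chart_measure g c) B = (\<integral>\<^sup>+x\<in>coord c ` (cdom c \<inter> B). ennreal (vol g c x) \<partial>lborel)"
proof -
  let ?R = "restrict_space lborel (cimg c)"
  have o: "cimg c \<inter> space lborel \<in> sets lborel"
    using open_cimg[OF c] by simp
  have S: "cinv c -` B \<inter> cimg c \<in> sets ?R"
    using measurable_sets[OF measurable_cinv[OF g c] B] by (simp add: space_restrict_space)
  have "emeasure (chart_measure g c) B = emeasure (density ?R (\<lambda>x. ennreal (vol g c x))) (cinv c -` B \<inter> cimg c)"
    unfolding chart_measure_def using measurable_cinv[OF g c] B
    by (simp add: emeasure_distr space_restrict_space)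
  also have "\<dots> = (\<integral>\<^sup>+x. ennreal (vol g c x) * indicator (cinv c -` B \<inter> cimg c) x \<partial>?R)"
    using measurable_vol[OF g c] S by (simp add: emeasure_density)
  also have "\<dots> = (\<integral>\<^sup>+x\<in>cimg c. ennreal (vol g c x) * indicator (cinv c -` B \<inter> cimg c) x \<partial>lborel)"
    by (rule nn_integral_restrict_space[OF o])
  also have "\<dots> = (\<integral>\<^sup>+x\<in>coord c ` (cdom c \<inter> B). ennreal (vol g c x) \<partial>lborel)"
    unfolding coord_image_eq[OF c] by (rule nn_integral_cong) (auto simp: indicator_def)
  finally show ?thesis .
qed

text \<open>Disjoint pieces, each inside one chart, allow chart measures to be added without
  counting overlaps twice.\<close>

lemma borel_chart_partition:
  obtains C P where "finite C" "C \<subseteq> A" "\<And>c. c \<in> C \<Longrightarrow> P c \<in> sets borel" "\<And>c. c \<in> C \<Longrightarrow> P c \<subseteq> cdom c"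
    "disjoint_family_on P C" "(\<Union>c\<in>C. P c) = (UNIV :: 'm set)"
proof -
  obtain C where C: "C \<subseteq> A" "finite C" "UNIV \<subseteq> (\<Union>c\<in>C. cdom c)"
  proof (rule compactE_image[OF compact_mfd, of A cdom])
    show "UNIV \<subseteq> (\<Union>c\<in>A. cdom c)"
      using cover by auto
  qed (use open_cdom in auto)
  have "\<exists>P. (\<forall>c\<in>D. P c \<in> sets borel \<and> P c \<subseteq> cdom c) \<and> disjoint_family_on P D \<and>
      (\<Union>c\<in>D. P c) = (\<Union>c\<in>D. cdom c)" if "finite D" "D \<subseteq> A" for D
    using that
  proof (induction D)
    case empty
    show ?case by (simp add: disjoint_family_on_def)
  next
    case (insert c D)
    then have "\<exists>P. (\<forall>c\<in>D. P c \<in> sets borel \<and> P c \<subseteq> cdom c) \<and> disjoint_family_on P D \<and>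
      (\<Union>c\<in>D. P c) = (\<Union>c\<in>D. cdom c)"
      by simp
    then obtain P where P: "\<forall>c\<in>D. P c \<in> sets borel \<and> P c \<subseteq> cdom c" "disjoint_family_on P D"
      "(\<Union>c\<in>D. P c) = (\<Union>c\<in>D. cdom c)"
      by (elim exE conjE)
    \<comment> \<open>The new piece keeps what the charts in \<open>D\<close> leave uncovered; it is
      Borel as a difference of open sets.\<close>
    let ?P = "P(c := cdom c - (\<Union>c\<in>D. cdom c))"
    have "open (\<Union>c\<in>D. cdom c)"
      using insert.prems open_cdom by blast
    then have "cdom c - (\<Union>c\<in>D. cdom c) \<in> sets borel"
      using insert.prems open_cdom[of c] by auto
    moreover have "?P d = P d" if "d \<in> D" for d
      using that insert.hyps by auto
    ultimately show ?case
      using P insert.hyps by (intro exI[of _ ?P]) (auto simp: disjoint_family_on_def)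
  qed
  from this[OF C(2,1)] obtain P where "\<forall>c\<in>C. P c \<in> sets borel \<and> P c \<subseteq> cdom c"
    "disjoint_family_on P C" "(\<Union>c\<in>C. P c) = (\<Union>c\<in>C. cdom c)"
    by (elim exE conjE)
  then show ?thesis
    using C by (intro that[of C P]) auto
qed

lemma emeasure_borel_partition:
  fixes \<mu> :: "'m measure"
  assumes "finite C" "\<And>c. c \<in> C \<Longrightarrow> P c \<in> sets borel" "disjoint_family_on P C" "(\<Union>c\<in>C. P c) = UNIV"
    and "sets \<mu> = sets borel" "B \<in> sets borel"
  shows "emeasure \<mu> B = (\<Sum>c\<in>C. emeasure \<mu> (B \<inter> P c))"
proof -
  have "B = (\<Union>c\<in>C. B \<inter> P c)"
    using assms(4) by auto
  moreover have "(\<Sum>c\<in>C. emeasure \<mu> (B \<inter> P c)) = emeasure \<mu> (\<Union>c\<in>C. B \<inter> P c)"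
    using assms by (intro sum_emeasure) (auto simp: disjoint_family_on_def)
  ultimately show ?thesis by simp
qed

lemma is_riemannian_measureD:
  assumes "is_riemannian_measure A g \<mu>" "c \<in> A" "B \<in> sets borel" "B \<subseteq> cdom c"
  shows "emeasure \<mu> B = (\<integral>\<^sup>+x\<in>coord c ` B. ennreal (vol g c x) \<partial>lborel)"
  using assms unfolding is_riemannian_measure_def by simp

text \<open>The definite description in \<open>riemannian_measure\<close> conveys information only
  once existence and uniqueness are known; both are obtained here by cutting along a Borel partition
  subordinate to charts.\<close>

lemma is_riemannian_measure:
  assumes g: "riemannian_metric A g"
  shows "is_riemannian_measure A g (riemannian_measure A g)"
proof -
  obtain C P where C: "finite C" "C \<subseteq> A" and P: "\<And>c. c \<in> C \<Longrightarrow> P c \<in> sets borel" "\<And>c. c \<in> C \<Longrightarrow> P c \<subseteq> cdom c"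
    "disjoint_family_on P C" "(\<Union>c\<in>C. P c) = (UNIV :: 'm set)"
    by (rule borel_chart_partition) blast
  \<comment> \<open>Each piece of \<open>B\<close> is measured in the chart that its index
    names.\<close>
  define m where "m B = (\<Sum>d\<in>C. emeasure (chart_measure g d) (B \<inter> P d))" for B
  define \<mu> where "\<mu> = measure_of (UNIV :: 'm set) (sets borel) m"
  have sets_\<mu>: "sets \<mu> = sets borel"
    unfolding \<mu>_def using sets.sigma_sets_eq[of "borel :: 'm measure"] by simp
  have sets_cm: "sets (chart_measure g d) = sets borel" for d
    by (simp add: chart_measure_def)
  have m: "emeasure \<mu> B = m B" if "B \<in> sets borel" for B
    unfolding \<mu>_def
  proof (rule emeasure_measure_of_sigma[OF _ _ _ that])
    show "sigma_algebra UNIV (sets (borel :: 'm measure))"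
      using sets.sigma_algebra_axioms[of "borel :: 'm measure"] by simp
    show "positive (sets borel) m"
      by (simp add: positive_def m_def)
    show "countably_additive (sets borel) m"
    proof (rule countably_additiveI)
      fix F :: "nat \<Rightarrow> 'm set"
      assume F: "range F \<subseteq> sets borel" "disjoint_family F"
      have "(\<Sum>i. m (F i)) = (\<Sum>d\<in>C. \<Sum>i. emeasure (chart_measure g d) (F i \<inter> P d))"
        unfolding m_def by (rule suminf_sum) simp
      also have "\<dots> = (\<Sum>d\<in>C. emeasure (chart_measure g d) (\<Union>i. F i \<inter> P d))"
      proof (rule sum.cong[OF refl], rule suminf_emeasure)
        fix d assume "d \<in> C"
        then show "range (\<lambda>i. F i \<inter> P d) \<subseteq> sets (chart_measure g d)"
          using F(1) P(1)[of d] by (auto simp: sets_cm)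
      qed (use F(2) in \<open>auto simp: disjoint_family_on_def\<close>)
      finally show "(\<Sum>i. m (F i)) = m (\<Union> (range F))"
        by (simp add: m_def)
    qed
  qed
  have rm_\<mu>: "is_riemannian_measure A g \<mu>"
    unfolding is_riemannian_measure_def
  proof (intro conjI ballI impI sets_\<mu>)
    fix c and B :: "'m set" assume c: "c \<in> A" and B: "B \<in> sets borel" "B \<subseteq> cdom c"
    \<comment> \<open>On an overlap the density of chart \<open>d\<close> may be exchanged for that
      of \<open>c\<close>; afterwards all pieces reassemble in the single chart
      \<open>c\<close>.\<close>
    have "emeasure (chart_measure g d) (B \<inter> P d) = emeasure (chart_measure g c) (B \<inter> P d)" if "d \<in> C" for d
    proof -
      have "B \<inter> P d \<in> sets borel" "cdom d \<inter> (B \<inter> P d) = B \<inter> P d" "cdom c \<inter> (B \<inter> P d) = B \<inter> P d"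
        using B P(1)[OF that] P(2)[OF that] by auto
      with that c C(2) B(2) P(2)[OF that] show ?thesis
        by (subst (1 2) emeasure_chart_measure[OF g]) (auto intro!: nn_integral_vol_chart_change[OF g])
    qed
    then have "emeasure \<mu> B = (\<Sum>d\<in>C. emeasure (chart_measure g c) (B \<inter> P d))"
      by (simp add: m[OF B(1)] m_def)
    also have "\<dots> = emeasure (chart_measure g c) B"
      by (rule emeasure_borel_partition[OF C(1) P(1,3,4) sets_cm B(1), symmetric])
    also have "\<dots> = (\<integral>\<^sup>+x\<in>coord c ` B. ennreal (vol g c x) \<partial>lborel)"
      using B by (simp add: emeasure_chart_measure[OF g c] Int_absorb1)
    finally show "emeasure \<mu> B = (\<integral>\<^sup>+x\<in>coord c ` B. ennreal (vol g c x) \<partial>lborel)" .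
  qed
  \<comment> \<open>Uniqueness: on every piece the value is prescribed by a coordinate integral, and
    the pieces add up.\<close>
  have "\<nu> = \<mu>" if \<nu>: "is_riemannian_measure A g \<nu>" for \<nu>
  proof (rule measure_eqI)
    show "sets \<nu> = sets \<mu>"
      using \<nu> by (simp add: is_riemannian_measure_def sets_\<mu>)
    fix B assume "B \<in> sets \<nu>"
    then have B: "B \<in> sets borel"
      using \<nu> by (simp add: is_riemannian_measure_def)
    have "emeasure \<nu> (B \<inter> P d) = emeasure \<mu> (B \<inter> P d)" if "d \<in> C" for d
    proof -
      have "d \<in> A" "B \<inter> P d \<in> sets borel" "B \<inter> P d \<subseteq> cdom d"
        using that C(2) P(1)[OF that] P(2)[OF that] B by auto
      then show ?thesis
        by (simp only: is_riemannian_measureD[OF \<nu>] is_riemannian_measureD[OF rm_\<mu>])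
    qed
    moreover have "sets \<nu> = sets borel"
      using \<nu> by (simp add: is_riemannian_measure_def)
    ultimately show "emeasure \<nu> B = emeasure \<mu> B"
      using emeasure_borel_partition[OF C(1) P(1,3,4) _ B] sets_\<mu> by simp
  qed
  with rm_\<mu> show ?thesis
    unfolding riemannian_measure_def by (rule theI)
qed

lemma sets_riemannian_measure:
  "riemannian_metric A g \<Longrightarrow> sets (riemannian_measure A g) = sets borel"
  using is_riemannian_measure by (simp add: is_riemannian_measure_def)

text \<open>Restricted to one chart, the measure is a push-forward from coordinates; this is how
  integrals over the manifold reach \<open>lborel\<close>.\<close>

lemma density_riemannian_measure:
  assumes g: "riemannian_metric A g" and c: "c \<in> A"
  shows "density (riemannian_measure A g) (indicator (cdom c)) = chart_measure g c"
proof (rule measure_eqI)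
  let ?\<mu> = "riemannian_measure A g"
  show "sets (density ?\<mu> (indicator (cdom c))) = sets (chart_measure g c)"
    by (simp add: chart_measure_def sets_riemannian_measure[OF g])
  fix B assume "B \<in> sets (density ?\<mu> (indicator (cdom c)))"
  then have B: "B \<in> sets borel"
    by (simp add: sets_riemannian_measure[OF g])
  have c_borel: "cdom c \<in> sets borel"
    using open_cdom[OF c] by simp
  have "emeasure (density ?\<mu> (indicator (cdom c))) B = (\<integral>\<^sup>+p. indicator (cdom c) p * indicator B p \<partial>?\<mu>)"
    using B c_borel by (intro emeasure_density borel_measurable_indicator) (auto simp: sets_riemannian_measure[OF g])
  also have "\<dots> = (\<integral>\<^sup>+p. indicator (cdom c \<inter> B) p \<partial>?\<mu>)"
    by (rule nn_integral_cong) (auto simp: indicator_def)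
  also have "\<dots> = emeasure ?\<mu> (cdom c \<inter> B)"
    using B c_borel by (intro nn_integral_indicator) (auto simp: sets_riemannian_measure[OF g])
  also have "\<dots> = emeasure (chart_measure g c) B"
    using is_riemannian_measureD[OF is_riemannian_measure[OF g] c, of "cdom c \<inter> B"] B c_borel
    by (simp add: emeasure_chart_measure[OF g c B])
  finally show "emeasure (density ?\<mu> (indicator (cdom c))) B = emeasure (chart_measure g c) B" .
qed

text \<open>As \<open>u\<close> vanishes outside \<open>cdom c\<close>, inserting the indicator of
  that domain changes nothing, and the restricted measure may be used. Continuity on the compact box
  provides integrability.\<close>

lemma
  fixes u :: "'m \<Rightarrow> real"
  assumes g: "riemannian_metric A g" and c: "c \<in> A" and box: "cbox a b \<subseteq> cimg c"
    and u: "continuous_on UNIV u" and supp: "\<And>q. u q \<noteq> 0 \<Longrightarrow> q \<in> cdom c \<and> coord c q \<in> cbox a b"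
  shows integrable_chart: "integrable (riemannian_measure A g) u"
    and integral_chart: "(\<integral>q. u q \<partial>riemannian_measure A g) = integral (cbox a b) (\<lambda>x. u (cinv c x) * vol g c x)"
proof -
  let ?\<mu> = "riemannian_measure A g" and ?R = "restrict_space lborel (cimg c)"
  let ?h = "\<lambda>x. u (cinv c x) * vol g c x"
  have u_meas: "u \<in> borel_measurable borel"
    using u by (rule borel_measurable_continuous_onI)
  have u_meas': "u \<in> borel_measurable ?\<mu>"
    using u_meas by (simp add: measurable_cong_sets[OF sets_riemannian_measure[OF g] refl])
  have ind_u: "indicator (cdom c) q *\<^sub>R u q = u q" for q
    using supp[of q] by (auto simp: indicator_def)
  have dens: "density ?\<mu> (\<lambda>q. ennreal (indicator (cdom c) q)) = chart_measure g c"
    using density_riemannian_measure[OF g c] by (simp add: ennreal_indicator)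
  have ind_real: "(indicator (cdom c) :: 'm \<Rightarrow> real) \<in> borel_measurable ?\<mu>"
    using open_cdom[OF c] by (intro borel_measurable_indicator) (simp add: sets_riemannian_measure[OF g])
  have uc_meas: "(\<lambda>x. u (cinv c x)) \<in> borel_measurable ?R"
    by (rule measurable_compose[OF measurable_cinv[OF g c] u_meas])
  have vol_nn: "0 \<le> vol g c x" if "x \<in> cimg c" for x
    using metric_det_pos[OF g c cinv_in[OF c that]] by simp
  have h_box: "?h x = 0" if "x \<in> cimg c" "x \<notin> cbox a b" for x
    using supp[of "cinv c x"] that coord_cinv[OF c] by fastforce
  have h_cont: "continuous_on (cbox a b) ?h"
    by (intro continuous_intros continuous_on_subset[OF continuous_on_vol[OF g c] box]
        continuous_on_compose2[OF u continuous_on_subset[OF continuous_on_cinv[OF c] box]]) auto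
  have int_h: "integrable lborel (\<lambda>x. indicator (cbox a b) x *\<^sub>R ?h x)"
    by (rule borel_integrable_compact[OF compact_cbox h_cont])
  have ind_h: "indicator (cimg c) x *\<^sub>R (vol g c x *\<^sub>R u (cinv c x)) = indicator (cbox a b) x *\<^sub>R ?h x" for x
    using box h_box[of x] by (auto simp: indicator_def)
  have o: "cimg c \<inter> space lborel \<in> sets lborel"
    using open_cimg[OF c] by simp
  have vol_ae: "AE x in ?R. 0 \<le> vol g c x"
    using vol_nn by (intro AE_I2) (simp add: space_restrict_space)
  have "integrable ?R (\<lambda>x. vol g c x *\<^sub>R u (cinv c x))"
    unfolding integrable_restrict_space[OF o] set_integrable_def ind_h by (rule int_h)
  then have "integrable (density ?R (\<lambda>x. ennreal (vol g c x))) (\<lambda>x. u (cinv c x))"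
    using integrable_density[OF uc_meas measurable_vol[OF g c] vol_ae] by simp
  then have "integrable (chart_measure g c) u"
    unfolding chart_measure_def using measurable_cinv[OF g c] u_meas
    by (subst integrable_distr_eq) auto
  then have "integrable ?\<mu> (\<lambda>q. indicator (cdom c) q *\<^sub>R u q)"
    using integrable_density[OF u_meas' ind_real] dens by simp
  then show "integrable ?\<mu> u"
    by (simp only: ind_u)
  have "(\<integral>q. u q \<partial>?\<mu>) = (\<integral>q. indicator (cdom c) q *\<^sub>R u q \<partial>?\<mu>)"
    by (simp only: ind_u)
  also have "\<dots> = (\<integral>q. u q \<partial>chart_measure g c)"
    using integral_density[OF u_meas' ind_real] dens by simp
  also have "\<dots> = (\<integral>x. u (cinv c x) \<partial>density ?R (\<lambda>x. ennreal (vol g c x)))"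
    unfolding chart_measure_def using measurable_cinv[OF g c] u_meas
    by (subst integral_distr) auto
  also have "\<dots> = (\<integral>x. vol g c x *\<^sub>R u (cinv c x) \<partial>?R)"
    by (rule integral_density[OF uc_meas measurable_vol[OF g c] vol_ae])
  also have "\<dots> = (\<integral>x. indicator (cbox a b) x *\<^sub>R ?h x \<partial>lborel)"
    unfolding integral_restrict_space[OF o] set_lebesgue_integral_def ind_h ..
  also have "\<dots> = integral (cbox a b) ?h"
    using set_borel_integral_eq_integral(2)[of "cbox a b" ?h] int_h
    by (simp add: set_integrable_def set_lebesgue_integral_def)
  finally show "(\<integral>q. u q \<partial>?\<mu>) = integral (cbox a b) ?h" .
qed

end

section \<open>Chart independence of tensor contractions\<close>

text \<open>Here \<open>H\<close> stands for the inverse metric and \<open>D i\<close> for the i-th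
  derivative of the metric. Then \<open>H ** D i ** H\<close> is minus the derivative of
  \<open>H\<close>, and half of \<open>trace (H ** D i)\<close> is the logarithmic derivative of
  sqrt(det g). So the contracted Christoffel symbol is minus the divergence of sqrt(det g)
  \<open>H\<close>, divided by sqrt(det g).\<close>

lemma christoffel_trace_identity:
  fixes H :: "real^'n::finite^'n" and D :: "'n \<Rightarrow> real^'n^'n"
  assumes "transpose H = H"
  shows "(\<Sum>i\<in>UNIV. \<Sum>j\<in>UNIV. H $ i $ j *
      ((1/2) * (\<Sum>l\<in>UNIV. H $ k $ l * (D i $ j $ l + D j $ i $ l - D l $ i $ j)))) =
    (\<Sum>i\<in>UNIV. (H ** D i ** H) $ i $ k) - (1/2) * (\<Sum>i\<in>UNIV. H $ i $ k * trace (H ** D i))"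
proof -
  have sym: "H $ i $ j = H $ j $ i" for i j
    using assms by (metis transpose_def vec_lambda_beta)
  let ?T1 = "\<Sum>i\<in>UNIV. \<Sum>j\<in>UNIV. \<Sum>l\<in>UNIV. H $ i $ j * H $ k $ l * D i $ j $ l"
  let ?T2 = "\<Sum>i\<in>UNIV. \<Sum>j\<in>UNIV. \<Sum>l\<in>UNIV. H $ i $ j * H $ k $ l * D j $ i $ l"
  let ?T3 = "\<Sum>i\<in>UNIV. \<Sum>j\<in>UNIV. \<Sum>l\<in>UNIV. H $ i $ j * H $ k $ l * D l $ i $ j"
  have "(\<Sum>i\<in>UNIV. \<Sum>j\<in>UNIV. H $ i $ j *
      ((1/2) * (\<Sum>l\<in>UNIV. H $ k $ l * (D i $ j $ l + D j $ i $ l - D l $ i $ j)))) =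
      (1/2) * (?T1 + ?T2 - ?T3)"
    by (simp add: sum_distrib_left sum_distrib_right sum.distrib sum_subtractf algebra_simps)
  \<comment> \<open>Exchanging the names of \<open>i\<close> and \<open>j\<close> identifies the two
    sums, as \<open>H\<close> is symmetric.\<close>
  moreover have "?T2 = ?T1"
    by (subst sum.swap) (simp add: sym)
  moreover have "?T1 = (\<Sum>i\<in>UNIV. (H ** D i ** H) $ i $ k)"
  proof (rule sum.cong[OF refl])
    fix i
    have "(H ** D i ** H) $ i $ k = (\<Sum>l\<in>UNIV. \<Sum>j\<in>UNIV. H $ i $ j * H $ k $ l * D i $ j $ l)"
      by (simp add: matrix_matrix_mult_def sum_distrib_right sum_distrib_left sym[of _ k] mult_ac)
    then show "(\<Sum>j\<in>UNIV. \<Sum>l\<in>UNIV. H $ i $ j * H $ k $ l * D i $ j $ l) = (H ** D i ** H) $ i $ k"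
      by (subst sum.swap) simp
  qed
  moreover have "?T3 = (\<Sum>l\<in>UNIV. H $ l $ k * trace (H ** D l))"
  proof -
    have "H $ l $ k * trace (H ** D l) = (\<Sum>j\<in>UNIV. \<Sum>i\<in>UNIV. H $ i $ j * H $ k $ l * D l $ i $ j)" for l
      by (simp add: trace_def matrix_matrix_mult_def sum_distrib_left sym[of _ k] mult_ac)
        (simp add: sym mult_ac)
    then have "H $ l $ k * trace (H ** D l) = (\<Sum>i\<in>UNIV. \<Sum>j\<in>UNIV. H $ i $ j * H $ k $ l * D l $ i $ j)" for l
      by (subst sum.swap) simp
    moreover have "?T3 = (\<Sum>i\<in>UNIV. \<Sum>l\<in>UNIV. \<Sum>j\<in>UNIV. H $ i $ j * H $ k $ l * D l $ i $ j)"
      by (rule sum.cong[OF refl], rule sum.swap)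
    then have "?T3 = (\<Sum>l\<in>UNIV. \<Sum>i\<in>UNIV. \<Sum>j\<in>UNIV. H $ i $ j * H $ k $ l * D l $ i $ j)"
      by (subst sum.swap) simp
    ultimately show ?thesis by simp
  qed
  ultimately show ?thesis by (simp add: algebra_simps)
qed

definition dvec :: "('m, 'n::finite) chart \<Rightarrow> ('m \<Rightarrow> real) \<Rightarrow> 'm \<Rightarrow> real^'n" where
  "dvec c u p = (\<chi> i. cpd c i u p)"

text \<open>The polarised squared gradient norm, expressed on differentials through the inverse
  metric. \<open>cometric_chart\<close> shows that the choice made by \<open>chart_at\<close> is
  immaterial.\<close>

definition cometric :: "('m, 'n::finite) chart set \<Rightarrow> ('m, 'n) tensor2 \<Rightarrow> ('m \<Rightarrow> real) \<Rightarrow> ('m \<Rightarrow> real) \<Rightarrow> 'm \<Rightarrow> real" where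
  "cometric A g u v p = (let c = chart_at A p in dvec c u p \<bullet> (matrix_inv (g c p) *v dvec c v p))"

lemma matrix_inv_congruence:
  fixes J M :: "real^'n::finite^'n"
  assumes "G = J ** M ** transpose J" "det G \<noteq> 0"
  shows "matrix_inv M = transpose J ** matrix_inv G ** J"
proof -
  have "J ** (M ** transpose J ** matrix_inv G) = mat 1"
    using matrix_inv_mult(2)[OF assms(2)] assms(1) by (simp add: matrix_mul_assoc)
  \<comment> \<open>A right inverse of a square matrix is a left inverse, so \<open>J\<close> moves
    to the other end without being inverted itself.\<close>
  then have "(M ** transpose J ** matrix_inv G) ** J = mat 1"
    by (simp add: matrix_left_right_inverse)
  then show ?thesis
    by (intro matrix_inv_unique) (simp add: matrix_mul_assoc)
qed

lemma inner_matrix_vector_mult: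
  fixes J :: "real^'n::finite^'n"
  shows "(J *v x) \<bullet> y = x \<bullet> (transpose J *v y)"
  by (metis dot_lmul_matrix inner_commute transpose_matrix_vector)

context closed_mfd
begin

lemma chart_at: "chart_at A p \<in> A" "p \<in> cdom (chart_at A p)"
proof -
  have "\<exists>c. c \<in> A \<and> p \<in> cdom c"
    using cover by blast
  then have "chart_at A p \<in> A \<and> p \<in> cdom (chart_at A p)"
    unfolding chart_at_def by (rule someI_ex)
  then show "chart_at A p \<in> A" "p \<in> cdom (chart_at A p)"
    by auto
qed

lemma dvec_chart_change:
  assumes "C1_mfd A u" "c \<in> A" "c' \<in> A" "p \<in> cdom c" "p \<in> cdom c'"
  shows "dvec c u p = jac c c' p *v dvec c' u p"
  using cpd_coordinate_change[OF assms(2-5) C1_mfd_differentiable[OF assms(1,3,5)]]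
  by (simp add: dvec_def jac_def matrix_vector_mult_def vec_eq_iff mult.commute)

lemma metric_congruence:
  assumes "riemannian_metric A g" "c \<in> A" "c' \<in> A" "p \<in> cdom c" "p \<in> cdom c'"
  shows "matrix_inv (g c' p) = transpose (jac c c' p) ** matrix_inv (g c p) ** jac c c' p"
  using covariant_jac[of A g c c' p] assms metric_det_pos[OF assms(1,2,4)]
  by (intro matrix_inv_congruence) (auto simp: riemannian_metric_def)

lemma metric_inv_sym:
  assumes "riemannian_metric A g" "c \<in> A" "p \<in> cdom c"
  shows "transpose (matrix_inv (g c p)) = matrix_inv (g c p)"
  using metric_det_pos[OF assms] metric_sym[OF assms] by (intro symmetric_matrix_inv) auto

text \<open>The Jacobians of the two differentials cancel against the contravariant law for
  \<open>K\<close>. Both the inverse metric and a tensor with two raised indices obey that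
  law.\<close>

lemma bilinear_chart_independent:
  assumes u: "C1_mfd A u" and v: "C1_mfd A v" and c: "c \<in> A" "c' \<in> A" and p: "p \<in> cdom c" "p \<in> cdom c'"
    and K: "K' = transpose (jac c c' p) ** K ** jac c c' p"
  shows "dvec c u p \<bullet> (K *v dvec c v p) = dvec c' u p \<bullet> (K' *v dvec c' v p)"
  by (simp add: dvec_chart_change[OF u c p] dvec_chart_change[OF v c p] K inner_matrix_vector_mult
      matrix_vector_mul_assoc matrix_mul_assoc)

lemma cometric_chart:
  assumes "riemannian_metric A g" "C1_mfd A u" "C1_mfd A v" "c \<in> A" "p \<in> cdom c"
  shows "cometric A g u v p = dvec c u p \<bullet> (matrix_inv (g c p) *v dvec c v p)"
  unfolding cometric_def Let_def
  using bilinear_chart_independent[OF assms(2,3) assms(4) chart_at(1) assms(5) chart_at(2)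
      metric_congruence[OF assms(1,4) chart_at(1) assms(5) chart_at(2)]] by simp

lemma tensor_apply_eq: "tensor_apply A h X Y p = X (chart_at A p) p \<bullet> (h (chart_at A p) p *v Y (chart_at A p) p)"
  by (simp add: tensor_apply_def Let_def inner_vec_def matrix_vector_mult_def sum_distrib_left mult_ac)

lemma grad_eq: "grad g u c p = matrix_inv (g c p) *v dvec c u p"
  by (simp add: grad_def dvec_def matrix_vector_mult_def)

text \<open>Raising both indices of \<open>g\<close> gives the inverse metric again; this connects
  the gradient norm of the theorem with \<open>cometric\<close>.\<close>

lemma tensor_apply_metric_grad:
  assumes "riemannian_metric A g"
  shows "tensor_apply A g (grad g u) (grad g v) p = cometric A g u v p"
proof -
  let ?d = "chart_at A p"
  have "g ?d p ** matrix_inv (g ?d p) = mat 1"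
    using matrix_inv_mult(2)[of "g ?d p"] metric_det_pos[OF assms chart_at] by (simp add: less_imp_neq[symmetric])
  then show ?thesis
    using metric_inv_sym[OF assms chart_at]
    by (simp add: tensor_apply_eq grad_eq cometric_def matrix_vector_mul_assoc inner_matrix_vector_mult Let_def)
qed

text \<open>The matrix on the right is \<open>h\<close> with both indices raised, which transforms
  like the inverse metric, so \<open>bilinear_chart_independent\<close> applies.\<close>

lemma tensor_apply_grad_chart:
  assumes "riemannian_metric A g" "covariant A h" "C1_mfd A u" "C1_mfd A v" "c \<in> A" "p \<in> cdom c"
  shows "tensor_apply A h (grad g u) (grad g v) p =
    dvec c u p \<bullet> ((matrix_inv (g c p) ** h c p ** matrix_inv (g c p)) *v dvec c v p)"
proof -
  let ?d = "chart_at A p"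
  let ?J = "jac c ?d p" and ?H = "matrix_inv (g c p)"
  have "tensor_apply A h (grad g u) (grad g v) p =
      dvec ?d u p \<bullet> ((matrix_inv (g ?d p) ** h ?d p ** matrix_inv (g ?d p)) *v dvec ?d v p)"
    using metric_inv_sym[OF assms(1) chart_at]
    by (simp add: tensor_apply_eq grad_eq matrix_vector_mul_assoc inner_matrix_vector_mult matrix_mul_assoc)
  also have "matrix_inv (g ?d p) ** h ?d p ** matrix_inv (g ?d p) =
      transpose ?J ** (?H ** (?J ** h ?d p ** transpose ?J) ** ?H) ** ?J"
    by (simp add: metric_congruence[OF assms(1,5) chart_at(1) assms(6) chart_at(2)] matrix_mul_assoc)
  also have "?J ** h ?d p ** transpose ?J = h c p"
    using covariant_jac[OF assms(2,5) chart_at(1) assms(6) chart_at(2)] by simp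
  finally show ?thesis
    using bilinear_chart_independent[OF assms(3,4,5) chart_at(1) assms(6) chart_at(2) refl] by simp
qed

lemma trace_wrt_eq:
  assumes "riemannian_metric A g" "c \<in> A" "p \<in> cdom c"
  shows "trace_wrt g h c p = trace (matrix_inv (g c p) ** h c p)"
proof -
  have sym: "matrix_inv (g c p) $ i $ j = matrix_inv (g c p) $ j $ i" for i j
    using arg_cong[OF metric_inv_sym[OF assms], of "\<lambda>M. M $ j $ i"] by (simp add: transpose_def)
  have "trace (matrix_inv (g c p) ** h c p) = (\<Sum>j\<in>UNIV. \<Sum>i\<in>UNIV. matrix_inv (g c p) $ j $ i * h c p $ i $ j)"
    by (simp add: trace_def matrix_matrix_mult_def)
  also have "\<dots> = (\<Sum>j\<in>UNIV. \<Sum>i\<in>UNIV. matrix_inv (g c p) $ i $ j * h c p $ i $ j)"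
    by (intro sum.cong refl arg_cong2[where f = "(*)"] sym)
  also have "\<dots> = trace_wrt g h c p"
    unfolding trace_wrt_def by (rule sum.swap)
  finally show ?thesis by simp
qed

text \<open>Cyclicity of the trace brings the two Jacobians of the inverse metric around
  \<open>h\<close>, where covariance absorbs them.\<close>

lemma trace_wrt_chart:
  assumes "riemannian_metric A g" "covariant A h" "c \<in> A" "p \<in> cdom c"
  shows "trace_wrt g h (chart_at A p) p = trace (matrix_inv (g c p) ** h c p)"
proof -
  let ?d = "chart_at A p"
  let ?J = "jac c ?d p" and ?H = "matrix_inv (g c p)"
  have "trace_wrt g h ?d p = trace (transpose ?J ** (?H ** ?J ** h ?d p))"
    by (simp add: trace_wrt_eq[OF assms(1) chart_at] matrix_mul_assoc
        metric_congruence[OF assms(1,3) chart_at(1) assms(4) chart_at(2)])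
  also have "\<dots> = trace (?H ** (?J ** h ?d p ** transpose ?J))"
    by (subst trace_mul_sym) (simp add: matrix_mul_assoc)
  also have "?J ** h ?d p ** transpose ?J = h c p"
    using covariant_jac[OF assms(2,3) chart_at(1) assms(4) chart_at(2)] by simp
  finally show ?thesis .
qed

lemma continuous_on_metric_inv:
  assumes "riemannian_metric A g" "c \<in> A"
  shows "continuous_on (cimg c) (\<lambda>x. matrix_inv (g c (cinv c x)) $ i $ j)"
  using metric_det_pos[OF assms cinv_in[OF assms(2)]] C1_onD(3)[OF C1_on_metric[OF assms]]
  by (intro continuous_on_matrix_inv) (auto simp: less_imp_neq[symmetric])

lemma dvec_nth: "c \<in> A \<Longrightarrow> x \<in> cimg c \<Longrightarrow> dvec c u (cinv c x) $ i = pd i (\<lambda>x. u (cinv c x)) x"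
  by (simp add: dvec_def cpd_eq coord_cinv)

lemma inner_matrix_vector_sum:
  fixes K :: "real^'n^'n"
  shows "d \<bullet> (K *v e) = (\<Sum>i\<in>UNIV. \<Sum>j\<in>UNIV. K $ i $ j * d $ i * e $ j)"
  by (simp add: inner_vec_def matrix_vector_mult_def sum_distrib_left mult_ac)

lemma continuous_on_bilinear_chart:
  assumes "C1_mfd A u" "C1_mfd A v" "c \<in> A" "\<And>i j. continuous_on (cimg c) (\<lambda>x. K x $ i $ j)"
  shows "continuous_on (cimg c) (\<lambda>x. dvec c u (cinv c x) \<bullet> (K x *v dvec c v (cinv c x)))"
proof -
  have d: "continuous_on (cimg c) (\<lambda>x. dvec c w (cinv c x) $ i)" if w: "C1_mfd A w" for w i
  proof (rule continuous_on_eq)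
    show "continuous_on (cimg c) (pd i (\<lambda>x. w (cinv c x)))"
      using w assms(3) by (auto simp: C1_mfd_def intro: C1_onD(2))
  qed (simp add: dvec_nth assms(3))
  show ?thesis
    unfolding inner_matrix_vector_sum
    by (intro continuous_intros assms(4) d assms(1,2))
qed

lemma continuous_on_cometric:
  assumes "riemannian_metric A g" "C1_mfd A u" "C1_mfd A v"
  shows "continuous_on UNIV (cometric A g u v)"
proof (rule continuous_on_mfd)
  fix c assume c: "c \<in> A"
  show "continuous_on (cimg c) (\<lambda>x. cometric A g u v (cinv c x))"
    by (rule continuous_on_eq[OF continuous_on_bilinear_chart[OF assms(2,3) c
        continuous_on_metric_inv[OF assms(1) c]]]) (simp add: cometric_chart[OF assms c] cinv_in[OF c])
qed

end

section \<open>Green's identity\<close>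

context closed_mfd
begin

section \<open>The Laplacian in a chart and its divergence form\<close>

lemma C1_on_pd_Cinf:
  assumes "f \<in> Cinf A" "c \<in> A"
  shows "C1_on (cimg c) (pd j (\<lambda>x. f (cinv c x)))"
  using C1_on_smooth[of "cimg c" "f \<circ> cinv c" "[j]"] assms open_cimg[OF assms(2)]
  by (simp add: Cinf_def o_def)

lemma christoffel_chart:
  fixes g :: "('m, 'n) tensor2"
  assumes "c \<in> A" "x \<in> cimg c"
  defines "H \<equiv> matrix_inv (g c (cinv c x))" and "D \<equiv> \<lambda>i. \<chi> a b. pd i (\<lambda>x. g c (cinv c x) $ a $ b) x"
  shows "christoffel g c k i j (cinv c x) =
    (1/2) * (\<Sum>l\<in>UNIV. H $ k $ l * (D i $ j $ l + D j $ i $ l - D l $ i $ j))"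
  by (simp add: christoffel_def cpd_eq coord_cinv[OF assms(1,2)] H_def D_def)

lemma laplacian_chart:
  fixes g :: "('m, 'n) tensor2"
  assumes "c \<in> A" "x \<in> cimg c"
  defines "H \<equiv> matrix_inv (g c (cinv c x))"
  shows "laplacian g f c (cinv c x) = (\<Sum>i\<in>UNIV. \<Sum>j\<in>UNIV. H $ i $ j * pd i (pd j (\<lambda>x. f (cinv c x))) x)
    - (\<Sum>k\<in>UNIV. pd k (\<lambda>x. f (cinv c x)) x * (\<Sum>i\<in>UNIV. \<Sum>j\<in>UNIV. H $ i $ j * christoffel g c k i j (cinv c x)))"
proof -
  let ?p = "cinv c x"
  have "cpd c i (cpd c j f) ?p = pd i (pd j (\<lambda>x. f (cinv c x))) x" for i j
    unfolding cpd_eq coord_cinv[OF assms(1,2)]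
    by (rule pd_cong[OF open_cimg[OF assms(1)] assms(2)]) (simp add: cpd_eq coord_cinv[OF assms(1)])
  then have "laplacian g f c ?p = (\<Sum>i\<in>UNIV. \<Sum>j\<in>UNIV. H $ i $ j * pd i (pd j (\<lambda>x. f (cinv c x))) x)
      - (\<Sum>i\<in>UNIV. \<Sum>j\<in>UNIV. \<Sum>k\<in>UNIV. H $ i $ j * (christoffel g c k i j ?p * pd k (\<lambda>x. f (cinv c x)) x))"
    by (simp add: laplacian_def trace_wrt_def hessian_def H_def cpd_eq[of c _ f] coord_cinv[OF assms(1,2)]
        right_diff_distrib sum_subtractf sum_distrib_left)
  also have "(\<Sum>i\<in>UNIV. \<Sum>j\<in>UNIV. \<Sum>k\<in>UNIV. H $ i $ j * (christoffel g c k i j ?p * pd k (\<lambda>x. f (cinv c x)) x)) =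
      (\<Sum>i\<in>UNIV. \<Sum>k\<in>UNIV. \<Sum>j\<in>UNIV. H $ i $ j * (christoffel g c k i j ?p * pd k (\<lambda>x. f (cinv c x)) x))"
    by (rule sum.cong[OF refl], rule sum.swap)
  also have "\<dots> = (\<Sum>k\<in>UNIV. \<Sum>i\<in>UNIV. \<Sum>j\<in>UNIV. H $ i $ j * (christoffel g c k i j ?p * pd k (\<lambda>x. f (cinv c x)) x))"
    by (rule sum.swap)
  also have "\<dots> = (\<Sum>k\<in>UNIV. pd k (\<lambda>x. f (cinv c x)) x * (\<Sum>i\<in>UNIV. \<Sum>j\<in>UNIV. H $ i $ j * christoffel g c k i j ?p))"
    by (simp add: sum_distrib_left mult_ac)
  finally show ?thesis .
qed

text \<open>The Laplacian times sqrt(det g) is the coordinate divergence of the gradient times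
  sqrt(det g). The derivatives \<open>dV i\<close> are taken along coordinate lines, where the
  one-variable rules for determinants and inverse matrices apply.\<close>

lemma weighted_gradient_divergence:
  assumes g: "riemannian_metric A g" and c: "c \<in> A" and f: "f \<in> Cinf A"
  obtains dV where
    "\<And>i x. x \<in> cimg c \<Longrightarrow> ((\<lambda>e. \<Sum>j\<in>UNIV. vol g c (x + e *\<^sub>R axis i 1) *
        (matrix_inv (g c (cinv c (x + e *\<^sub>R axis i 1))) $ i $ j * pd j (\<lambda>x. f (cinv c x)) (x + e *\<^sub>R axis i 1)))
      has_real_derivative dV i x) (at 0)"
    "\<And>i. continuous_on (cimg c) (dV i)"
    "\<And>x. x \<in> cimg c \<Longrightarrow> (\<Sum>i\<in>UNIV. dV i x) = vol g c x * laplacian g f c (cinv c x)"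
proof -
  define G where "G x = g c (cinv c x)" for x
  define H where "H x = matrix_inv (G x)" for x
  define D where "D i x = (\<chi> a b. pd i (\<lambda>x. G x $ a $ b) x)" for i x
  define F where "F j = pd j (\<lambda>x. f (cinv c x))" for j
  \<comment> \<open>The product rule for density, inverse metric and first derivative of
    \<open>f\<close>, with the derivatives of the first two already inserted.\<close>
  define dV where "dV i x = (\<Sum>j\<in>UNIV. (vol g c x * trace (H x ** D i x) / 2) * (H x $ i $ j * F j x)
      + vol g c x * (- (H x ** D i x ** H x) $ i $ j * F j x + H x $ i $ j * pd i (F j) x))" for i x
  have det_pos: "det (G x) > 0" if "x \<in> cimg c" for x
    unfolding G_def by (rule metric_det_pos[OF g c cinv_in[OF c that]])
  have C1_G: "C1_on (cimg c) (\<lambda>x. G x $ a $ b)" for a b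
    unfolding G_def by (rule C1_on_metric[OF g c])
  have C1_F: "C1_on (cimg c) (F j)" for j
    unfolding F_def by (rule C1_on_pd_Cinf[OF f c])
  show ?thesis
  proof (rule that[of dV])
    fix i and x assume x: "x \<in> cimg c"
    define a where "a = (axis i 1 :: real^'n)"
    \<comment> \<open>The parameters for which the coordinate line stays in the chart image.
      \<open>J\<close> is open, so the derivative within \<open>J\<close> is the ordinary
      one.\<close>
    define J where "J = (\<lambda>e. x + e *\<^sub>R a) -` cimg c"
    have J: "open J" "0 \<in> J"
      unfolding J_def using x by (auto intro!: open_vimage[OF open_cimg[OF c]] continuous_intros)
    have at: "at 0 within J = at 0"
      by (rule at_within_open[OF J(2,1)])
    have G': "((\<lambda>e. G (x + e *\<^sub>R a) $ k $ l) has_real_derivative D i x $ k $ l) (at 0)" for k l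
      unfolding D_def a_def using has_real_derivative_pd_shift[OF C1_onD(1)[OF C1_G x]] by simp
    have H': "((\<lambda>e. H (x + e *\<^sub>R a) $ k $ l) has_real_derivative - (H x ** D i x ** H x) $ k $ l) (at 0)" for k l
    proof -
      have "((\<lambda>e. matrix_inv (G (x + e *\<^sub>R a)) $ k $ l) has_real_derivative
         - (matrix_inv (G (x + 0 *\<^sub>R a)) ** D i x ** matrix_inv (G (x + 0 *\<^sub>R a))) $ k $ l) (at 0 within J)"
      proof (rule has_real_derivative_matrix_inv)
        show "((\<lambda>e. G (x + e *\<^sub>R a) $ k $ l) has_real_derivative D i x $ k $ l) (at 0 within J)" for k l
          by (rule has_field_derivative_at_within[OF G'])
        show "det (G (x + e *\<^sub>R a)) \<noteq> 0" if "e \<in> J" for e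
          using det_pos that by (auto simp: J_def less_imp_neq[symmetric])
      qed (use J at in auto)
      then show ?thesis
        by (simp add: at H_def)
    qed
    have vol': "((\<lambda>e. sqrt (det (G (x + e *\<^sub>R a)))) has_real_derivative
        vol g c x * trace (H x ** D i x) / 2) (at 0)"
      using has_real_derivative_sqrt_det[of "\<lambda>e. G (x + e *\<^sub>R a)" _ 0 UNIV, OF G'] det_pos[OF x]
      by (simp add: H_def G_def)
    have F': "((\<lambda>e. F j (x + e *\<^sub>R a)) has_real_derivative pd i (F j) x) (at 0)" for j
      unfolding a_def by (rule has_real_derivative_pd_shift[OF C1_onD(1)[OF C1_F x]])
    have "((\<lambda>e. \<Sum>j\<in>UNIV. sqrt (det (G (x + e *\<^sub>R a))) * (H (x + e *\<^sub>R a) $ i $ j * F j (x + e *\<^sub>R a)))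
      has_real_derivative dV i x) (at 0)"
      unfolding dV_def
    proof (rule DERIV_sum)
      fix j
      show "((\<lambda>e. sqrt (det (G (x + e *\<^sub>R a))) * (H (x + e *\<^sub>R a) $ i $ j * F j (x + e *\<^sub>R a))) has_real_derivative
         (vol g c x * trace (H x ** D i x) / 2) * (H x $ i $ j * F j x)
         + vol g c x * (- (H x ** D i x ** H x) $ i $ j * F j x + H x $ i $ j * pd i (F j) x)) (at 0)"
        by (rule DERIV_cong[OF DERIV_mult[OF vol' DERIV_mult[OF H' F']]]) (simp add: G_def algebra_simps)
    qed
    then show "((\<lambda>e. \<Sum>j\<in>UNIV. vol g c (x + e *\<^sub>R axis i 1) *
        (matrix_inv (g c (cinv c (x + e *\<^sub>R axis i 1))) $ i $ j * pd j (\<lambda>x. f (cinv c x)) (x + e *\<^sub>R axis i 1)))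
      has_real_derivative dV i x) (at 0)"
      by (simp add: G_def H_def F_def a_def)
  next
    fix i
    have Hc: "continuous_on (cimg c) (\<lambda>x. H x $ k $ l)" for k l
      unfolding H_def G_def by (rule continuous_on_metric_inv[OF g c])
    have Dc: "continuous_on (cimg c) (\<lambda>x. D i x $ k $ l)" for k l
      unfolding D_def using C1_onD(2)[OF C1_G] by simp
    have tr: "continuous_on (cimg c) (\<lambda>x. trace (H x ** D i x))"
      unfolding trace_def matrix_matrix_mult_def vec_lambda_beta
      by (intro continuous_on_sum continuous_on_mult Hc Dc)
    have HDH: "continuous_on (cimg c) (\<lambda>x. (H x ** D i x ** H x) $ k $ l)" for k l
      unfolding matrix_matrix_mult_def vec_lambda_beta
      by (intro continuous_on_sum continuous_on_mult Hc Dc)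
    show "continuous_on (cimg c) (dV i)"
      unfolding dV_def[abs_def]
      by (intro continuous_on_sum continuous_on_add continuous_on_mult continuous_on_divide continuous_on_minus
          continuous_on_const continuous_on_vol[OF g c] tr HDH Hc C1_onD(2)[OF C1_F] C1_onD(3)[OF C1_F]) simp
  next
    fix x assume x: "x \<in> cimg c"
    let ?Hf = "\<Sum>i\<in>UNIV. \<Sum>j\<in>UNIV. H x $ i $ j * pd i (F j) x"
    \<comment> \<open>\<open>?Q j\<close> is the Christoffel symbol with upper index
      \<open>j\<close> contracted with the inverse metric, in the form given by
      \<open>christoffel_trace_identity\<close>.\<close>
    let ?Q = "\<lambda>j. (\<Sum>i\<in>UNIV. (H x ** D i x ** H x) $ i $ j) - (1/2) * (\<Sum>i\<in>UNIV. H x $ i $ j * trace (H x ** D i x))"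
    have sym: "transpose (H x) = H x"
      unfolding H_def G_def by (rule metric_inv_sym[OF g c cinv_in[OF c x]])
    have D: "(\<chi> a b. pd i (\<lambda>x. g c (cinv c x) $ a $ b) x) = D i x" for i
      by (simp add: D_def G_def)
    have "laplacian g f c (cinv c x) = ?Hf - (\<Sum>j\<in>UNIV. F j x * ?Q j)"
      unfolding laplacian_chart[OF c x] christoffel_chart[OF c x] D
      using christoffel_trace_identity[OF sym, of _ "\<lambda>i. D i x"] by (simp add: F_def H_def G_def)
    moreover have "(\<Sum>i\<in>UNIV. dV i x) = vol g c x * (?Hf - (\<Sum>j\<in>UNIV. F j x * ?Q j))"
    proof -
      have "(\<Sum>i\<in>UNIV. dV i x) = vol g c x * ?Hf + vol g c x * (\<Sum>i\<in>UNIV. \<Sum>j\<in>UNIV.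
          F j x * ((1/2) * (H x $ i $ j * trace (H x ** D i x)) - (H x ** D i x ** H x) $ i $ j))"
        by (simp add: dV_def sum.distrib sum_subtractf sum_distrib_left algebra_simps sum_negf)
      also have "(\<Sum>i\<in>UNIV. \<Sum>j\<in>UNIV.
          F j x * ((1/2) * (H x $ i $ j * trace (H x ** D i x)) - (H x ** D i x ** H x) $ i $ j)) =
          (\<Sum>j\<in>UNIV. \<Sum>i\<in>UNIV.
          F j x * ((1/2) * (H x $ i $ j * trace (H x ** D i x)) - (H x ** D i x ** H x) $ i $ j))"
        by (rule sum.swap)
      also have "\<dots> = - (\<Sum>j\<in>UNIV. F j x * ?Q j)"
        by (simp add: sum_negf[symmetric] sum_subtractf sum_distrib_left right_diff_distrib)
      finally show ?thesis
        by (simp add: algebra_simps)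
    qed
    ultimately show "(\<Sum>i\<in>UNIV. dV i x) = vol g c x * laplacian g f c (cinv c x)"
      by simp
  qed
qed

text \<open>The field \<open>u\<close> sqrt(det g) grad \<open>f\<close> vanishes off the box, so
  each of its coordinate derivatives integrates to zero. Their sum is the energy density plus
  \<open>u\<close> times the Laplacian term.\<close>

lemma green_chart:
  assumes g: "riemannian_metric A g" and c: "c \<in> A" and box: "cbox a b \<subseteq> cimg c"
    and u: "C1_mfd A u" and supp: "\<And>q. u q \<noteq> 0 \<Longrightarrow> q \<in> cdom c \<and> coord c q \<in> cbox a b"
    and f: "eigenfunction A g l f"
  shows "(\<integral>p. cometric A g u f p \<partial>riemannian_measure A g) = l * (\<integral>p. u p * f p \<partial>riemannian_measure A g)"
proof -
  have fC: "f \<in> Cinf A" and f_C1: "C1_mfd A f"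
    using f Cinf_C1_mfd by (auto simp: eigenfunction_def)
  define U where "U x = u (cinv c x)" for x
  define F where "F x = f (cinv c x)" for x
  define H where "H x = matrix_inv (g c (cinv c x))" for x
  define V where "V i x = (\<Sum>j\<in>UNIV. vol g c x * (H x $ i $ j * pd j F x))" for i x
  obtain dV where dV': "\<And>i x. x \<in> cimg c \<Longrightarrow> ((\<lambda>e. \<Sum>j\<in>UNIV. vol g c (x + e *\<^sub>R axis i 1) *
        (matrix_inv (g c (cinv c (x + e *\<^sub>R axis i 1))) $ i $ j * pd j (\<lambda>x. f (cinv c x)) (x + e *\<^sub>R axis i 1)))
      has_real_derivative dV i x) (at 0)"
    and dV: "\<And>i. continuous_on (cimg c) (dV i)"
    "\<And>x. x \<in> cimg c \<Longrightarrow> (\<Sum>i\<in>UNIV. dV i x) = vol g c x * laplacian g f c (cinv c x)"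
    by (rule weighted_gradient_divergence[OF g c fC]) (rule that)
  have V': "((\<lambda>e. V i (x + e *\<^sub>R axis i 1)) has_real_derivative dV i x) (at 0)" if "x \<in> cimg c" for i x
    unfolding V_def H_def F_def[abs_def] by (rule dV'[OF that])
  have U_C1: "C1_on (cimg c) U"
    using u c by (simp add: C1_mfd_def U_def[abs_def])
  have F_C1: "C1_on (cimg c) F"
    using f_C1 c by (simp add: C1_mfd_def F_def[abs_def])
  have supp_U: "U x = 0" if "x \<in> cimg c" "x \<notin> cbox a b" for x
    using supp[of "cinv c x"] that coord_cinv[OF c that(1)] by (auto simp: U_def)
  have o: "open (cimg c)" "open (- cbox a b)" "open (cimg c - cbox a b)"
    using open_cimg[OF c] by (auto intro: open_Diff)
  have supp_dU: "pd i U x = 0" if "x \<in> cimg c" "x \<notin> cbox a b" for x i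
  proof -
    have "pd i U x = pd i (\<lambda>x. 0) x"
      by (rule pd_cong[OF o(3)]) (use that supp_U in auto)
    then show ?thesis
      by (simp add: pd_const)
  qed
  have Un: "cimg c \<union> - cbox a b = UNIV"
    using box by auto
  have V_cont: "continuous_on (cimg c) (V i)" for i
    unfolding V_def[abs_def] H_def
    by (intro continuous_intros continuous_on_vol[OF g c] continuous_on_metric_inv[OF g c] C1_onD(2)[OF F_C1])
  \<comment> \<open>\<open>cinv c\<close> is unspecified off \<open>cimg c\<close>, so the product
    is cut off there. Since \<open>U\<close> vanishes in the chart outside the box, continuity can
    be checked on \<open>cimg c\<close> and on the complement of the box, two open sets covering the
    space.\<close>
  define h where "h i x = (if x \<in> cimg c then U x * V i x else 0)" for i x
  define h' where "h' i x = (if x \<in> cimg c then pd i U x * V i x + U x * dV i x else 0)" for i x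
  have "integral (cbox a b) (h' i) = 0" for i
  proof (rule integral_directional_derivative_eq_0[where h = "h i" and v = "axis i 1"])
    show "h i x = 0" if "x \<notin> cbox a b" for x
      using that supp_U by (simp add: h_def)
    show "((\<lambda>e. h i (x + e *\<^sub>R axis i 1)) has_real_derivative h' i x) (at 0)" for x
    proof (cases "x \<in> cimg c")
      case True
      have ev: "\<forall>\<^sub>F e in nhds (0::real). x + e *\<^sub>R axis i 1 \<in> cimg c"
      proof -
        have "open ((\<lambda>e::real. x + e *\<^sub>R axis i 1) -` cimg c)"
          by (intro open_vimage[OF o(1)] continuous_intros)
        from eventually_nhds_in_open[OF this, of 0] True show ?thesis
          by simp
      qed
      have "((\<lambda>e. U (x + e *\<^sub>R axis i 1) * V i (x + e *\<^sub>R axis i 1)) has_real_derivative h' i x) (at 0)"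
        by (rule DERIV_cong[OF DERIV_mult[OF has_real_derivative_pd_shift[OF C1_onD(1)[OF U_C1 True]] V'[OF True]]])
          (use True in \<open>simp add: h'_def mult.commute\<close>)
      then show ?thesis
        by (subst has_field_derivative_cong_ev[OF refl _ refl refl]) (use ev True in \<open>auto simp: h_def elim: eventually_mono\<close>)
    next
      case False
      then have "x \<in> - cbox a b"
        using box by auto
      have ev: "\<forall>\<^sub>F e in nhds (0::real). x + e *\<^sub>R axis i 1 \<in> - cbox a b"
      proof -
        have "open ((\<lambda>e::real. x + e *\<^sub>R axis i 1) -` (- cbox a b))"
          by (intro open_vimage[OF o(2)] continuous_intros)
        from eventually_nhds_in_open[OF this, of 0] \<open>x \<in> - cbox a b\<close> show ?thesis
          by simp
      qed
      have "((\<lambda>e. 0) has_real_derivative h' i x) (at 0)"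
        using False by (simp add: h'_def)
      then show ?thesis
        by (subst has_field_derivative_cong_ev[OF refl _ refl refl])
          (use ev False supp_U in \<open>auto simp: h_def elim!: eventually_mono\<close>)
    qed
    have "continuous_on (cimg c) (h i)"
      by (rule continuous_on_eq[OF continuous_on_mult[OF C1_onD(3)[OF U_C1] V_cont[of i]]]) (simp add: h_def)
    moreover have "continuous_on (- cbox a b) (h i)"
      by (rule continuous_on_eq[OF continuous_on_const[of _ 0]]) (use supp_U in \<open>auto simp: h_def\<close>)
    ultimately show "continuous_on UNIV (h i)"
      using continuous_on_open_Un[OF o(1,2)] Un by metis
    have "continuous_on (cimg c) (h' i)"
      by (rule continuous_on_eq[OF continuous_on_add[OF continuous_on_mult[OF C1_onD(2)[OF U_C1] V_cont]
            continuous_on_mult[OF C1_onD(3)[OF U_C1] dV(1)]]]) (simp add: h'_def)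
    moreover have "continuous_on (- cbox a b) (h' i)"
      by (rule continuous_on_eq[OF continuous_on_const[of _ 0]]) (use supp_U supp_dU in \<open>auto simp: h'_def\<close>)
    ultimately show "continuous_on UNIV (h' i)"
      using continuous_on_open_Un[OF o(1,2)] Un by metis
  qed
  moreover have cont_h': "continuous_on (cbox a b) (h' i)" for i
  proof (rule continuous_on_eq)
    show "continuous_on (cbox a b) (\<lambda>x. pd i U x * V i x + U x * dV i x)"
      by (rule continuous_on_subset[OF _ box])
        (intro continuous_intros V_cont dV(1) C1_onD(2)[OF U_C1] C1_onD(3)[OF U_C1])
  qed (use box in \<open>auto simp: h'_def\<close>)
  ultimately have "integral (cbox a b) (\<lambda>x. \<Sum>i\<in>UNIV. h' i x) = 0"
    by (subst integral_sum) (auto intro: integrable_continuous)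
  \<comment> \<open>The derivatives falling on \<open>U\<close> sum to the energy density; those
    falling on \<open>V\<close> sum to the Laplacian term, which the eigenvalue equation
    replaces.\<close>
  moreover have sum_h': "(\<Sum>i\<in>UNIV. h' i x) = cometric A g u f (cinv c x) * vol g c x - l * (u (cinv c x) * f (cinv c x) * vol g c x)"
    if x: "x \<in> cbox a b" for x
  proof -
    have xc: "x \<in> cimg c"
      using x box by auto
    have "cometric A g u f (cinv c x) * vol g c x = (\<Sum>i\<in>UNIV. pd i U x * V i x)"
      unfolding cometric_chart[OF g u f_C1 c cinv_in[OF c xc]] inner_matrix_vector_sum
      by (simp add: dvec_nth[OF c xc] V_def H_def U_def[abs_def] F_def[abs_def] sum_distrib_left
          sum_distrib_right mult_ac)
    moreover have "laplacian g f c (cinv c x) = - l * f (cinv c x)"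
      using f c cinv_in[OF c xc] by (simp add: eigenfunction_def eq_neg_iff_add_eq_0)
    ultimately show ?thesis
      using dV(2)[OF xc] xc by (simp add: h'_def sum.distrib sum_distrib_left[symmetric] U_def)
  qed
  moreover have "integral (cbox a b) (\<lambda>x. \<Sum>i\<in>UNIV. h' i x) =
     integral (cbox a b) (\<lambda>x. cometric A g u f (cinv c x) * vol g c x) -
     l * integral (cbox a b) (\<lambda>x. u (cinv c x) * f (cinv c x) * vol g c x)"
  proof -
    have cc: "continuous_on (cbox a b) (\<lambda>x. w (cinv c x) * vol g c x)" if "continuous_on UNIV w" for w
      by (intro continuous_intros continuous_on_subset[OF continuous_on_vol[OF g c] box]
        continuous_on_compose2[OF that continuous_on_subset[OF continuous_on_cinv[OF c] box]]) auto
    have "integral (cbox a b) (\<lambda>x. \<Sum>i\<in>UNIV. h' i x) = integral (cbox a b)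
       (\<lambda>x. cometric A g u f (cinv c x) * vol g c x - l * (u (cinv c x) * f (cinv c x) * vol g c x))"
      by (rule integral_cong) (rule sum_h')
    also have "\<dots> = integral (cbox a b) (\<lambda>x. cometric A g u f (cinv c x) * vol g c x) -
       integral (cbox a b) (\<lambda>x. l * (u (cinv c x) * f (cinv c x) * vol g c x))"
      using cc[OF continuous_on_cometric[OF g u f_C1]]
        cc[OF continuous_on_mult[OF C1_mfd_continuous[OF u] C1_mfd_continuous[OF f_C1]]]
      by (intro integral_diff integrable_continuous continuous_on_mult_left) auto
    finally show ?thesis
      by simp
  qed
  moreover have "(\<integral>p. cometric A g u f p \<partial>riemannian_measure A g) =
      integral (cbox a b) (\<lambda>x. cometric A g u f (cinv c x) * vol g c x)"
  proof (rule integral_chart[OF g c box continuous_on_cometric[OF g u f_C1]])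
    fix q assume q: "cometric A g u f q \<noteq> 0"
    show "q \<in> cdom c \<and> coord c q \<in> cbox a b"
    proof (rule ccontr)
      assume nq: "\<not> (q \<in> cdom c \<and> coord c q \<in> cbox a b)"
      \<comment> \<open>\<open>?K\<close> is compact, hence closed, and \<open>u\<close> vanishes on
        its open complement. So the differential of \<open>u\<close> at \<open>q\<close> vanishes in
        whichever chart \<open>chart_at\<close> has picked.\<close>
      let ?d = "chart_at A q" and ?K = "cinv c ` cbox a b"
      have "closed ?K"
        by (rule compact_imp_closed[OF compact_continuous_image[OF
          continuous_on_subset[OF continuous_on_cinv[OF c] box] compact_cbox]])
      moreover have "q \<notin> ?K"
      proof
        assume "q \<in> ?K"
        then obtain x where "x \<in> cbox a b" "q = cinv c x"
          by auto
        then show False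
          using nq box cinv_in[OF c, of x] coord_cinv[OF c, of x] by auto
      qed
      ultimately have S: "open (coord ?d ` (cdom ?d \<inter> - ?K))" "coord ?d q \<in> coord ?d ` (cdom ?d \<inter> - ?K)"
        using open_coord_image[OF chart_at(1), of "- ?K"] chart_at(2) by auto
      have u0: "u r = 0" if "r \<notin> ?K" for r
        using that supp[of r] cinv_coord[OF c, of r] by (metis imageI)
      have "cpd ?d i u q = 0" for i
      proof -
        have "cpd ?d i u q = pd i (\<lambda>x. 0) (coord ?d q)"
          unfolding cpd_eq by (rule pd_cong[OF S]) (auto simp: cinv_coord[OF chart_at(1)] u0)
        then show ?thesis
          by (simp add: pd_const)
      qed
      then have "dvec ?d u q = 0"
        by (simp add: dvec_def vec_eq_iff)
      then show False
        using q by (simp add: cometric_def Let_def)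
    qed
  qed
  moreover have "(\<integral>p. u p * f p \<partial>riemannian_measure A g) =
      integral (cbox a b) (\<lambda>x. u (cinv c x) * f (cinv c x) * vol g c x)"
    using supp
    by (intro integral_chart[OF g c box] continuous_on_mult C1_mfd_continuous[OF u] C1_mfd_continuous[OF f_C1]) auto
  ultimately show ?thesis
    by simp
qed

text \<open>The data involve no metric, so one partition serves the metrics of all times at
  once.\<close>

definition chart_partition ::
  "'i set \<Rightarrow> ('i \<Rightarrow> ('m, 'n) chart) \<Rightarrow> ('i \<Rightarrow> real^'n) \<Rightarrow> ('i \<Rightarrow> real^'n) \<Rightarrow> ('i \<Rightarrow> 'm \<Rightarrow> real) \<Rightarrow> bool"
  where
  "chart_partition I ch a b pu \<longleftrightarrow> finite I \<and> (\<forall>q. (\<Sum>k\<in>I. pu k q) = 1) \<and>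
     (\<forall>k\<in>I. ch k \<in> A \<and> cbox (a k) (b k) \<subseteq> cimg (ch k) \<and> C1_mfd A (pu k) \<and>
       (\<forall>q. pu k q \<noteq> 0 \<longrightarrow> q \<in> cdom (ch k) \<and> coord (ch k) q \<in> cbox (a k) (b k)))"

lemma ex_chart_partition: "\<exists>(I :: 'm set) ch a b pu. chart_partition I ch a b pu"
proof (rule partition_of_unity)
  fix I :: "'m set" and ch a b and pu :: "'m \<Rightarrow> 'm \<Rightarrow> real"
  assume "finite I" "\<And>k. k \<in> I \<Longrightarrow> ch k \<in> A" "\<And>k. k \<in> I \<Longrightarrow> cbox (a k) (b k) \<subseteq> cimg (ch k)"
    "\<And>k. k \<in> I \<Longrightarrow> C1_mfd A (pu k)"
    "\<And>k q. k \<in> I \<Longrightarrow> pu k q \<noteq> 0 \<Longrightarrow> q \<in> cdom (ch k) \<and> coord (ch k) q \<in> cbox (a k) (b k)"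
    "\<And>q. (\<Sum>k\<in>I. pu k q) = 1"
  then have "chart_partition I ch a b pu"
    unfolding chart_partition_def by simp
  then show ?thesis
    by (intro exI)
qed

lemma chart_partitionD:
  assumes "chart_partition I ch a b pu"
  shows "finite I" "(\<Sum>k\<in>I. pu k q) = 1"
    "k \<in> I \<Longrightarrow> ch k \<in> A" "k \<in> I \<Longrightarrow> cbox (a k) (b k) \<subseteq> cimg (ch k)" "k \<in> I \<Longrightarrow> C1_mfd A (pu k)"
    "k \<in> I \<Longrightarrow> pu k q \<noteq> 0 \<Longrightarrow> q \<in> cdom (ch k) \<and> coord (ch k) q \<in> cbox (a k) (b k)"
  using assms unfolding chart_partition_def by simp_all

lemma
  assumes g: "riemannian_metric A g" and P: "chart_partition I ch a b pu" and u: "continuous_on UNIV u"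
  shows integrable_continuous_mfd: "integrable (riemannian_measure A g) u"
    and integral_eq_sum_charts: "(\<integral>q. u q \<partial>riemannian_measure A g) = (\<Sum>k\<in>I. integral (cbox (a k) (b k))
      (\<lambda>x. pu k (cinv (ch k) x) * u (cinv (ch k) x) * vol g (ch k) x))"
proof -
  let ?\<mu> = "riemannian_measure A g"
  have cont: "continuous_on UNIV (\<lambda>q. pu k q * u q)" if "k \<in> I" for k
    by (intro continuous_on_mult C1_mfd_continuous chart_partitionD(5)[OF P that] u)
  have supp: "q \<in> cdom (ch k) \<and> coord (ch k) q \<in> cbox (a k) (b k)" if "k \<in> I" "pu k q * u q \<noteq> 0" for k q
    using chart_partitionD(6)[OF P that(1)] that(2) by simp
  note chart = g chart_partitionD(3,4)[OF P] cont supp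
  have eq: "u q = (\<Sum>k\<in>I. pu k q * u q)" for q
    using chart_partitionD(2)[OF P, of q] by (simp flip: sum_distrib_right)
  have int: "integrable ?\<mu> (\<lambda>q. pu k q * u q)" if "k \<in> I" for k
    by (rule integrable_chart[OF chart]) (use that in auto)
  then have "integrable ?\<mu> (\<lambda>q. \<Sum>k\<in>I. pu k q * u q)"
    by (rule Bochner_Integration.integrable_sum)
  then show "integrable ?\<mu> u"
    by (simp flip: eq)
  have "(\<integral>q. u q \<partial>?\<mu>) = (\<integral>q. (\<Sum>k\<in>I. pu k q * u q) \<partial>?\<mu>)"
    by (simp flip: eq)
  also have "\<dots> = (\<Sum>k\<in>I. \<integral>q. pu k q * u q \<partial>?\<mu>)"
    using int by (rule Bochner_Integration.integral_sum)
  also have "\<dots> = (\<Sum>k\<in>I. integral (cbox (a k) (b k))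
      (\<lambda>x. pu k (cinv (ch k) x) * u (cinv (ch k) x) * vol g (ch k) x))"
    by (rule sum.cong[OF refl], rule integral_chart[OF chart]) auto
  finally show "(\<integral>q. u q \<partial>?\<mu>) = (\<Sum>k\<in>I. integral (cbox (a k) (b k))
      (\<lambda>x. pu k (cinv (ch k) x) * u (cinv (ch k) x) * vol g (ch k) x))" .
qed

lemma cometric_sum_left:
  assumes "\<And>k. k \<in> I \<Longrightarrow> C1_mfd A (u k)" "finite I"
  shows "cometric A g (\<lambda>q. \<Sum>k\<in>I. u k q) v p = (\<Sum>k\<in>I. cometric A g (u k) v p)"
proof -
  have "dvec c (\<lambda>q. \<Sum>k\<in>I. u k q) p = (\<Sum>k\<in>I. dvec c (u k) p)" if "c \<in> A" "p \<in> cdom c" for c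
    using C1_mfd_differentiable[OF assms(1) that] assms(2)
    by (simp add: dvec_def cpd_eq vec_eq_iff pd_sum)
  then show ?thesis
    by (simp add: cometric_def Let_def chart_at inner_sum_left)
qed

text \<open>Only the test function is cut into pieces supported in boxes; the eigenfunction stays
  whole, so linearity in the first slot is enough to add up the chart identities.\<close>

lemma green:
  assumes g: "riemannian_metric A g" and u: "C1_mfd A u" and f: "eigenfunction A g l f"
  shows "(\<integral>p. cometric A g u f p \<partial>riemannian_measure A g) = l * (\<integral>p. u p * f p \<partial>riemannian_measure A g)"
proof -
  let ?\<mu> = "riemannian_measure A g"
  obtain I :: "'m set" and ch a b pu where P: "chart_partition I ch a b pu"
    using ex_chart_partition by blast
  have f_C1: "C1_mfd A f"
    using f Cinf_C1_mfd by (simp add: eigenfunction_def)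
  define w where "w k q = pu k q * u q" for k q
  have w_C1: "C1_mfd A (w k)" if "k \<in> I" for k
    unfolding w_def[abs_def] by (intro C1_mfd_mult u chart_partitionD(5)[OF P that])
  have eq: "u q = (\<Sum>k\<in>I. w k q)" for q
    using chart_partitionD(2)[OF P, of q] by (simp add: w_def flip: sum_distrib_right)
  have "u = (\<lambda>q. \<Sum>k\<in>I. w k q)"
    using eq by (rule ext)
  then have co: "cometric A g u f p = (\<Sum>k\<in>I. cometric A g (w k) f p)" for p
    using cometric_sum_left[OF w_C1 chart_partitionD(1)[OF P]] by simp
  have "(\<integral>p. cometric A g u f p \<partial>?\<mu>) = (\<Sum>k\<in>I. \<integral>p. cometric A g (w k) f p \<partial>?\<mu>)"
    unfolding co using integrable_continuous_mfd[OF g P continuous_on_cometric[OF g w_C1 f_C1]]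
    by (rule Bochner_Integration.integral_sum)
  also have "\<dots> = (\<Sum>k\<in>I. l * (\<integral>p. w k p * f p \<partial>?\<mu>))"
  proof (rule sum.cong[OF refl])
    fix k assume k: "k \<in> I"
    show "(\<integral>p. cometric A g (w k) f p \<partial>?\<mu>) = l * (\<integral>p. w k p * f p \<partial>?\<mu>)"
      using chart_partitionD(6)[OF P k]
      by (intro green_chart[OF g chart_partitionD(3,4)[OF P k] w_C1[OF k] _ f]) (auto simp: w_def)
  qed
  also have "\<dots> = l * (\<integral>p. (\<Sum>k\<in>I. w k p * f p) \<partial>?\<mu>)"
  proof -
    have "integrable ?\<mu> (\<lambda>p. w k p * f p)" if "k \<in> I" for k
      by (intro integrable_continuous_mfd[OF g P] continuous_on_mult C1_mfd_continuous w_C1[OF that] f_C1)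
    then show ?thesis
      by (simp add: Bochner_Integration.integral_sum flip: sum_distrib_left)
  qed
  also have "(\<lambda>p. \<Sum>k\<in>I. w k p * f p) = (\<lambda>p. u p * f p)"
    by (simp add: eq flip: sum_distrib_right)
  finally show ?thesis .
qed

end

section \<open>Time derivatives along the Ricci flow\<close>

lemma tendsto_integral_uniform_limit:
  fixes u :: "'s \<Rightarrow> 'a::euclidean_space \<Rightarrow> real"
  assumes u: "uniform_limit (cbox a b) u l F"
    and cont: "\<forall>\<^sub>F s in F. continuous_on (cbox a b) (u s)" "continuous_on (cbox a b) l"
  shows "((\<lambda>s. integral (cbox a b) (u s)) \<longlongrightarrow> integral (cbox a b) l) F"
proof (rule tendstoI)
  fix e :: real assume e: "e > 0"
  define m where "m = measure lborel (cbox a b)"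
  have m: "m \<ge> 0"
    unfolding m_def by (rule measure_nonneg)
  \<comment> \<open>\<open>m + 1\<close> keeps the divisor positive even for a box of measure
    zero.\<close>
  define d where "d = e / (2 * (m + 1))"
  have d: "d > 0" "d * m < e"
  proof -
    show "d > 0"
      unfolding d_def using e m by simp
    have "d * m \<le> d * (m + 1)"
      using \<open>d > 0\<close> by simp
    also have "\<dots> = e / 2"
      unfolding d_def using m by (simp add: field_simps)
    finally show "d * m < e"
      using e by simp
  qed
  show "\<forall>\<^sub>F s in F. dist (integral (cbox a b) (u s)) (integral (cbox a b) l) < e"
    using uniform_limitD[OF u d(1)] cont(1)
  proof eventually_elim
    case (elim s)
    have "norm (integral (cbox a b) (\<lambda>x. u s x - l x)) \<le> d * m"
      unfolding m_def
    proof (rule has_integral_bound)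
      show "((\<lambda>x. u s x - l x) has_integral integral (cbox a b) (\<lambda>x. u s x - l x)) (cbox a b)"
        using elim(2) cont(2) by (intro integrable_integral integrable_continuous continuous_on_diff)
    qed (use elim(1) d(1) in \<open>auto simp: dist_norm less_imp_le\<close>)
    moreover have "integral (cbox a b) (\<lambda>x. u s x - l x) = integral (cbox a b) (u s) - integral (cbox a b) l"
      using elim(2) cont(2) by (intro integral_diff integrable_continuous)
    ultimately show ?case
      using d(2) by (simp add: dist_norm)
  qed
qed

text \<open>Multiply the quotient by \<open>s - t\<close>, which tends to zero; boundedness of the
  limit \<open>l\<close> keeps the product limit uniform.\<close>

lemma uniform_limit_from_difference_quotient:
  fixes a :: "real \<Rightarrow> 'a \<Rightarrow> real"
  assumes q: "uniform_limit K (\<lambda>s x. (a s x - b x) / (s - t)) l (at t within J)" and bd: "bounded (l ` K)"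
  shows "uniform_limit K a b (at t within J)"
proof -
  have "uniform_limit K (\<lambda>s x. s - t) (\<lambda>x. 0) (at t within J)"
  proof (rule uniform_limitI)
    fix e :: real assume "e > 0"
    then show "\<forall>\<^sub>F s in at t within J. \<forall>x\<in>K. dist (s - t) 0 < e"
      by (auto simp: eventually_at dist_norm intro: exI[of _ e])
  qed
  from uniform_lim_mult[OF q this bd]
  have "uniform_limit K (\<lambda>s x. (a s x - b x) / (s - t) * (s - t)) (\<lambda>x. l x * 0) (at t within J)"
    by (simp add: image_constant_conv)
  then have "uniform_limit K (\<lambda>s x. a s x - b x) (\<lambda>x. 0) (at t within J)"
    by (rule uniform_limit_cong[THEN iffD1, rotated -1]) (auto simp: eventually_at_filter)
  then show ?thesis
    by (simp add: uniform_limit_iff dist_norm)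
qed

text \<open>To be read with \<open>w\<close> a partition function, \<open>e s\<close> a product
  built from f_s and f_t, and \<open>q s\<close> a coefficient of the metric. The factor
  \<open>e s\<close> is common to both integrals, so it only has to converge, while \<open>q\<close>
  alone is differenced.\<close>

lemma tendsto_weighted_integral_quotient:
  fixes e q :: "real \<Rightarrow> 'a::euclidean_space \<Rightarrow> real"
  assumes t: "t \<in> J" and q: "uniform_limit (cbox a b) (\<lambda>s x. (q s x - q t x) / (s - t)) q' (at t within J)"
    and e: "uniform_limit (cbox a b) e (e t) (at t within J)"
    and cont: "continuous_on (cbox a b) w" "continuous_on (cbox a b) q'"
      "\<And>s. s \<in> J \<Longrightarrow> continuous_on (cbox a b) (e s)" "\<And>s. s \<in> J \<Longrightarrow> continuous_on (cbox a b) (q s)"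
  shows "((\<lambda>s. (integral (cbox a b) (\<lambda>x. w x * e s x * q s x) - integral (cbox a b) (\<lambda>x. w x * e s x * q t x)) / (s - t))
    \<longlongrightarrow> integral (cbox a b) (\<lambda>x. w x * e t x * q' x)) (at t within J)"
proof -
  have bd: "bounded (h ` cbox a b)" if "continuous_on (cbox a b) h" for h :: "'a \<Rightarrow> real"
    by (rule compact_imp_bounded[OF compact_continuous_image[OF that compact_cbox]])
  have "uniform_limit (cbox a b) (\<lambda>s x. w x * e s x) (\<lambda>x. w x * e t x) (at t within J)"
    by (rule uniform_lim_mult[OF uniform_limit_const e bd[OF cont(1)] bd[OF cont(3)[OF t]]])
  then have "uniform_limit (cbox a b) (\<lambda>s x. w x * e s x * ((q s x - q t x) / (s - t)))
      (\<lambda>x. w x * e t x * q' x) (at t within J)"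
    by (rule uniform_lim_mult[OF _ q bd[OF continuous_on_mult[OF cont(1,3)]] bd[OF cont(2)]]) (rule t)
  moreover have inJ: "\<forall>\<^sub>F s in at t within J. s \<in> J \<and> s \<noteq> t"
    by (simp add: eventually_at_filter)
  have c: "continuous_on (cbox a b) (\<lambda>x. w x * e s x * ((q s x - q t x) / (s - t)))" if "s \<in> J \<and> s \<noteq> t" for s
    using that t by (intro continuous_intros cont) auto
  have "\<forall>\<^sub>F s in at t within J. continuous_on (cbox a b) (\<lambda>x. w x * e s x * ((q s x - q t x) / (s - t)))"
    using inJ by eventually_elim (rule c)
  ultimately have "((\<lambda>s. integral (cbox a b) (\<lambda>x. w x * e s x * ((q s x - q t x) / (s - t))))
      \<longlongrightarrow> integral (cbox a b) (\<lambda>x. w x * e t x * q' x)) (at t within J)"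
    using t by (intro tendsto_integral_uniform_limit continuous_intros cont) auto
  then show ?thesis
  proof (rule Lim_transform_eventually)
    show "\<forall>\<^sub>F s in at t within J. integral (cbox a b) (\<lambda>x. w x * e s x * ((q s x - q t x) / (s - t))) =
       (integral (cbox a b) (\<lambda>x. w x * e s x * q s x) - integral (cbox a b) (\<lambda>x. w x * e s x * q t x)) / (s - t)"
      using inJ
    proof eventually_elim
      case (elim s)
      have "integral (cbox a b) (\<lambda>x. w x * e s x * ((q s x - q t x) / (s - t))) =
          integral (cbox a b) (\<lambda>x. (w x * e s x * q s x - w x * e s x * q t x) / (s - t))"
        by (simp add: algebra_simps)
      also have "\<dots> = integral (cbox a b) (\<lambda>x. w x * e s x * q s x - w x * e s x * q t x) / (s - t)"
        by (rule integral_divide)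
      also have "integral (cbox a b) (\<lambda>x. w x * e s x * q s x - w x * e s x * q t x) =
         integral (cbox a b) (\<lambda>x. w x * e s x * q s x) - integral (cbox a b) (\<lambda>x. w x * e s x * q t x)"
        using elim t by (intro integral_diff integrable_continuous continuous_intros cont) auto
      finally show ?case .
    qed
  qed
qed

text \<open>Convexity of \<open>J\<close> serves the mean value estimates; nontrivial filters make
  derivatives within \<open>J\<close> unique, including one-sided ones.\<close>

locale ricci_flow_mfd = closed_mfd A
  for A :: "('m::{t2_space, second_countable_topology}, 'n::finite) chart set" +
  fixes J :: "real set" and g :: "real \<Rightarrow> ('m, 'n) tensor2"
  assumes flow: "ricci_flow A J g" and convex_J: "convex J"
    and nontrivial_J: "\<And>t. t \<in> J \<Longrightarrow> at t within J \<noteq> bot"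
begin

section \<open>Time derivatives and joint continuity of the geometric coefficients\<close>

lemma metric: "t \<in> J \<Longrightarrow> riemannian_metric A (g t)"
  using flow by (simp add: ricci_flow_def)

lemma metric_time_derivative:
  assumes "t \<in> J" "c \<in> A" "p \<in> cdom c"
  shows "((\<lambda>s. g s c p $ i $ j) has_real_derivative (- 2 *\<^sub>R ricci (g t) c p) $ i $ j) (at t within J)"
proof -
  have "\<forall>t\<in>J. \<forall>c\<in>A. \<forall>p\<in>cdom c. \<forall>i j.
      ((\<lambda>s. g s c p $ i $ j) has_real_derivative - 2 * ricci (g t) c p $ i $ j) (at t within J)"
    using flow unfolding ricci_flow_def by (elim conjE)
  from bspec[OF bspec[OF bspec[OF this assms(1)] assms(2)] assms(3)] show ?thesis
    by simp
qed

text \<open>Differentiating the transformation law of \<open>g t\<close> in time yields that of the Ricci tensor.\<close>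

lemma covariant_ricci:
  assumes t: "t \<in> J"
  shows "covariant A (ricci (g t))"
  unfolding covariant_def
proof (intro ballI allI)
  fix c c' p i j assume c: "c \<in> A" "c' \<in> A" and p: "p \<in> cdom c \<inter> cdom c'"
  define a where "a i k = cpd c i (\<lambda>q. coord c' q $ k) p" for i k
  have cov: "g s c p $ i $ j = (\<Sum>k\<in>UNIV. \<Sum>l\<in>UNIV. g s c' p $ k $ l * a i k * a j l)" if "s \<in> J" for s
  proof -
    have "covariant A (g s)"
      using metric[OF that] by (simp add: riemannian_metric_def)
    from bspec[OF bspec[OF bspec[OF this[unfolded covariant_def] c(1)] c(2)] p]
    show ?thesis by (simp add: a_def)
  qed
  have "((\<lambda>s. \<Sum>k\<in>UNIV. \<Sum>l\<in>UNIV. g s c' p $ k $ l * a i k * a j l) has_real_derivative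
      (\<Sum>k\<in>UNIV. \<Sum>l\<in>UNIV. (- 2 *\<^sub>R ricci (g t) c' p) $ k $ l * a i k * a j l)) (at t within J)"
    using p by (intro DERIV_sum DERIV_cmult_right metric_time_derivative t c) auto
  then have "((\<lambda>s. g s c p $ i $ j) has_real_derivative
      (\<Sum>k\<in>UNIV. \<Sum>l\<in>UNIV. (- 2 *\<^sub>R ricci (g t) c' p) $ k $ l * a i k * a j l)) (at t within J)"
    by (rule has_field_derivative_transform_within[OF _ zero_less_one t]) (simp add: cov)
  moreover have "((\<lambda>s. g s c p $ i $ j) has_real_derivative (- 2 *\<^sub>R ricci (g t) c p) $ i $ j) (at t within J)"
    using p by (intro metric_time_derivative t c) auto
  ultimately have "(- 2 *\<^sub>R ricci (g t) c p) $ i $ j =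
      (\<Sum>k\<in>UNIV. \<Sum>l\<in>UNIV. (- 2 *\<^sub>R ricci (g t) c' p) $ k $ l * a i k * a j l)"
    using has_field_derivative_unique nontrivial_J[OF t] by blast
  also have "\<dots> = - 2 * (\<Sum>k\<in>UNIV. \<Sum>l\<in>UNIV. ricci (g t) c' p $ k $ l * a i k * a j l)"
    by (simp add: sum_distrib_left mult.assoc)
  finally show "ricci (g t) c p $ i $ j = (\<Sum>k\<in>UNIV. \<Sum>l\<in>UNIV. ricci (g t) c' p $ k $ l *
      cpd c i (\<lambda>q. coord c' q $ k) p * cpd c j (\<lambda>q. coord c' q $ l) p)"
    by (simp add: a_def)
qed

text \<open>By the flow equation the Ricci components are -1/2 times the time derivative of the
  metric components, whose joint continuity is part of \<open>smooth_in_time_on\<close>; the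
  Christoffel symbols need not be unfolded.\<close>

lemma
  assumes c: "c \<in> A"
  shows continuous_on_metric_time: "continuous_on (J \<times> cimg c) (\<lambda>z. g (fst z) c (cinv c (snd z)) $ i $ j)"
    and continuous_on_ricci_time: "continuous_on (J \<times> cimg c) (\<lambda>z. ricci (g (fst z)) c (cinv c (snd z)) $ i $ j)"
proof -
  have S: "smooth_in_time_on J (cimg c) (\<lambda>t x. g t c (cinv c x) $ i $ j)"
    using flow c unfolding ricci_flow_def by blast
  have C: "continuous_on (J \<times> cimg c) (\<lambda>(t, x). mixed_pds J \<alpha> (\<lambda>t x. g t c (cinv c x) $ i $ j) t x)" for \<alpha>
    using S unfolding smooth_in_time_on_def by (blast intro: differentiable_imp_continuous_on)
  show "continuous_on (J \<times> cimg c) (\<lambda>z. g (fst z) c (cinv c (snd z)) $ i $ j)"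
    using C[of "[]"] by (simp add: case_prod_beta)
  have "continuous_on (J \<times> cimg c) (\<lambda>z. - (1/2) *
      (case z of (t, x) \<Rightarrow> mixed_pds J [None] (\<lambda>t x. g t c (cinv c x) $ i $ j) t x))"
    by (intro continuous_on_mult_left C)
  then show "continuous_on (J \<times> cimg c) (\<lambda>z. ricci (g (fst z)) c (cinv c (snd z)) $ i $ j)"
  proof (rule continuous_on_eq)
    fix z assume "z \<in> J \<times> cimg c"
    then obtain t x where z: "z = (t, x)" "t \<in> J" "x \<in> cimg c"
      by auto
    have "vector_derivative (\<lambda>s. g s c (cinv c x) $ i $ j) (at t within J) = (- 2 *\<^sub>R ricci (g t) c (cinv c x)) $ i $ j"
      using metric_time_derivative[OF z(2) c cinv_in[OF c z(3)]]
      by (intro vector_derivative_within nontrivial_J z(2))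
        (simp add: has_real_derivative_iff_has_vector_derivative)
    then show "- (1/2) * (case z of (t, x) \<Rightarrow> mixed_pds J [None] (\<lambda>t x. g t c (cinv c x) $ i $ j) t x) =
        ricci (g (fst z)) c (cinv c (snd z)) $ i $ j"
      using z(1) by simp
  qed
qed

abbreviation "Hm t c x \<equiv> matrix_inv (g t c (cinv c x))"
abbreviation "Rc t c x \<equiv> ricci (g t) c (cinv c x)"

text \<open>With derivative -2 Ric for the metric, half the trace in the formula for sqrt(det g)
  becomes minus the scalar curvature, and the two signs in the derivative of the inverse
  cancel.\<close>

lemma
  assumes t: "t \<in> J" and c: "c \<in> A" and x: "x \<in> cimg c"
  shows vol_time_derivative: "((\<lambda>s. vol (g s) c x) has_real_derivative
      - (vol (g t) c x * trace (Hm t c x ** Rc t c x))) (at t within J)"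
    and metric_inv_time_derivative: "((\<lambda>s. Hm s c x $ i $ j) has_real_derivative
      2 * (Hm t c x ** Rc t c x ** Hm t c x) $ i $ j) (at t within J)"
proof -
  note p = cinv_in[OF c x]
  have pos: "det (g s c (cinv c x)) > 0" if "s \<in> J" for s
    by (rule metric_det_pos[OF metric[OF that] c p])
  note D = metric_time_derivative[OF t c p]
  have lin: "M ** (- 2 *\<^sub>R N) = - 2 *\<^sub>R (M ** N)" "(- 2 *\<^sub>R N) ** M = - 2 *\<^sub>R (N ** M)" for M N :: "real^'n^'n"
    by (simp_all add: matrix_matrix_mult_def vec_eq_iff sum_distrib_left sum_negf mult_ac)
  have "trace (- 2 *\<^sub>R M) = - 2 * trace M" for M :: "real^'n^'n"
    by (simp add: trace_def sum_distrib_left sum_negf)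
  then show "((\<lambda>s. vol (g s) c x) has_real_derivative
      - (vol (g t) c x * trace (Hm t c x ** Rc t c x))) (at t within J)"
    using has_real_derivative_sqrt_det[OF D pos[OF t]] by (simp only: lin) simp
  show "((\<lambda>s. Hm s c x $ i $ j) has_real_derivative
      2 * (Hm t c x ** Rc t c x ** Hm t c x) $ i $ j) (at t within J)"
  proof (rule DERIV_cong[OF has_real_derivative_matrix_inv[OF D]])
    show "- (Hm t c x ** (- 2 *\<^sub>R Rc t c x) ** Hm t c x) $ i $ j = 2 * (Hm t c x ** Rc t c x ** Hm t c x) $ i $ j"
      by (simp only: lin) simp
  qed (use pos t nontrivial_J in \<open>auto simp: less_imp_neq[symmetric]\<close>)
qed

lemma
  assumes c: "c \<in> A"
  shows continuous_on_vol_time: "continuous_on (J \<times> cimg c) (\<lambda>z. vol (g (fst z)) c (snd z))"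
    and continuous_on_metric_inv_time: "continuous_on (J \<times> cimg c) (\<lambda>z. Hm (fst z) c (snd z) $ i $ j)"
    and continuous_on_scalar_time:
      "continuous_on (J \<times> cimg c) (\<lambda>z. trace (Hm (fst z) c (snd z) ** Rc (fst z) c (snd z)))"
    and continuous_on_ricci_inv_time: "continuous_on (J \<times> cimg c)
      (\<lambda>z. (Hm (fst z) c (snd z) ** Rc (fst z) c (snd z) ** Hm (fst z) c (snd z)) $ i $ j)"
proof -
  have pos: "det (g (fst z) c (cinv c (snd z))) > 0" if "z \<in> J \<times> cimg c" for z
    using that by (intro metric_det_pos[OF metric _ cinv_in] c) auto
  show "continuous_on (J \<times> cimg c) (\<lambda>z. vol (g (fst z)) c (snd z))"
    by (intro continuous_on_real_sqrt continuous_on_det continuous_on_metric_time c)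
  have H: "continuous_on (J \<times> cimg c) (\<lambda>z. Hm (fst z) c (snd z) $ i $ j)" for i j
    using pos by (intro continuous_on_matrix_inv continuous_on_metric_time c) (auto simp: less_imp_neq[symmetric])
  then show "continuous_on (J \<times> cimg c) (\<lambda>z. Hm (fst z) c (snd z) $ i $ j)" .
  show "continuous_on (J \<times> cimg c) (\<lambda>z. trace (Hm (fst z) c (snd z) ** Rc (fst z) c (snd z)))"
    unfolding trace_def matrix_matrix_mult_def vec_lambda_beta
    by (intro continuous_on_sum continuous_on_mult H continuous_on_ricci_time c)
  show "continuous_on (J \<times> cimg c)
      (\<lambda>z. (Hm (fst z) c (snd z) ** Rc (fst z) c (snd z) ** Hm (fst z) c (snd z)) $ i $ j)"
    unfolding matrix_matrix_mult_def vec_lambda_beta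
    by (intro continuous_on_sum continuous_on_mult H continuous_on_ricci_time c)
qed

lemma continuous_on_time_slice:
  fixes F :: "real \<times> (real^'n) \<Rightarrow> real"
  assumes "continuous_on (J \<times> S) F" "t \<in> J"
  shows "continuous_on S (\<lambda>x. F (t, x))"
  by (rule continuous_on_compose2[OF assms(1)]) (use assms(2) in \<open>auto intro!: continuous_intros\<close>)

lemma continuous_on_scalar_curvature:
  assumes t: "t \<in> J"
  shows "continuous_on UNIV (scalar_curvature A (g t))"
proof (rule continuous_on_mfd)
  fix c assume c: "c \<in> A"
  show "continuous_on (cimg c) (\<lambda>x. scalar_curvature A (g t) (cinv c x))"
    by (rule continuous_on_eq[OF continuous_on_time_slice[OF continuous_on_scalar_time[OF c] t]])
      (simp add: scalar_curvature_def trace_wrt_chart[OF metric[OF t] covariant_ricci[OF t] c cinv_in[OF c]])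
qed

lemma continuous_on_ricci_grad:
  assumes t: "t \<in> J" and u: "C1_mfd A u"
  shows "continuous_on UNIV (\<lambda>p. tensor_apply A (ricci (g t)) (grad (g t) u) (grad (g t) u) p)"
proof (rule continuous_on_mfd)
  fix c assume c: "c \<in> A"
  have "continuous_on (cimg c) (\<lambda>x. (Hm t c x ** Rc t c x ** Hm t c x) $ i $ j)" for i j
    using continuous_on_time_slice[OF continuous_on_ricci_inv_time[OF c] t] by simp
  from continuous_on_bilinear_chart[OF u u c this]
  show "continuous_on (cimg c) (\<lambda>x. tensor_apply A (ricci (g t)) (grad (g t) u) (grad (g t) u) (cinv c x))"
    by (rule continuous_on_eq)
      (simp add: tensor_apply_grad_chart[OF metric[OF t] covariant_ricci[OF t] u u c cinv_in[OF c]])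
qed

text \<open>For the energy, density and inverse metric are kept together as one coefficient, so its
  derivative carries both curvature terms.\<close>

lemma
  assumes t: "t \<in> J" and c: "c \<in> A" and box: "cbox a b \<subseteq> cimg c"
  shows uniform_limit_vol: "uniform_limit (cbox a b) (\<lambda>s x. (vol (g s) c x - vol (g t) c x) / (s - t))
      (\<lambda>x. - (vol (g t) c x * trace (Hm t c x ** Rc t c x))) (at t within J)"
    and uniform_limit_inv_vol: "uniform_limit (cbox a b)
      (\<lambda>s x. (vol (g s) c x * Hm s c x $ i $ j - vol (g t) c x * Hm t c x $ i $ j) / (s - t))
      (\<lambda>x. vol (g t) c x * (2 * (Hm t c x ** Rc t c x ** Hm t c x) $ i $ j
        - trace (Hm t c x ** Rc t c x) * Hm t c x $ i $ j)) (at t within J)"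
proof -
  have sub: "J \<times> cbox a b \<subseteq> J \<times> cimg c"
    using box by auto
  note C = continuous_on_subset[OF _ sub]
  show "uniform_limit (cbox a b) (\<lambda>s x. (vol (g s) c x - vol (g t) c x) / (s - t))
      (\<lambda>x. - (vol (g t) c x * trace (Hm t c x ** Rc t c x))) (at t within J)"
  proof (rule uniform_limit_difference_quotient[OF compact_cbox convex_J t])
    show "((\<lambda>s. vol (g s) c x) has_real_derivative - (vol (g s) c x * trace (Hm s c x ** Rc s c x))) (at s within J)"
      if "s \<in> J" "x \<in> cbox a b" for s x
      using that box by (intro vol_time_derivative c) auto
    show "continuous_on (J \<times> cbox a b) (\<lambda>(s, x). - (vol (g s) c x * trace (Hm s c x ** Rc s c x)))"
      unfolding case_prod_beta
      by (rule C, intro continuous_on_minus continuous_on_mult continuous_on_vol_time continuous_on_scalar_time c)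
  qed
  show "uniform_limit (cbox a b)
      (\<lambda>s x. (vol (g s) c x * Hm s c x $ i $ j - vol (g t) c x * Hm t c x $ i $ j) / (s - t))
      (\<lambda>x. vol (g t) c x * (2 * (Hm t c x ** Rc t c x ** Hm t c x) $ i $ j
        - trace (Hm t c x ** Rc t c x) * Hm t c x $ i $ j)) (at t within J)"
  proof (rule uniform_limit_difference_quotient[OF compact_cbox convex_J t])
    show "((\<lambda>s. vol (g s) c x * Hm s c x $ i $ j) has_real_derivative
        vol (g s) c x * (2 * (Hm s c x ** Rc s c x ** Hm s c x) $ i $ j
        - trace (Hm s c x ** Rc s c x) * Hm s c x $ i $ j)) (at s within J)"
      if "s \<in> J" "x \<in> cbox a b" for s x
    proof (rule DERIV_cong[OF DERIV_mult[OF vol_time_derivative metric_inv_time_derivative]])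
    qed (use that box c in \<open>auto simp: algebra_simps\<close>)
    show "continuous_on (J \<times> cbox a b) (\<lambda>(s, x). vol (g s) c x * (2 * (Hm s c x ** Rc s c x ** Hm s c x) $ i $ j
        - trace (Hm s c x ** Rc s c x) * Hm s c x $ i $ j))"
      unfolding case_prod_beta
      by (rule C, intro continuous_on_diff continuous_on_mult continuous_on_const continuous_on_vol_time
          continuous_on_scalar_time continuous_on_metric_inv_time continuous_on_ricci_inv_time c)
  qed
qed

text \<open>\<open>C1_into_Cinf\<close> controls the difference quotients of \<open>f\<close>;
  removing the factor \<open>s - t\<close> leaves locally uniform convergence of \<open>f s\<close>
  and of its first derivatives.\<close>

lemma
  assumes f: "C1_into_Cinf A J f" and t: "t \<in> J" and c: "c \<in> A" and K: "compact K" "K \<subseteq> cimg c"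
  shows uniform_limit_C1: "uniform_limit K (\<lambda>s x. f s (cinv c x)) (\<lambda>x. f t (cinv c x)) (at t within J)"
    and uniform_limit_C1_pd:
      "uniform_limit K (\<lambda>s. pd j (\<lambda>x. f s (cinv c x))) (pd j (\<lambda>x. f t (cinv c x))) (at t within J)"
proof -
  obtain h where h: "\<And>t. t \<in> J \<Longrightarrow> h t \<in> Cinf A"
    "\<And>t. t \<in> J \<Longrightarrow> Cinf_tendsto A (\<lambda>s p. (f s p - f t p) / (s - t)) (h t) (at t within J)"
    using f unfolding C1_into_Cinf_def by blast
  have fC: "f s \<in> Cinf A" if "s \<in> J" for s
    using f that unfolding C1_into_Cinf_def by blast
  have lim: "uniform_limit K (\<lambda>s. pds \<alpha> ((\<lambda>p. (f s p - f t p) / (s - t)) \<circ> cinv c)) (pds \<alpha> (h t \<circ> cinv c)) (at t within J)" for \<alpha>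
    using h(2)[OF t] c K unfolding Cinf_tendsto_def by blast
  have bd: "bounded (pds \<alpha> (h t \<circ> cinv c) ` K)" for \<alpha>
  proof -
    have "C1_on (cimg c) (pds \<alpha> (h t \<circ> cinv c))"
      using h(1)[OF t] c open_cimg[OF c] by (intro C1_on_smooth) (auto simp: Cinf_def)
    from continuous_on_subset[OF C1_onD(3)[OF this] K(2)] show ?thesis
      by (intro compact_imp_bounded compact_continuous_image K(1))
  qed
  show "uniform_limit K (\<lambda>s x. f s (cinv c x)) (\<lambda>x. f t (cinv c x)) (at t within J)"
  proof (rule uniform_limit_from_difference_quotient)
    show "uniform_limit K (\<lambda>s x. (f s (cinv c x) - f t (cinv c x)) / (s - t)) (\<lambda>x. h t (cinv c x)) (at t within J)"
      using lim[of "[]"] by (simp add: o_def)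
    show "bounded ((\<lambda>x. h t (cinv c x)) ` K)"
      using bd[of "[]"] by (simp add: o_def)
  qed
  show "uniform_limit K (\<lambda>s. pd j (\<lambda>x. f s (cinv c x))) (pd j (\<lambda>x. f t (cinv c x))) (at t within J)"
  proof (rule uniform_limit_from_difference_quotient)
    \<comment> \<open>For fixed \<open>s\<close> and \<open>t\<close> the quotient is a linear
      combination of two functions of \<open>x\<close>, so it commutes with
      \<open>pd j\<close>.\<close>
    have "pds [j] ((\<lambda>p. (f s p - f t p) / (s - t)) \<circ> cinv c) x =
        (pd j (\<lambda>x. f s (cinv c x)) x - pd j (\<lambda>x. f t (cinv c x)) x) / (s - t)"
      if "s \<in> J" "x \<in> K" for s x
    proof -
      have d: "(\<lambda>x. f r (cinv c x)) differentiable (at x)" if "r \<in> J" for r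
        using C1_onD(1)[of "cimg c"] Cinf_C1_mfd[OF fC[OF that]] c K(2) \<open>x \<in> K\<close> unfolding C1_mfd_def by blast
      have "(\<lambda>p. (f s p - f t p) / (s - t)) \<circ> cinv c =
          (\<lambda>x. (1 / (s - t)) * f s (cinv c x) + (- 1 / (s - t)) * f t (cinv c x))"
        by (auto simp: diff_divide_distrib)
      then have "pds [j] ((\<lambda>p. (f s p - f t p) / (s - t)) \<circ> cinv c) x =
          pd j (\<lambda>x. (1 / (s - t)) * f s (cinv c x) + (- 1 / (s - t)) * f t (cinv c x)) x"
        by simp
      also have "\<dots> = (1 / (s - t)) * pd j (\<lambda>x. f s (cinv c x)) x + (- 1 / (s - t)) * pd j (\<lambda>x. f t (cinv c x)) x"
        by (simp only: pd_add[OF differentiable_mult[OF differentiable_const d[OF that(1)]]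
              differentiable_mult[OF differentiable_const d[OF t]]] pd_cmult[OF d[OF that(1)]] pd_cmult[OF d[OF t]])
      finally show ?thesis
        by (simp add: diff_divide_distrib)
    qed
    then show "uniform_limit K (\<lambda>s x. (pd j (\<lambda>x. f s (cinv c x)) x - pd j (\<lambda>x. f t (cinv c x)) x) / (s - t))
        (pds [j] (h t \<circ> cinv c)) (at t within J)"
      by (intro uniform_limit_cong[THEN iffD1, OF _ _ lim[of "[j]"]]) (auto simp: eventually_at_filter)
  qed (rule bd)
qed

end

section \<open>Differentiating mass and energy\<close>

lemma (in closed_mfd) cometric_commute:
  assumes "riemannian_metric A g"
  shows "cometric A g u v p = cometric A g v u p"
  using metric_inv_sym[OF assms chart_at]
  by (simp add: cometric_def Let_def) (metis inner_commute inner_matrix_vector_mult)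

context ricci_flow_mfd
begin

lemma C1_mfd_C1_into_Cinf: "C1_into_Cinf A J f \<Longrightarrow> s \<in> J \<Longrightarrow> C1_mfd A (f s)"
  by (rule Cinf_C1_mfd) (simp add: C1_into_Cinf_def)

lemma continuous_on_cbox_chart:
  assumes "c \<in> A" "cbox a b \<subseteq> cimg c" "C1_mfd A u"
  shows "continuous_on (cbox a b) (\<lambda>x. u (cinv c x))" "continuous_on (cbox a b) (pd i (\<lambda>x. u (cinv c x)))"
proof -
  have "C1_on (cbox a b) (\<lambda>x. u (cinv c x))"
    using assms C1_on_subset unfolding C1_mfd_def by blast
  then show "continuous_on (cbox a b) (\<lambda>x. u (cinv c x))" "continuous_on (cbox a b) (pd i (\<lambda>x. u (cinv c x)))"
    by (rule C1_onD)+
qed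

text \<open>In \<open>X s r\<close> the first argument dates the eigenfunction paired with
  \<open>f t\<close>, the second the measure. The quotient varies the measure alone, so its limit
  contains only the derivative of the density.\<close>

lemma tendsto_mass_quotient:
  assumes f: "C1_into_Cinf A J f" and t: "t \<in> J"
  defines "X \<equiv> \<lambda>s r. \<integral>p. f s p * f t p \<partial>riemannian_measure A (g r)"
  shows "((\<lambda>s. (X s s - X s t) / (s - t)) \<longlongrightarrow>
      - (\<integral>p. (f t p)\<^sup>2 * scalar_curvature A (g t) p \<partial>riemannian_measure A (g t))) (at t within J)"
    and "((\<lambda>s. X s s) \<longlongrightarrow> X t t) (at t within J)"
proof -
  obtain I :: "'m set" and ch a b pu where P: "chart_partition I ch a b pu"
    using ex_chart_partition by blast
  note PD = chart_partitionD[OF P]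
  note fC1 = C1_mfd_C1_into_Cinf[OF f]
  define w where "w k x = pu k (cinv (ch k) x)" for k x
  define e where "e k s x = f s (cinv (ch k) x) * f t (cinv (ch k) x)" for k s x
  define q where "q k s x = vol (g s) (ch k) x" for k s x
  define q' where "q' k x = - (vol (g t) (ch k) x * trace (Hm t (ch k) x ** Rc t (ch k) x))" for k x
  have X: "X s r = (\<Sum>k\<in>I. integral (cbox (a k) (b k)) (\<lambda>x. w k x * e k s x * q k r x))" if "s \<in> J" "r \<in> J" for s r
    unfolding X_def w_def e_def q_def
    by (rule integral_eq_sum_charts[OF metric[OF that(2)] P])
      (intro continuous_on_mult C1_mfd_continuous fC1 that(1) t)
  have w: "continuous_on (cbox (a k) (b k)) (w k)" if "k \<in> I" for k
    unfolding w_def[abs_def] by (rule continuous_on_cbox_chart[OF PD(3,4,5)]) (rule that)+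
  have e: "continuous_on (cbox (a k) (b k)) (e k s)" if "k \<in> I" "s \<in> J" for k s
    unfolding e_def[abs_def]
    by (intro continuous_on_mult continuous_on_cbox_chart PD(3,4) that fC1 t)
  have q: "continuous_on (cbox (a k) (b k)) (q k s)" if "k \<in> I" "s \<in> J" for k s
    unfolding q_def[abs_def]
    by (rule continuous_on_subset[OF continuous_on_vol[OF metric[OF that(2)] PD(3)[OF that(1)]] PD(4)[OF that(1)]])
  have scal: "continuous_on (cbox (a k) (b k)) (\<lambda>x. trace (Hm t (ch k) x ** Rc t (ch k) x))" if "k \<in> I" for k
    using continuous_on_time_slice[OF continuous_on_scalar_time[OF PD(3)[OF that]] t]
    by (simp add: continuous_on_subset[OF _ PD(4)[OF that]])
  have q'_cont: "continuous_on (cbox (a k) (b k)) (q' k)" if "k \<in> I" for k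
    unfolding q'_def[abs_def] using q[OF that t]
    by (intro continuous_on_minus continuous_on_mult scal that) (simp add: q_def[abs_def])
  have bd: "bounded (h ` cbox x y)" if "continuous_on (cbox x y) h" for h :: "real^'n \<Rightarrow> real" and x y
    by (rule compact_imp_bounded[OF compact_continuous_image[OF that compact_cbox]])
  have q_lim: "uniform_limit (cbox (a k) (b k)) (\<lambda>s x. (q k s x - q k t x) / (s - t)) (q' k) (at t within J)" if "k \<in> I" for k
    unfolding q_def q'_def[abs_def] by (rule uniform_limit_vol[OF t PD(3,4)]) (rule that)+
  have e_lim: "uniform_limit (cbox (a k) (b k)) (e k) (e k t) (at t within J)" if k: "k \<in> I" for k
    unfolding e_def[abs_def]
    by (rule uniform_lim_mult[OF uniform_limit_C1[OF f t PD(3)[OF k] compact_cbox PD(4)[OF k]] uniform_limit_const])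
      (intro bd continuous_on_cbox_chart PD(3,4) k fC1 t)+
  have inJ: "\<forall>\<^sub>F s in at t within J. s \<in> J"
    by (simp add: eventually_at_filter)
  have L: "((\<lambda>s. \<Sum>k\<in>I. (integral (cbox (a k) (b k)) (\<lambda>x. w k x * e k s x * q k s x)
      - integral (cbox (a k) (b k)) (\<lambda>x. w k x * e k s x * q k t x)) / (s - t)) \<longlongrightarrow>
      (\<Sum>k\<in>I. integral (cbox (a k) (b k)) (\<lambda>x. w k x * e k t x * q' k x))) (at t within J)"
    by (intro tendsto_sum tendsto_weighted_integral_quotient[OF t q_lim e_lim w q'_cont e q])
  have E: "\<forall>\<^sub>F s in at t within J. (\<Sum>k\<in>I. (integral (cbox (a k) (b k)) (\<lambda>x. w k x * e k s x * q k s x)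
      - integral (cbox (a k) (b k)) (\<lambda>x. w k x * e k s x * q k t x)) / (s - t)) = (X s s - X s t) / (s - t)"
    using inJ by eventually_elim (simp add: X t sum_subtractf flip: sum_divide_distrib)
  have Q: "(\<Sum>k\<in>I. integral (cbox (a k) (b k)) (\<lambda>x. w k x * e k t x * q' k x)) =
      - (\<integral>p. (f t p)\<^sup>2 * scalar_curvature A (g t) p \<partial>riemannian_measure A (g t))"
  proof -
    have "(\<integral>p. (f t p)\<^sup>2 * scalar_curvature A (g t) p \<partial>riemannian_measure A (g t)) =
       (\<Sum>k\<in>I. integral (cbox (a k) (b k)) (\<lambda>x. pu k (cinv (ch k) x) * ((f t (cinv (ch k) x))\<^sup>2 *
          scalar_curvature A (g t) (cinv (ch k) x)) * vol (g t) (ch k) x))"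
      by (rule integral_eq_sum_charts[OF metric[OF t] P])
        (intro continuous_on_mult continuous_on_power continuous_on_scalar_curvature C1_mfd_continuous fC1 t)
    also have "\<dots> = (\<Sum>k\<in>I. - integral (cbox (a k) (b k)) (\<lambda>x. w k x * e k t x * q' k x))"
    proof (rule sum.cong[OF refl])
      fix k assume k: "k \<in> I"
      have "integral (cbox (a k) (b k)) (\<lambda>x. pu k (cinv (ch k) x) * ((f t (cinv (ch k) x))\<^sup>2 *
          scalar_curvature A (g t) (cinv (ch k) x)) * vol (g t) (ch k) x) =
          integral (cbox (a k) (b k)) (\<lambda>x. - (w k x * e k t x * q' k x))"
      proof (rule integral_cong)
        fix x assume "x \<in> cbox (a k) (b k)"
        then have "cinv (ch k) x \<in> cdom (ch k)"
          using PD(4)[OF k] cinv_in[OF PD(3)[OF k]] by auto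
        then show "pu k (cinv (ch k) x) * ((f t (cinv (ch k) x))\<^sup>2 *
          scalar_curvature A (g t) (cinv (ch k) x)) * vol (g t) (ch k) x = - (w k x * e k t x * q' k x)"
          by (simp add: scalar_curvature_def trace_wrt_chart[OF metric[OF t] covariant_ricci[OF t] PD(3)[OF k]]
              w_def e_def q'_def power2_eq_square)
      qed
      then show "integral (cbox (a k) (b k)) (\<lambda>x. pu k (cinv (ch k) x) * ((f t (cinv (ch k) x))\<^sup>2 *
          scalar_curvature A (g t) (cinv (ch k) x)) * vol (g t) (ch k) x) =
          - integral (cbox (a k) (b k)) (\<lambda>x. w k x * e k t x * q' k x)"
        by simp
    qed
    finally show ?thesis
      by (simp add: sum_negf)
  qed
  show 1: "((\<lambda>s. (X s s - X s t) / (s - t)) \<longlongrightarrow>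
      - (\<integral>p. (f t p)\<^sup>2 * scalar_curvature A (g t) p \<partial>riemannian_measure A (g t))) (at t within J)"
    by (rule Lim_transform_eventually[OF L[unfolded Q] E])
  \<comment> \<open>With the measure frozen at \<open>t\<close>, convergence of \<open>f s\<close>
    makes \<open>X s t\<close> tend to \<open>X t t\<close>. The rest, \<open>X s s - X s t\<close>,
    is the quotient above times \<open>s - t\<close> and disappears in the limit.\<close>
  have "((\<lambda>s. \<Sum>k\<in>I. integral (cbox (a k) (b k)) (\<lambda>x. w k x * e k s x * q k t x)) \<longlongrightarrow>
      (\<Sum>k\<in>I. integral (cbox (a k) (b k)) (\<lambda>x. w k x * e k t x * q k t x))) (at t within J)"
  proof (intro tendsto_sum tendsto_integral_uniform_limit)
    fix k assume k: "k \<in> I"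
    show "uniform_limit (cbox (a k) (b k)) (\<lambda>s x. w k x * e k s x * q k t x) (\<lambda>x. w k x * e k t x * q k t x) (at t within J)"
      by (rule uniform_lim_mult[OF uniform_lim_mult[OF uniform_limit_const e_lim[OF k]] uniform_limit_const])
        (intro bd continuous_on_mult w e q k t)+
    show "\<forall>\<^sub>F s in at t within J. continuous_on (cbox (a k) (b k)) (\<lambda>x. w k x * e k s x * q k t x)"
      using inJ by eventually_elim (intro continuous_on_mult w e q k t)
    show "continuous_on (cbox (a k) (b k)) (\<lambda>x. w k x * e k t x * q k t x)"
      by (intro continuous_on_mult w e q k t)
  qed
  then have "((\<lambda>s. X s t) \<longlongrightarrow> X t t) (at t within J)"
    unfolding X[OF t t] by (rule Lim_transform_eventually) (use inJ in \<open>eventually_elim, simp add: X t\<close>)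
  moreover have "((\<lambda>s. (X s s - X s t) / (s - t) * (s - t)) \<longlongrightarrow>
      - (\<integral>p. (f t p)\<^sup>2 * scalar_curvature A (g t) p \<partial>riemannian_measure A (g t)) * (t - t)) (at t within J)"
    by (intro tendsto_mult 1 tendsto_diff tendsto_ident_at tendsto_const)
  ultimately have L2: "((\<lambda>s. X s t + (X s s - X s t) / (s - t) * (s - t)) \<longlongrightarrow> X t t + 0) (at t within J)"
    by (intro tendsto_add) auto
  show "((\<lambda>s. X s s) \<longlongrightarrow> X t t) (at t within J)"
  proof -
    have "\<forall>\<^sub>F s in at t within J. X s t + (X s s - X s t) / (s - t) * (s - t) = X s s"
      by (simp add: eventually_at_filter)
    with L2 show ?thesis
      by (simp add: Lim_transform_eventually)
  qed
qed

text \<open>Same scheme as for the mass, with coefficient sqrt(det g) times the inverse metric for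
  each pair of indices; its product rule produces 2 Ric from the inverse metric and minus R from the
  density.\<close>

lemma tendsto_energy_quotient:
  assumes f: "C1_into_Cinf A J f" and t: "t \<in> J"
  defines "Y \<equiv> \<lambda>s r. \<integral>p. cometric A (g r) (f s) (f t) p \<partial>riemannian_measure A (g r)"
  shows "((\<lambda>s. (Y s s - Y s t) / (s - t)) \<longlongrightarrow>
      2 * (\<integral>p. tensor_apply A (ricci (g t)) (grad (g t) (f t)) (grad (g t) (f t)) p \<partial>riemannian_measure A (g t))
      - (\<integral>p. scalar_curvature A (g t) p * cometric A (g t) (f t) (f t) p \<partial>riemannian_measure A (g t)))
      (at t within J)"
proof -
  let ?Ric = "\<lambda>p. tensor_apply A (ricci (g t)) (grad (g t) (f t)) (grad (g t) (f t)) p"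
  let ?RE = "\<lambda>p. scalar_curvature A (g t) p * cometric A (g t) (f t) (f t) p"
  obtain I :: "'m set" and ch a b pu where P: "chart_partition I ch a b pu"
    using ex_chart_partition by blast
  note PD = chart_partitionD[OF P]
  note fC1 = C1_mfd_C1_into_Cinf[OF f]
  define w where "w k x = pu k (cinv (ch k) x)" for k x
  define e where "e k i j s x = pd i (\<lambda>x. f s (cinv (ch k) x)) x * pd j (\<lambda>x. f t (cinv (ch k) x)) x" for k i j s x
  define q where "q k i j s x = vol (g s) (ch k) x * Hm s (ch k) x $ i $ j" for k i j s x
  define q' where "q' k i j x = vol (g t) (ch k) x * (2 * (Hm t (ch k) x ** Rc t (ch k) x ** Hm t (ch k) x) $ i $ j
        - trace (Hm t (ch k) x ** Rc t (ch k) x) * Hm t (ch k) x $ i $ j)" for k i j x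
  have w: "continuous_on (cbox (a k) (b k)) (w k)" if "k \<in> I" for k
    unfolding w_def[abs_def] by (rule continuous_on_cbox_chart[OF PD(3,4,5)]) (rule that)+
  have e: "continuous_on (cbox (a k) (b k)) (e k i j s)" if "k \<in> I" "s \<in> J" for k i j s
    unfolding e_def[abs_def]
    by (intro continuous_on_mult continuous_on_cbox_chart PD(3,4) that fC1 t)
  have vol: "continuous_on (cbox (a k) (b k)) (\<lambda>x. vol (g s) (ch k) x)" if "k \<in> I" "s \<in> J" for k s
    by (rule continuous_on_subset[OF continuous_on_vol[OF metric[OF that(2)] PD(3)[OF that(1)]] PD(4)[OF that(1)]])
  have inv: "continuous_on (cbox (a k) (b k)) (\<lambda>x. Hm s (ch k) x $ i $ j)" if "k \<in> I" "s \<in> J" for k s i j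
    by (rule continuous_on_subset[OF continuous_on_metric_inv[OF metric[OF that(2)] PD(3)[OF that(1)]] PD(4)[OF that(1)]])
  have q: "continuous_on (cbox (a k) (b k)) (q k i j s)" if "k \<in> I" "s \<in> J" for k i j s
    unfolding q_def[abs_def] by (intro continuous_on_mult vol inv that)
  have scal: "continuous_on (cbox (a k) (b k)) (\<lambda>x. trace (Hm t (ch k) x ** Rc t (ch k) x))" if "k \<in> I" for k
    using continuous_on_time_slice[OF continuous_on_scalar_time[OF PD(3)[OF that]] t]
    by (simp add: continuous_on_subset[OF _ PD(4)[OF that]])
  have ric: "continuous_on (cbox (a k) (b k)) (\<lambda>x. (Hm t (ch k) x ** Rc t (ch k) x ** Hm t (ch k) x) $ i $ j)" if "k \<in> I" for k i j
    using continuous_on_time_slice[OF continuous_on_ricci_inv_time[OF PD(3)[OF that]] t]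
    by (simp add: continuous_on_subset[OF _ PD(4)[OF that]])
  have q'_cont: "continuous_on (cbox (a k) (b k)) (q' k i j)" if "k \<in> I" for k i j
    unfolding q'_def[abs_def]
    by (intro continuous_on_diff continuous_on_mult continuous_on_const vol inv scal ric that t)
  have bd: "bounded (h ` cbox x y)" if "continuous_on (cbox x y) h" for h :: "real^'n \<Rightarrow> real" and x y
    by (rule compact_imp_bounded[OF compact_continuous_image[OF that compact_cbox]])
  have q_lim: "uniform_limit (cbox (a k) (b k)) (\<lambda>s x. (q k i j s x - q k i j t x) / (s - t)) (q' k i j) (at t within J)"
    if "k \<in> I" for k i j
    unfolding q_def q'_def[abs_def] by (rule uniform_limit_inv_vol[OF t PD(3,4)]) (rule that)+
  have e_lim: "uniform_limit (cbox (a k) (b k)) (e k i j) (e k i j t) (at t within J)" if k: "k \<in> I" for k i j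
    unfolding e_def[abs_def]
    by (rule uniform_lim_mult[OF uniform_limit_C1_pd[OF f t PD(3)[OF k] compact_cbox PD(4)[OF k]] uniform_limit_const])
      (intro bd continuous_on_cbox_chart PD(3,4) k fC1 t)+
  have cm: "cinv (ch k) x \<in> cdom (ch k)" "x \<in> cimg (ch k)" if "k \<in> I" "x \<in> cbox (a k) (b k)" for k x
    using PD(4)[OF that(1)] cinv_in[OF PD(3)[OF that(1)]] that(2) by auto
  \<comment> \<open>Pulling the index sums out of the integral reduces the claim to the scalar lemma
    \<open>tendsto_weighted_integral_quotient\<close>, applied to each pair \<open>i\<close>,
    \<open>j\<close>.\<close>
  have chart_sum: "integral (cbox (a k) (b k)) (\<lambda>x. \<Sum>i\<in>UNIV. \<Sum>j\<in>UNIV. w k x * e k i j s x * h i j x) =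
      (\<Sum>i\<in>UNIV. \<Sum>j\<in>UNIV. integral (cbox (a k) (b k)) (\<lambda>x. w k x * e k i j s x * h i j x))"
    if "k \<in> I" "s \<in> J" "\<And>i j. continuous_on (cbox (a k) (b k)) (h i j)" for k s h
  proof -
    have c: "continuous_on (cbox (a k) (b k)) (\<lambda>x. w k x * e k i j s x * h i j x)" for i j
      by (intro continuous_on_mult w e that)
    have "integral (cbox (a k) (b k)) (\<lambda>x. \<Sum>i\<in>UNIV. \<Sum>j\<in>UNIV. w k x * e k i j s x * h i j x) =
      (\<Sum>i\<in>UNIV. integral (cbox (a k) (b k)) (\<lambda>x. \<Sum>j\<in>UNIV. w k x * e k i j s x * h i j x))"
      by (intro integral_sum finite_UNIV finite integrable_continuous continuous_on_sum c)
    also have "\<dots> = (\<Sum>i\<in>UNIV. \<Sum>j\<in>UNIV. integral (cbox (a k) (b k)) (\<lambda>x. w k x * e k i j s x * h i j x))"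
      by (intro sum.cong refl integral_sum finite integrable_continuous c)
    finally show ?thesis .
  qed
  have Y: "Y s r = (\<Sum>k\<in>I. \<Sum>i\<in>UNIV. \<Sum>j\<in>UNIV. integral (cbox (a k) (b k)) (\<lambda>x. w k x * e k i j s x * q k i j r x))"
    if sr: "s \<in> J" "r \<in> J" for s r
  proof -
    have "Y s r = (\<Sum>k\<in>I. integral (cbox (a k) (b k))
        (\<lambda>x. pu k (cinv (ch k) x) * cometric A (g r) (f s) (f t) (cinv (ch k) x) * vol (g r) (ch k) x))"
      unfolding Y_def
      by (rule integral_eq_sum_charts[OF metric[OF sr(2)] P])
        (intro continuous_on_cometric metric fC1 sr t)
    also have "\<dots> = (\<Sum>k\<in>I. integral (cbox (a k) (b k)) (\<lambda>x. \<Sum>i\<in>UNIV. \<Sum>j\<in>UNIV. w k x * e k i j s x * q k i j r x))"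
    proof (intro sum.cong refl integral_cong)
      fix k x assume k: "k \<in> I" and x: "x \<in> cbox (a k) (b k)"
      show "pu k (cinv (ch k) x) * cometric A (g r) (f s) (f t) (cinv (ch k) x) * vol (g r) (ch k) x =
          (\<Sum>i\<in>UNIV. \<Sum>j\<in>UNIV. w k x * e k i j s x * q k i j r x)"
        unfolding cometric_chart[OF metric[OF sr(2)] fC1[OF sr(1)] fC1[OF t] PD(3)[OF k] cm(1)[OF k x]]
          inner_matrix_vector_sum dvec_nth[OF PD(3)[OF k] cm(2)[OF k x]]
        by (simp add: w_def e_def q_def sum_distrib_left sum_distrib_right mult_ac)
    qed
    also have "\<dots> = (\<Sum>k\<in>I. \<Sum>i\<in>UNIV. \<Sum>j\<in>UNIV. integral (cbox (a k) (b k)) (\<lambda>x. w k x * e k i j s x * q k i j r x))"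
      by (intro sum.cong refl chart_sum q sr)
    finally show ?thesis .
  qed
  have inJ: "\<forall>\<^sub>F s in at t within J. s \<in> J"
    by (simp add: eventually_at_filter)
  have L: "((\<lambda>s. \<Sum>k\<in>I. \<Sum>i\<in>UNIV. \<Sum>j\<in>UNIV. (integral (cbox (a k) (b k)) (\<lambda>x. w k x * e k i j s x * q k i j s x)
      - integral (cbox (a k) (b k)) (\<lambda>x. w k x * e k i j s x * q k i j t x)) / (s - t)) \<longlongrightarrow>
      (\<Sum>k\<in>I. \<Sum>i\<in>UNIV. \<Sum>j\<in>UNIV. integral (cbox (a k) (b k)) (\<lambda>x. w k x * e k i j t x * q' k i j x))) (at t within J)"
    by (intro tendsto_sum tendsto_weighted_integral_quotient[OF t q_lim e_lim w q'_cont e q])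
  have E: "\<forall>\<^sub>F s in at t within J. (\<Sum>k\<in>I. \<Sum>i\<in>UNIV. \<Sum>j\<in>UNIV. (integral (cbox (a k) (b k)) (\<lambda>x. w k x * e k i j s x * q k i j s x)
      - integral (cbox (a k) (b k)) (\<lambda>x. w k x * e k i j s x * q k i j t x)) / (s - t)) = (Y s s - Y s t) / (s - t)"
    using inJ by eventually_elim (simp add: Y t sum_subtractf flip: sum_divide_distrib)
  have Ric_cont: "continuous_on UNIV ?Ric"
    by (rule continuous_on_ricci_grad[OF t fC1[OF t]])
  have RE_cont: "continuous_on UNIV ?RE"
    by (intro continuous_on_mult continuous_on_scalar_curvature[OF t] continuous_on_cometric metric fC1 t)
  have "2 * (\<integral>p. ?Ric p \<partial>riemannian_measure A (g t)) - (\<integral>p. ?RE p \<partial>riemannian_measure A (g t)) =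
      (\<integral>p. 2 * ?Ric p - ?RE p \<partial>riemannian_measure A (g t))"
    using integrable_continuous_mfd[OF metric[OF t] P Ric_cont] integrable_continuous_mfd[OF metric[OF t] P RE_cont]
    by simp
  also have "\<dots> = (\<Sum>k\<in>I. integral (cbox (a k) (b k)) (\<lambda>x. pu k (cinv (ch k) x) *
      (2 * ?Ric (cinv (ch k) x) - ?RE (cinv (ch k) x)) * vol (g t) (ch k) x))"
    by (rule integral_eq_sum_charts[OF metric[OF t] P])
      (intro continuous_on_diff continuous_on_mult_left Ric_cont RE_cont)
  also have "\<dots> = (\<Sum>k\<in>I. integral (cbox (a k) (b k)) (\<lambda>x. \<Sum>i\<in>UNIV. \<Sum>j\<in>UNIV. w k x * e k i j t x * q' k i j x))"
  proof (intro sum.cong refl integral_cong)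
    fix k x assume k: "k \<in> I" and x: "x \<in> cbox (a k) (b k)"
    have sc: "scalar_curvature A (g t) (cinv (ch k) x) = trace (Hm t (ch k) x ** Rc t (ch k) x)"
      unfolding scalar_curvature_def
      by (rule trace_wrt_chart[OF metric[OF t] covariant_ricci[OF t] PD(3)[OF k] cm(1)[OF k x]])
    show "pu k (cinv (ch k) x) * (2 * ?Ric (cinv (ch k) x) - ?RE (cinv (ch k) x)) * vol (g t) (ch k) x =
        (\<Sum>i\<in>UNIV. \<Sum>j\<in>UNIV. w k x * e k i j t x * q' k i j x)"
      unfolding sc cometric_chart[OF metric[OF t] fC1[OF t] fC1[OF t] PD(3)[OF k] cm(1)[OF k x]]
        tensor_apply_grad_chart[OF metric[OF t] covariant_ricci[OF t] fC1[OF t] fC1[OF t] PD(3)[OF k] cm(1)[OF k x]]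
        inner_matrix_vector_sum dvec_nth[OF PD(3)[OF k] cm(2)[OF k x]]
      by (simp add: w_def e_def q'_def sum_distrib_left sum_distrib_right algebra_simps sum_subtractf)
  qed
  also have "\<dots> = (\<Sum>k\<in>I. \<Sum>i\<in>UNIV. \<Sum>j\<in>UNIV. integral (cbox (a k) (b k)) (\<lambda>x. w k x * e k i j t x * q' k i j x))"
    by (intro sum.cong refl chart_sum q'_cont t)
  finally show ?thesis
    using Lim_transform_eventually[OF L E] by simp
qed

lemma eigenvalue_derivative:
  assumes t: "t \<in> J" and f: "C1_into_Cinf A J f"
    and ev: "\<And>s. s \<in> J \<Longrightarrow> eigenfunction A (g s) (lam s) (f s)"
    and norm: "(\<integral>p. (f t p)\<^sup>2 \<partial>riemannian_measure A (g t)) = 1"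
  shows "(lam has_real_derivative
       (lam t * (\<integral>p. (f t p)\<^sup>2 * scalar_curvature A (g t) p \<partial>riemannian_measure A (g t))
        - (\<integral>p. scalar_curvature A (g t) p
               * tensor_apply A (g t) (grad (g t) (f t)) (grad (g t) (f t)) p \<partial>riemannian_measure A (g t))
        + 2 * (\<integral>p. tensor_apply A (ricci (g t)) (grad (g t) (f t)) (grad (g t) (f t)) p
             \<partial>riemannian_measure A (g t)))) (at t within J)"
proof -
  define X where "X s r = (\<integral>p. f s p * f t p \<partial>riemannian_measure A (g r))" for s r
  define Y where "Y s r = (\<integral>p. cometric A (g r) (f s) (f t) p \<partial>riemannian_measure A (g r))" for s r
  define SR where "SR = (\<integral>p. (f t p)\<^sup>2 * scalar_curvature A (g t) p \<partial>riemannian_measure A (g t))"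
  define RE where "RE = (\<integral>p. scalar_curvature A (g t) p * cometric A (g t) (f t) (f t) p \<partial>riemannian_measure A (g t))"
  define RG where "RG = (\<integral>p. tensor_apply A (ricci (g t)) (grad (g t) (f t)) (grad (g t) (f t)) p \<partial>riemannian_measure A (g t))"
  note fC1 = C1_mfd_C1_into_Cinf[OF f]
  \<comment> \<open>\<open>green\<close> expects the eigenfunction of the metric in use in the
    second slot. At time \<open>s\<close> this is \<open>f s\<close>, whence the swap by symmetry;
    at time \<open>t\<close> it is \<open>f t\<close> already.\<close>
  have Y_s: "Y s s = lam s * X s s" and Y_t: "Y s t = lam t * X s t" if s: "s \<in> J" for s
  proof -
    have "Y s s = (\<integral>p. cometric A (g s) (f t) (f s) p \<partial>riemannian_measure A (g s))"
      unfolding Y_def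
      by (rule Bochner_Integration.integral_cong[OF refl cometric_commute[OF metric[OF s]]])
    also have "\<dots> = lam s * X s s"
      unfolding X_def using green[OF metric[OF s] fC1[OF t] ev[OF s]] by (simp add: mult.commute)
    finally show "Y s s = lam s * X s s" .
    show "Y s t = lam t * X s t"
      unfolding X_def Y_def by (rule green[OF metric[OF t] fC1[OF s] ev[OF t]])
  qed
  have "X t t = 1"
    using norm by (simp add: X_def power2_eq_square)
  then have X_lim: "((\<lambda>s. X s s) \<longlongrightarrow> 1) (at t within J)"
    using tendsto_mass_quotient(2)[OF f t] by (simp add: X_def)
  have XQ: "((\<lambda>s. (X s s - X s t) / (s - t)) \<longlongrightarrow> - SR) (at t within J)"
    using tendsto_mass_quotient(1)[OF f t] by (simp add: X_def SR_def)
  have YQ: "((\<lambda>s. (Y s s - Y s t) / (s - t)) \<longlongrightarrow> 2 * RG - RE) (at t within J)"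
    using tendsto_energy_quotient[OF f t] by (simp add: Y_def RG_def RE_def)
  \<comment> \<open>Division by \<open>X s s\<close> is harmless near \<open>t\<close>, where it
    tends to 1. The inner sign of \<open>SR\<close> comes from the derivative -R of the
    density.\<close>
  have "((\<lambda>s. ((Y s s - Y s t) / (s - t) - lam t * ((X s s - X s t) / (s - t))) / X s s) \<longlongrightarrow>
      (2 * RG - RE - lam t * (- SR)) / 1) (at t within J)"
    by (intro tendsto_intros X_lim XQ YQ) simp
  moreover have "\<forall>\<^sub>F s in at t within J.
      ((Y s s - Y s t) / (s - t) - lam t * ((X s s - X s t) / (s - t))) / X s s = (lam s - lam t) / (s - t)"
  proof -
    have "\<forall>\<^sub>F s in at t within J. X s s \<noteq> 0"
      using X_lim by (rule tendsto_imp_eventually_ne) simp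
    moreover have "\<forall>\<^sub>F s in at t within J. s \<in> J \<and> s \<noteq> t"
      by (simp add: eventually_at_filter)
    ultimately show ?thesis
    proof eventually_elim
      case (elim s)
      then have "(Y s s - Y s t) - lam t * (X s s - X s t) = (lam s - lam t) * X s s"
        by (simp add: Y_s Y_t algebra_simps)
      then have "(Y s s - Y s t) / (s - t) - lam t * ((X s s - X s t) / (s - t)) = (lam s - lam t) * X s s / (s - t)"
        by (simp flip: diff_divide_distrib)
      then show ?case
        using elim by simp
    qed
  qed
  ultimately have "((\<lambda>s. (lam s - lam t) / (s - t)) \<longlongrightarrow> (2 * RG - RE - lam t * (- SR)) / 1) (at t within J)"
    by (rule Lim_transform_eventually)
  then show ?thesis
    unfolding has_field_derivative_iff tensor_apply_metric_grad[OF metric[OF t]]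
    by (simp add: SR_def RE_def RG_def algebra_simps)
qed

end

theorem proposition2p1:
  fixes A :: "('m::{t2_space, second_countable_topology}, 'n::finite) chart set"
    and T :: ereal
    and g :: "real \<Rightarrow> ('m, 'n) tensor2"
    and g0 :: "('m, 'n) tensor2"
    and lam :: "real \<Rightarrow> real"
    and f :: "real \<Rightarrow> 'm \<Rightarrow> real"
  assumes "closed_manifold A"
    and "0 < T"
    and "ricci_flow A (flow_interval T) g"
    and "g 0 = g0"
    and "evolving_eigenvalue A (flow_interval T) g lam f"
  shows "\<forall>t\<in>flow_interval T.
    (lam has_real_derivative
       (lam t * (\<integral>p. (f t p)\<^sup>2 * scalar_curvature A (g t) p \<partial>riemannian_measure A (g t))
        - (\<integral>p. scalar_curvature A (g t) p
               * tensor_apply A (g t) (grad (g t) (f t)) (grad (g t) (f t)) p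
             \<partial>riemannian_measure A (g t))
        + 2 * (\<integral>p. tensor_apply A (ricci (g t)) (grad (g t) (f t)) (grad (g t) (f t)) p
             \<partial>riemannian_measure A (g t))))
    (at t within flow_interval T)"
proof
  fix t assume t: "t \<in> flow_interval T"
  let ?J = "flow_interval T"
  have J: "is_interval ?J"
    unfolding is_interval_1 flow_interval_def by (auto intro: le_less_trans[of "ereal _" "ereal _"])
  \<comment> \<open>\<open>T\<close> may be infinite; a real \<open>r\<close> strictly between 0 and
    \<open>T\<close> shows that the interval has more than one point.\<close>
  obtain r where r: "0 < r" "ereal r < T"
    using ereal_dense2[OF assms(2)] by (metis less_ereal.simps(1) zero_ereal_def)
  have sub: "{0..r} \<subseteq> ?J"
    using r(2) by (auto simp: flow_interval_def intro: le_less_trans[of "ereal _" "ereal r"])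
  \<comment> \<open>A connected set with more than one point has no isolated points; this includes
    the endpoint 0 of the interval.\<close>
  have nontrivial: "at s within ?J \<noteq> bot" if "s \<in> ?J" for s
  proof -
    have "connected ?J"
      using J by (simp add: is_interval_connected_1)
    moreover have "\<not> (\<exists>x. ?J = {x})"
      using sub r(1) by (metis atLeastAtMost_iff less_eq_real_def order_refl singletonD subset_eq less_irrefl)
    ultimately show ?thesis
      using connected_imp_perfect[of ?J s] that by (simp add: trivial_limit_within)
  qed
  interpret ricci_flow_mfd A ?J g
    by standard (use assms(1,3) nontrivial J in \<open>auto simp: is_interval_convex_1\<close>)
  from assms(5) show "(lam has_real_derivative
       (lam t * (\<integral>p. (f t p)\<^sup>2 * scalar_curvature A (g t) p \<partial>riemannian_measure A (g t))
        - (\<integral>p. scalar_curvature A (g t) p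
               * tensor_apply A (g t) (grad (g t) (f t)) (grad (g t) (f t)) p
             \<partial>riemannian_measure A (g t))
        + 2 * (\<integral>p. tensor_apply A (ricci (g t)) (grad (g t) (f t)) (grad (g t) (f t)) p
             \<partial>riemannian_measure A (g t))))
    (at t within ?J)"
    using t unfolding evolving_eigenvalue_def by (intro eigenvalue_derivative) auto
qed

end
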